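(* Let $\lambda\in\mathbb{C}\setminus\mathbb{Z}$ and $t\in\mathbb{C}\setminus\{0\}$. In the Lie superalgebra (with supercommutator) of polynomial differential operators on $\mathbb{C}[x,\theta]$ with $x$ even and $\theta$ odd, consider the odd operator $X=x\partial_\theta+x\theta\partial_x-\lambda\theta$, the even operator $Y=\partial_x$, and the odd operator $Z=t(\partial_x\partial_\theta-\theta\partial_x^2)$, and let $\mathfrak{osp}(\lambda+1|\lambda)$ be the Lie subsuperalgebra they generate. Let $\mathfrak F$ be the free Lie superalgebra on an odd generator $X$, an even generator $Y$ and an odd generator $Z$, and put $Y_i=(\operatorname{ad}X)^iY$, $Z_i=(\operatorname{ad}X)^iZ$. Then the natural homomorphism $\mathfrak F\to\mathfrak{osp}(\lambda+1|\lambda)$ is surjective and its kernel is the ideal generated by: (0.1) $[Y,Y_1]=0$; (0.2) $[Y_2,Y]=2Y$; (0.3) $[Y_2,X]=-X$; (1.1) $[Y,Z]=0$; (1.2) $[[X,Y],Z]=0$; (1.3) $(\operatorname{ad}X)^7Z=0$; (1.4) $[Y_2,Z]=3Z$; (2.1) $3[Z,Z_3]+2[Z_1,Z_2]=6t(2\lambda+1)\,Z$; (2.2) $[Z_1,Z_3]=2t^2(\lambda-1)(\lambda+2)\,Y+2t(2\lambda+1)\,Z_1$; (3.1) $[Z_1,[Z,Z]]=0$.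
   Context: All brackets are supercommutators $[a,b]=ab-(-1)^{p(a)p(b)}ba$ (so for odd $a$, $[a,a]=2a^2$), and $\operatorname{ad}X(w)=[X,w]$. $X$ is the image of the odd generator $\nabla^+$ of a superprincipally embedded $\mathfrak{osp}(1|2)$; $Z$ is a lowest weight vector (weight $-3$) of an irreducible $\mathfrak{osp}(1|2)$-submodule with odd highest weight vector of highest weight $3$ (dimension 7). Relation (1.3) expresses that this module is 7-dimensional. *)

theory Defs
  imports "HOL-Computational_Algebra.Polynomial"
begin

text \<open>An element f0 + f1*theta of C[x,theta] (x even, theta odd, theta^2 = 0)
  is represented by the pair (f0, f1).  Polynomial differential operators are
  represented by their (faithful) action on C[x,theta].\<close>

type_synonym sfun = "complex poly \<times> complex poly"
type_synonym sop = "sfun \<Rightarrow> sfun"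

definition op_zero :: sop where "op_zero = (\<lambda>v. (0, 0))"
definition op_add :: "sop \<Rightarrow> sop \<Rightarrow> sop" where
  "op_add A B = (\<lambda>v. (fst (A v) + fst (B v), snd (A v) + snd (B v)))"
definition op_smul :: "complex \<Rightarrow> sop \<Rightarrow> sop" where
  "op_smul c A = (\<lambda>v. (smult c (fst (A v)), smult c (snd (A v))))"

text \<open>Sign (-1)^(p q) for parities p, q (True = odd).\<close>
definition sgn_par :: "bool \<Rightarrow> bool \<Rightarrow> complex" where
  "sgn_par p q = (if p \<and> q then -1 else 1)"

definition op_br :: "bool \<Rightarrow> bool \<Rightarrow> sop \<Rightarrow> sop \<Rightarrow> sop" where
  "op_br p q A B = op_add (A \<circ> B) (op_smul (- sgn_par p q) (B \<circ> A))"

definition d_x :: sop where "d_x = (\<lambda>(f0, f1). (pderiv f0, pderiv f1))"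
definition d_th :: sop where "d_th = (\<lambda>(f0, f1). (f1, 0))"
definition mul_x :: sop where "mul_x = (\<lambda>(f0, f1). ([:0, 1:] * f0, [:0, 1:] * f1))"
definition mul_th :: sop where "mul_th = (\<lambda>(f0, f1). (0, f0))"

definition opX :: "complex \<Rightarrow> sop" where
  "opX lam = op_add (op_add (mul_x \<circ> d_th) (mul_x \<circ> mul_th \<circ> d_x)) (op_smul (- lam) mul_th)"
definition opY :: sop where "opY = d_x"
definition opZ :: "complex \<Rightarrow> sop" where
  "opZ t = op_smul t (op_add (d_x \<circ> d_th) (op_smul (-1) (mul_th \<circ> d_x \<circ> d_x)))"

inductive ospH :: "complex \<Rightarrow> complex \<Rightarrow> sop \<Rightarrow> bool \<Rightarrow> bool" for lam t where
  genX: "ospH lam t (opX lam) True"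
| genY: "ospH lam t opY False"
| genZ: "ospH lam t (opZ t) True"
| zero: "ospH lam t op_zero p"
| add: "ospH lam t A p \<Longrightarrow> ospH lam t B p \<Longrightarrow> ospH lam t (op_add A B) p"
| smul: "ospH lam t A p \<Longrightarrow> ospH lam t (op_smul c A) p"
| br: "ospH lam t A p \<Longrightarrow> ospH lam t B q \<Longrightarrow> ospH lam t (op_br p q A B) (p \<noteq> q)"

definition osp :: "complex \<Rightarrow> complex \<Rightarrow> sop set" where
  "osp lam t = {op_add A B | A B. ospH lam t A False \<and> ospH lam t B True}"

datatype gen = GX | GY | GZ

datatype expr = Gen gen | Zero | Add expr expr | Smul complex expr | Br expr expr

fun gen_par :: "gen \<Rightarrow> bool" where
  "gen_par GX = True" | "gen_par GY = False" | "gen_par GZ = True"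

inductive hom :: "expr \<Rightarrow> bool \<Rightarrow> bool" where
  "hom (Gen g) (gen_par g)"
| "hom Zero p"
| "hom a p \<Longrightarrow> hom b p \<Longrightarrow> hom (Add a b) p"
| "hom a p \<Longrightarrow> hom (Smul c a) p"
| "hom a p \<Longrightarrow> hom b q \<Longrightarrow> hom (Br a b) (p \<noteq> q)"

text \<open>The congruence generated by the complex vector space axioms, bilinearity of the bracket,
  the Lie superalgebra axioms (super-antisymmetry, super-Jacobi on homogeneous elements) and the
  extra relations R.  With R = {} the quotient is the free Lie superalgebra F; in general
  e ~_R Zero iff the class of e in F lies in the ideal of F generated by the elements l - r,
  (l, r) in R.\<close>
inductive liecong :: "(expr \<times> expr) set \<Rightarrow> expr \<Rightarrow> expr \<Rightarrow> bool" for R where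
  rel: "(a, b) \<in> R \<Longrightarrow> liecong R a b"
| refl: "liecong R a a"
| sym: "liecong R a b \<Longrightarrow> liecong R b a"
| trans: "liecong R a b \<Longrightarrow> liecong R b c \<Longrightarrow> liecong R a c"
| cong_add: "liecong R a a' \<Longrightarrow> liecong R b b' \<Longrightarrow> liecong R (Add a b) (Add a' b')"
| cong_smul: "liecong R a a' \<Longrightarrow> liecong R (Smul c a) (Smul c a')"
| cong_br: "liecong R a a' \<Longrightarrow> liecong R b b' \<Longrightarrow> liecong R (Br a b) (Br a' b')"
| add_assoc: "liecong R (Add (Add a b) c) (Add a (Add b c))"
| add_comm: "liecong R (Add a b) (Add b a)"
| add_zero: "liecong R (Add a Zero) a"
| add_neg: "liecong R (Add a (Smul (-1) a)) Zero"
| smul_one: "liecong R (Smul 1 a) a"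
| smul_smul: "liecong R (Smul c (Smul d a)) (Smul (c * d) a)"
| smul_add_scalar: "liecong R (Smul (c + d) a) (Add (Smul c a) (Smul d a))"
| smul_add: "liecong R (Smul c (Add a b)) (Add (Smul c a) (Smul c b))"
| br_add_left: "liecong R (Br (Add a b) c) (Add (Br a c) (Br b c))"
| br_add_right: "liecong R (Br a (Add b c)) (Add (Br a b) (Br a c))"
| br_smul_left: "liecong R (Br (Smul c a) b) (Smul c (Br a b))"
| br_smul_right: "liecong R (Br a (Smul c b)) (Smul c (Br a b))"
| antisym: "hom a p \<Longrightarrow> hom b q \<Longrightarrow>
    liecong R (Br a b) (Smul (- sgn_par p q) (Br b a))"
| jacobi: "hom a p \<Longrightarrow> hom b q \<Longrightarrow>
    liecong R (Br a (Br b c)) (Add (Br (Br a b) c) (Smul (sgn_par p q) (Br b (Br a c))))"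

fun evalp :: "complex \<Rightarrow> complex \<Rightarrow> expr \<Rightarrow> sop \<times> sop" where
  "evalp lam t (Gen GX) = (op_zero, opX lam)"
| "evalp lam t (Gen GY) = (opY, op_zero)"
| "evalp lam t (Gen GZ) = (op_zero, opZ t)"
| "evalp lam t Zero = (op_zero, op_zero)"
| "evalp lam t (Add a b) =
     (op_add (fst (evalp lam t a)) (fst (evalp lam t b)),
      op_add (snd (evalp lam t a)) (snd (evalp lam t b)))"
| "evalp lam t (Smul c a) = (op_smul c (fst (evalp lam t a)), op_smul c (snd (evalp lam t a)))"
| "evalp lam t (Br a b) =
     (op_add (op_br False False (fst (evalp lam t a)) (fst (evalp lam t b)))
             (op_br True True (snd (evalp lam t a)) (snd (evalp lam t b))),
      op_add (op_br False True (fst (evalp lam t a)) (snd (evalp lam t b)))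
             (op_br True False (snd (evalp lam t a)) (fst (evalp lam t b))))"

definition nat_hom :: "complex \<Rightarrow> complex \<Rightarrow> expr \<Rightarrow> sop" where
  "nat_hom lam t e = op_add (fst (evalp lam t e)) (snd (evalp lam t e))"

abbreviation eX where "eX \<equiv> Gen GX"
abbreviation eY where "eY \<equiv> Gen GY"
abbreviation eZ where "eZ \<equiv> Gen GZ"

definition adX :: "nat \<Rightarrow> expr \<Rightarrow> expr" where "adX i = (Br eX) ^^ i"

definition eYi :: "nat \<Rightarrow> expr" where "eYi i = adX i eY"
definition eZi :: "nat \<Rightarrow> expr" where "eZi i = adX i eZ"

definition rels :: "complex \<Rightarrow> complex \<Rightarrow> (expr \<times> expr) set" where
  "rels lam t = {
     (Br eY (eYi 1), Zero),
     (Br (eYi 2) eY, Smul 2 eY),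
     (Br (eYi 2) eX, Smul (-1) eX),
     (Br eY eZ, Zero),
     (Br (Br eX eY) eZ, Zero),
     (adX 7 eZ, Zero),
     (Br (eYi 2) eZ, Smul 3 eZ),
     (Add (Smul 3 (Br eZ (eZi 3))) (Smul 2 (Br (eZi 1) (eZi 2))), Smul (6 * t * (2 * lam + 1)) eZ),
     (Br (eZi 1) (eZi 3),
        Add (Smul (2 * t^2 * (lam - 1) * (lam + 2)) eY) (Smul (2 * t * (2 * lam + 1)) (eZi 1))),
     (Br (eZi 1) (Br eZ eZ), Zero)}"

end

theory Submission
  imports Defs "HOL-Library.Product_Plus"
begin

text \<open>
  In the quotient of the free algebra by the relations write \<open>p = [X,Y]\<close> and \<open>q = X\<close>, and filter it
  by the number of occurrences of \<open>Z\<close>. In the associated graded algebra the even elements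
  \<open>a = Z\<^sub>1\<close>, \<open>b = Z\<^sub>3/2\<close>, \<open>c = Z\<^sub>5/2\<close> commute (this is (2.2) up to lower terms), and
  \<open>[a,q] = [b,p]\<close>, \<open>[b,q] = [c,p]\<close>. Hence the module that they generate from \<open>p\<close> and \<open>q\<close> is a quotient
  of the odd polynomials in two commuting variables \<open>p\<close>, \<open>q\<close>, with \<open>a\<close>, \<open>b\<close>, \<open>c\<close> acting as multiplication by
  \<open>p\<^sup>2\<close>, \<open>pq\<close>, \<open>q\<^sup>2\<close>. By induction on the degree, brackets of \<open>p\<close>, \<open>q\<close> with this module depend
  only on the product of the polynomials (even degree) or on their Poisson bracket (odd degree); relation (3.1)
  starts this induction. So the degree \<open>d\<close> part of the graded algebra is at most one irreducible
  \<open>osp(1|2)\<close>-module. The differential operators contain a lowest weight vector of each of these weights,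
  and the resulting elements are linearly independent, which forces the kernel to be the ideal of relations.
\<close>

text \<open>Counting explains \<open>wt\<close>. Degree d contains 2d+2 monomials of degree 2d+1.
  Their brackets with p and q add at most 2d+3 elements if d is even (products, of degree 2d+2) and
  2d+1 if d is odd (Poisson brackets, of degree 2d). Both totals are 2 \<open>wt d\<close> + 1, the
  dimension of the irreducible module whose lowest weight vector has H-eigenvalue
  \<open>wt d\<close>. The delicate step leads from an even degree e to e + 1. Symmetry of the
  bracket of odd elements settles everything there except whether \<open>a\<close> annihilates
  [p, p^(2e+1)]. For e = 0 it does since [a, Y] = 0, for e = 2 this is the cubic relation, and for
  every larger even e it has to be derived, which is the purpose of the elements U and V.
  Independence rests on two facts. Repeated application of p shortens every chain until only lowest
  weight vectors are left, and the operator belonging to d acts on functions without theta through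
  their derivative of order d + 1.\<close>

definition wt :: "nat \<Rightarrow> nat" where "wt d = (if even d then 2 * d + 2 else 2 * d + 1)"

section \<open>Lie superalgebras with a parity predicate\<close>

text \<open>Parity is a predicate, and signs are prescribed for homogeneous arguments only. An
  element need not split into an even and an odd part, so a quotient can be modelled on a carrier
  type that is larger than the algebra.\<close>

locale super_lie = vector_space scale
  for scale :: "complex \<Rightarrow> 'a::ab_group_add \<Rightarrow> 'a" (infixr "*s" 75) +
  fixes br :: "'a \<Rightarrow> 'a \<Rightarrow> 'a" and par :: "bool \<Rightarrow> 'a \<Rightarrow> bool"
  assumes br_add_left: "br (x + y) z = br x z + br y z"
    and br_add_right: "br x (y + z) = br x y + br x z"
    and br_scale_left: "br (k *s x) y = k *s br x y"
    and br_scale_right: "br x (k *s y) = k *s br x y"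
    and par_scale: "par r x \<Longrightarrow> par r (k *s x)"
    and par_add: "par r x \<Longrightarrow> par r y \<Longrightarrow> par r (x + y)"
    and par_br: "par r x \<Longrightarrow> par q y \<Longrightarrow> par (r \<noteq> q) (br x y)"
    and antisym: "par r x \<Longrightarrow> par q y \<Longrightarrow> br x y = (- sgn_par r q) *s br y x"
    and jacobi: "par r x \<Longrightarrow> par q y \<Longrightarrow>
      br x (br y z) = br (br x y) z + sgn_par r q *s br y (br x z)"
begin

abbreviation "even_el \<equiv> par False"
abbreviation "odd_el \<equiv> par True"

lemma br_zero_left [simp]: "br 0 y = 0"
  using br_scale_left[of 0 0 y] by simp

lemma br_zero_right [simp]: "br x 0 = 0"
  using br_scale_right[of x 0 0] by simp

lemma br_minus_left [simp]: "br (- x) y = - br x y"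
  using br_scale_left[of "-1" x y] by simp

lemma br_minus_right [simp]: "br x (- y) = - br x y"
  using br_scale_right[of x "-1" y] by simp

lemma br_diff_left: "br (x - y) z = br x z - br y z"
  using br_add_left[of x "- y" z] by simp

lemma br_diff_right: "br x (y - z) = br x y - br x z"
  using br_add_right[of x y "- z"] by simp

lemma antisym_even: "even_el x \<Longrightarrow> par q y \<Longrightarrow> br x y = - br y x"
  using antisym[of False x q y] by (simp add: sgn_par_def)

lemma antisym_odd: "odd_el x \<Longrightarrow> odd_el y \<Longrightarrow> br x y = br y x"
  using antisym[of True x True y] by (simp add: sgn_par_def)

lemma jacobi_even:
  "even_el x \<Longrightarrow> par q y \<Longrightarrow> br x (br y z) = br (br x y) z + br y (br x z)"
  using jacobi[of False x q y z] by (simp add: sgn_par_def)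

lemma jacobi_odd:
  "odd_el x \<Longrightarrow> odd_el y \<Longrightarrow> br x (br y z) = br (br x y) z - br y (br x z)"
  using jacobi[of True x True y z] by (simp add: sgn_par_def)

lemmas jacobi_ee = jacobi_even[where q = False] and jacobi_eo = jacobi_even[where q = True]

lemma par_br_ee: "even_el x \<Longrightarrow> even_el y \<Longrightarrow> even_el (br x y)"
  and par_br_eo: "even_el x \<Longrightarrow> odd_el y \<Longrightarrow> odd_el (br x y)"
  and par_br_oe: "odd_el x \<Longrightarrow> even_el y \<Longrightarrow> odd_el (br x y)"
  and par_br_oo: "odd_el x \<Longrightarrow> odd_el y \<Longrightarrow> even_el (br x y)"
  using par_br[of False x False y] par_br[of False x True y]
    par_br[of True x False y] par_br[of True x True y] by auto

definition functional :: "('a \<Rightarrow> complex) \<Rightarrow> bool" where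
  "functional \<phi> \<longleftrightarrow> (\<forall>x y. \<phi> (x + y) = \<phi> x + \<phi> y) \<and> (\<forall>k x. \<phi> (k *s x) = k * \<phi> x)"

lemma functional_simps:
  assumes "functional \<phi>"
  shows "\<phi> (x + y) = \<phi> x + \<phi> y" "\<phi> (k *s x) = k * \<phi> x" "\<phi> 0 = 0" "\<phi> (- x) = - \<phi> x"
    "\<phi> (x - y) = \<phi> x - \<phi> y"
proof -
  have add: "\<phi> (x + y) = \<phi> x + \<phi> y" and sc: "\<phi> (k *s x) = k * \<phi> x" for x y k
    using assms by (auto simp: functional_def)
  show "\<phi> (x + y) = \<phi> x + \<phi> y" "\<phi> (k *s x) = k * \<phi> x" by (fact add, fact sc)
  show "\<phi> 0 = 0" using sc[of 0 0] by simp
  show neg: "\<phi> (- x) = - \<phi> x" for x using sc[of "-1" x] by simp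
  show "\<phi> (x - y) = \<phi> x - \<phi> y" using add[of x "- y"] neg[of y] by simp
qed

text \<open>Turns vector identities into identities of complex numbers.\<close>

lemma vec_eqI:
  assumes "\<And>\<phi>. functional \<phi> \<Longrightarrow> \<phi> x = \<phi> y"
  shows "x = y"
proof (rule ccontr)
  assume "x \<noteq> y"
  interpret cvs: vector_space "(*) :: complex \<Rightarrow> complex \<Rightarrow> complex"
    by unfold_locales (auto simp: algebra_simps)
  interpret vsp: vector_space_pair scale "(*) :: complex \<Rightarrow> complex \<Rightarrow> complex"
    by unfold_locales
  have ind: "independent {x - y}"
    using \<open>x \<noteq> y\<close> by simp
  from vsp.linear_independent_extend[OF this, of "\<lambda>_. 1"]
  obtain g where g: "Vector_Spaces.linear scale (*) g" "g (x - y) = 1"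
    by auto
  interpret g: Vector_Spaces.linear scale "(*)" g by (fact g(1))
  have "functional g"
    by (auto simp: functional_def g.add g.scale)
  from assms[OF this] have "g (x - y) = 0"
    by (simp add: g.diff)
  with g(2) show False by simp
qed

text \<open>The equation \<open>u = v\<close> becomes a hypothesis on the values of an arbitrary
  functional, so its consequences are found by elimination among complex numbers.\<close>

lemma vec_eqI1:
  assumes "u = v" and "\<And>\<phi>. functional \<phi> \<Longrightarrow> \<phi> u = \<phi> v \<longrightarrow> \<phi> x = \<phi> y"
  shows "x = y"
  using assms by (intro vec_eqI) simp

lemma eq_halfI:
  fixes x y :: 'a
  assumes "x = y + y - x"
  shows "x = y"
  by (rule vec_eqI1[OF assms], simp only: functional_simps, algebra)

end

section \<open>The associated graded algebra\<close>

text \<open>All relations are homogeneous in the number of Z. For the bracket of Z_1 and Z_3, whose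
  prescribed value has smaller degree, this means that it becomes zero.\<close>

locale graded_osp = super_lie scale br par
  for scale :: "complex \<Rightarrow> 'a::ab_group_add \<Rightarrow> 'a" (infixr "*s" 75) and br par +
  fixes X Y Z :: 'a
  assumes par_X: "par True X" and par_Y: "par False Y" and par_Z: "par True Z"
    and Y_Y1: "br Y (br X Y) = 0"
    and Y2_Y: "br (br X (br X Y)) Y = 2 *s Y"
    and Y2_X: "br (br X (br X Y)) X = - X"
    and Y1_Z: "br (br X Y) Z = 0"
    and X7_Z: "(br X ^^ 7) Z = 0"
    and Y2_Z: "br (br X (br X Y)) Z = 3 *s Z"
    and Z1_Z3: "br (br X Z) ((br X ^^ 3) Z) = 0"
    and Z1_Z_Z: "br (br X Z) (br Z Z) = 0"
begin

section \<open>The copy of osp(1|2) and its seven-dimensional module\<close>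

definition "p = br X Y"
definition "H = br X p"
definition "Q = (1/2) *s br X X"
definition "Zi i = (br X ^^ i) Z"
definition "a = Zi 1"
definition "b = (1/2) *s Zi 3"
definition "c = (1/2) *s Zi 5"

lemma Zi_0 [simp]: "Zi 0 = Z" by (simp add: Zi_def)
lemma Zi_Suc: "Zi (Suc i) = br X (Zi i)" by (simp add: Zi_def)

lemma par_p: "odd_el p" unfolding p_def by (intro par_br_oe par_X par_Y)
lemma par_H: "even_el H" unfolding H_def by (intro par_br_oo par_X par_p)
lemma par_Q: "even_el Q" unfolding Q_def by (intro par_scale par_br_oo par_X)

lemma par_Zi: "par (even i) (Zi i)"
proof (induction i)
  case (Suc i)
  then show ?case
    using par_br[OF par_X Suc] by (simp add: Zi_Suc)
qed (use par_Z in simp)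

lemma par_a: "even_el a" and par_b: "even_el b" and par_c: "even_el c"
  using par_Zi[of 1] par_Zi[of 3] par_Zi[of 5] by (auto simp: a_def b_def c_def intro: par_scale)

lemmas par_intros = par_X par_Y par_Z par_p par_H par_Q par_a par_b par_c
  par_br_ee par_br_eo par_br_oe par_br_oo par_scale

text \<open>For odd X the square of ad X is ad of half of [X, X]; \<open>Q\<close> plays the role of
  the square of X.\<close>

lemma X_X: "br X (br X w) = br Q w"
proof (rule eq_halfI)
  show "br X (br X w) = br Q w + br Q w - br X (br X w)"
    by (subst jacobi_odd[OF par_X par_X, of w], intro vec_eqI) (simp add: Q_def br_scale_left functional_simps)
qed

lemma X_p: "br X (br p w) = br H w - br p (br X w)"
  using jacobi_odd[OF par_X par_p, of w] by (simp add: H_def)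

lemma Y_p [simp]: "br Y p = 0" using Y_Y1 by (simp add: p_def)
lemma H_Y: "br H Y = 2 *s Y" using Y2_Y by (simp add: p_def H_def)
lemma H_X: "br H X = - X" using Y2_X by (simp add: p_def H_def)
lemma X_H: "br X H = X" using H_X antisym_even[OF par_H par_X] by simp

lemma Y_X: "br Y X = - p"
  using antisym_even[OF par_Y par_X] by (simp add: p_def)

lemma H_p: "br H p = p"
proof -
  have "br H p = br (br H X) Y + br X (br H Y)"
    unfolding p_def by (intro jacobi_eo par_intros)
  then show ?thesis
    by (intro vec_eqI) (simp add: H_X H_Y br_scale_right functional_simps flip: p_def)
qed

lemma p_Y [simp]: "br p Y = 0"
  using antisym_even[OF par_Y par_p] by simp

lemma p_X: "br p X = H"
  using antisym_odd[OF par_p par_X] by (simp add: H_def)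

lemma p_p_eq: "br p p = 2 *s Y"
  using X_p[of Y] H_Y by (simp add: p_def[symmetric])

lemma p_p: "br p (br p w) = br Y w"
proof (rule eq_halfI)
  have "br (2 *s Y) w = br Y w + br Y w"
    by (intro vec_eqI) (simp add: br_scale_left functional_simps)
  then show "br p (br p w) = br Y w + br Y w - br p (br p w)"
    using jacobi_odd[OF par_p par_p, of w] by (simp add: p_p_eq)
qed

lemma Q_p: "br Q p = X"
  by (simp add: X_H flip: X_X H_def)

text \<open>Put u = [X,[X,X]]. The Jacobi identity gives u = [Q,X], which is half of [[X,X],X] = -u;
  hence 3u = 0.\<close>

lemma Q_X [simp]: "br Q X = 0"
proof -
  let ?u = "br X (br X X)"
  have "?u = br Q X" by (rule X_X)
  also have "\<dots> = (1/2) *s br (br X X) X"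
    by (simp add: Q_def br_scale_left)
  also have "br (br X X) X = - ?u"
    by (rule antisym_even[OF par_br_oo[OF par_X par_X] par_X])
  finally have eq: "?u = (1/2) *s (- ?u)" .
  have "?u = 0"
    by (rule vec_eqI1[OF eq], simp only: functional_simps, algebra)
  then show ?thesis by (simp add: X_X)
qed

lemma H_Z: "br H Z = 3 *s Z" using Y2_Z by (simp add: p_def H_def)
lemma p_Z [simp]: "br p Z = 0" using Y1_Z by (simp add: p_def)

lemma H_Zi: "br H (Zi i) = (3 - of_nat i) *s Zi i"
proof (induction i)
  case (Suc i)
  have "br H (br X (Zi i)) = br (br H X) (Zi i) + br X (br H (Zi i))"
    by (intro jacobi_eo par_intros)
  then have "br H (br X (Zi i)) = - br X (Zi i) + (3 - of_nat i) *s br X (Zi i)"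
    by (simp only: H_X Suc br_scale_right br_minus_left)
  also have "\<dots> = (3 - of_nat (Suc i)) *s br X (Zi i)"
    by (intro vec_eqI) (simp add: functional_simps algebra_simps)
  finally show ?case by (simp only: Zi_Suc)
qed (simp add: H_Z)

lemma p_Zi_Suc: "br p (Zi (Suc i)) = (3 - of_nat i) *s Zi i - br X (br p (Zi i))"
  using X_p[of "Zi i"] by (simp add: H_Zi Zi_Suc algebra_simps)

lemma X_Zi: "br X (Zi i) = Zi (Suc i)" by (simp add: Zi_Suc)

lemma Zi_7: "Zi 7 = 0" using X7_Z by (simp add: Zi_def)

text \<open>The recursion k_(i+1) = (3 - i) - k_i with k_0 = 0 produces the coefficients 3, -1, 2,
  -2, 1, -3.\<close>

lemma p_Zi:
  "br p (Zi 1) = 3 *s Zi 0" "br p (Zi 2) = - Zi 1" "br p (Zi 3) = 2 *s Zi 2"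
  "br p (Zi 4) = - (2 *s Zi 3)" "br p (Zi 5) = Zi 4" "br p (Zi 6) = - (3 *s Zi 5)"
proof -
  show 1: "br p (Zi 1) = 3 *s Zi 0"
    using p_Zi_Suc[of 0] by simp
  show 2: "br p (Zi 2) = - Zi 1"
    using p_Zi_Suc[of 1] 1 X_Zi[of 0]
    by (intro vec_eqI) (simp add: br_scale_right functional_simps flip: numeral_2_eq_2)
  show 3: "br p (Zi 3) = 2 *s Zi 2"
    using p_Zi_Suc[of 2] 2
    by (intro vec_eqI) (simp add: X_Zi br_scale_right functional_simps algebra_simps flip: One_nat_def)
  show 4: "br p (Zi 4) = - (2 *s Zi 3)"
    using p_Zi_Suc[of 3] 3
    by (intro vec_eqI) (simp add: X_Zi br_scale_right functional_simps algebra_simps)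
  show 5: "br p (Zi 5) = Zi 4"
    by (rule vec_eqI1[OF p_Zi_Suc[of 4, simplified 4 br_minus_right br_scale_right X_Zi]])
      (simp add: functional_simps)
  show 6: "br p (Zi 6) = - (3 *s Zi 5)"
    by (rule vec_eqI1[OF p_Zi_Suc[of 5, simplified 5 X_Zi]]) (simp add: functional_simps)
qed

lemma Zi_p: "odd i \<Longrightarrow> br (Zi i) p = - br p (Zi i)"
  using antisym_even[of "Zi i", OF _ par_p] par_Zi[of i] by simp

lemma Zi_X: "odd i \<Longrightarrow> br (Zi i) X = - Zi (Suc i)"
  using antisym_even[of "Zi i", OF _ par_X] par_Zi[of i] by (simp add: X_Zi)

text \<open>The factors 1/2 in \<open>b\<close> and \<open>c\<close> are chosen so that [a,X] =
  [b,p] and [b,X] = [c,p]. These two coincidences make monomials in p and q meaningful.\<close>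

lemma a_p: "br a p = - (3 *s Zi 0)" and b_p: "br b p = - Zi 2" and c_p: "br c p = - ((1/2) *s Zi 4)"
  and a_X: "br a X = - Zi 2" and b_X: "br b X = - ((1/2) *s Zi 4)"
  and c_X: "br c X = - ((1/2) *s Zi 6)"
  using Zi_p[of 1] Zi_p[of 3] Zi_p[of 5] Zi_X[of 1] Zi_X[of 3] Zi_X[of 5]
  by (simp_all add: a_def b_def c_def br_scale_left p_Zi p_Zi[unfolded One_nat_def]
      flip: numeral_2_eq_2)

lemma Q_Zi: "br Q (Zi i) = Zi (Suc (Suc i))"
  by (simp add: X_Zi flip: X_X)

lemma Y_Zi: "br Y (Zi i) = br p (br p (Zi i))"
  by (simp add: p_p)

lemma Q_a: "br Q a = 2 *s b" and Q_b: "br Q b = c" and Q_c: "br Q c = 0"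
  using Zi_7 by (simp_all add: a_def b_def c_def br_scale_right Q_Zi eval_nat_numeral)

lemma Y_a: "br Y a = 0" and Y_c: "br Y c = - (2 *s b)"
  by (simp_all add: a_def b_def c_def br_scale_right Y_Zi p_Zi p_Zi[unfolded One_nat_def])

lemma H_a: "br H a = 2 *s a" and H_c: "br H c = - (2 *s c)"
  by (simp_all add: a_def b_def c_def H_Zi br_scale_right)

lemma br_even_self: "even_el x \<Longrightarrow> br x x = 0"
  using antisym_even[of x False x] by (intro eq_halfI[of "br x x" 0]) (simp only: add_0_left diff_0)

lemma ab_zero: "br a b = 0"
  using Z1_Z3 by (simp add: a_def b_def br_scale_right Zi_def)

text \<open>The derivation \<open>Q\<close> maps a to 2b, b to c and c to 0, so the single relation
  [a,b] = 0 spreads to the other pairs.\<close>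

lemma ac_zero: "br a c = 0"
proof -
  have "br Q (br a b) = br (br Q a) b + br a (br Q b)"
    by (intro jacobi_ee par_intros)
  then show ?thesis
    by (simp add: ab_zero Q_a Q_b br_scale_left br_even_self par_b)
qed

lemma bc_zero: "br b c = 0"
proof -
  have "br Q (br a c) = br (br Q a) c + br a (br Q c)"
    by (intro jacobi_ee par_intros)
  then show ?thesis
    by (simp add: ac_zero Q_a Q_c br_scale_left)
qed

lemma b_a: "br b (br a w) = br a (br b w)"
  using jacobi_ee[OF par_a par_b, of w] by (simp only: ab_zero br_zero_left add_0_left)

lemma c_a: "br c (br a w) = br a (br c w)"
  using jacobi_ee[OF par_a par_c, of w] by (simp only: ac_zero br_zero_left add_0_left)

lemma c_b: "br c (br b w) = br b (br c w)"
  using jacobi_ee[OF par_b par_c, of w] by (simp only: bc_zero br_zero_left add_0_left)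

section \<open>Odd monomials in two commuting variables\<close>

lemmas br_lin = br_add_left br_add_right br_diff_left br_diff_right br_scale_left br_scale_right
  br_minus_left br_minus_right br_zero_left br_zero_right

text \<open>\<open>m n j\<close> stands for the monomial \<open>p\<^bsup>2n+1-j\<^esup> q\<^bsup>j\<^esup>\<close>, on which \<open>a\<close>, \<open>b\<close>, \<open>c\<close> act as
  multiplication by \<open>p\<^sup>2\<close>, \<open>pq\<close>, \<open>q\<^sup>2\<close>, \<open>Q\<close> as \<open>q \<partial>/\<partial>p\<close> and \<open>Y\<close> as \<open>-p \<partial>/\<partial>q\<close>.\<close>

fun m :: "nat \<Rightarrow> nat \<Rightarrow> 'a" where
  "m 0 j = (if j = 0 then p else X)"
| "m (Suc n) j = (if j \<le> 2 * n + 1 then br a (m n j) else br c (m n (j - 2)))"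

lemma par_m: "odd_el (m n j)"
  by (induction n arbitrary: j) (auto intro: par_intros)

lemma a_m: "j \<le> 2 * n + 1 \<Longrightarrow> br a (m n j) = m (Suc n) j"
  by simp

lemma c_m: "j \<le> 2 * n + 1 \<Longrightarrow> br c (m n j) = m (Suc n) (j + 2)"
proof (induction n arbitrary: j)
  case 0
  then show ?case by auto
next
  case (Suc n)
  show ?case
  proof (cases "j \<le> 2 * n + 1")
    case True
    then have "br c (m (Suc n) j) = br a (br c (m n j))"
      by (simp add: c_a)
    also have "\<dots> = br a (m (Suc n) (j + 2))"
      using True Suc.IH by simp
    also have "\<dots> = m (Suc (Suc n)) (j + 2)"
      using True by (intro a_m) simp
    finally show ?thesis .
  next
    case False
    then show ?thesis by simp
  qed
qed

text \<open>The definition of \<open>m\<close> builds monomials with a and c only. That b multiplies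
  by pq reduces, by commutativity, to degree 0, where it is the coincidence [b,p] = [a,X] and [b,X]
  = [c,p].\<close>

lemma b_m: "j \<le> 2 * n + 1 \<Longrightarrow> br b (m n j) = m (Suc n) (j + 1)"
proof (induction n arbitrary: j)
  case 0
  then consider "j = 0" | "j = 1" by linarith
  then show ?case by cases (simp_all add: b_p a_X b_X c_p)
next
  case (Suc n)
  show ?case
  proof (cases "j \<le> 2 * n + 1")
    case True
    then have "br b (m (Suc n) j) = br a (br b (m n j))"
      by (simp add: b_a)
    also have "\<dots> = br a (m (Suc n) (j + 1))"
      using True Suc.IH by simp
    also have "\<dots> = m (Suc (Suc n)) (j + 1)"
      using True by (intro a_m) simp
    finally show ?thesis .
  next
    case False
    then have "br b (m (Suc n) j) = br c (br b (m n (j - 2)))"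
      using c_b by simp
    also have "\<dots> = br c (m (Suc n) (j - 1))"
      using False Suc.IH[of "j - 2"] Suc.prems by (simp add: numeral_2_eq_2 Suc_diff_Suc)
    also have "\<dots> = m (Suc (Suc n)) (j + 1)"
      using False Suc.prems by (subst c_m) auto
    finally show ?thesis .
  qed
qed

lemma m_1: "m 1 0 = - (3 *s Z)" "m 1 (Suc 0) = - Zi 2" "m 1 2 = - ((1/2) *s Zi 4)"
    "m 1 3 = - ((1/2) *s Zi 6)"
  by (simp_all add: a_p a_X c_p c_X)

declare m.simps(2) [simp del]

text \<open>At \<open>j = 2 * n + 1\<close> the coefficient is zero, which makes the meaningless
  value \<open>m n (2 * n + 2)\<close> harmless. The case split on this j inside the proof serves
  the same purpose.\<close>

lemma Q_m: "j \<le> 2 * n + 1 \<Longrightarrow> br Q (m n j) = (2 * of_nat n + 1 - of_nat j) *s m n (Suc j)"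
proof (induction n arbitrary: j)
  case 0
  then consider "j = 0" | "j = 1" by linarith
  then show ?case by cases (simp_all add: Q_p)
next
  case (Suc n)
  show ?case
  proof (cases "j \<le> 2 * n + 1")
    case True
    have "br Q (br a (m n j)) = br (br Q a) (m n j) + br a (br Q (m n j))"
      by (rule jacobi_ee[OF par_Q par_a])
    also have "\<dots> = 2 *s m (Suc n) (j + 1) + (2 * of_nat n + 1 - of_nat j) *s br a (m n (Suc j))"
      using True Suc.IH by (simp add: Q_a br_lin b_m)
    also have "(2 * of_nat n + 1 - of_nat j) *s br a (m n (Suc j))
        = (2 * of_nat n + 1 - of_nat j) *s m (Suc n) (Suc j)"
    proof (cases "j = 2 * n + 1")
      case False
      with True show ?thesis by (simp add: a_m)
    qed simp
    also have "2 *s m (Suc n) (j + 1) + (2 * of_nat n + 1 - of_nat j) *s m (Suc n) (Suc j)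
        = (2 * of_nat (Suc n) + 1 - of_nat j) *s m (Suc n) (Suc j)"
      by (intro vec_eqI) (simp add: functional_simps algebra_simps)
    finally show ?thesis
      using True by (simp only: a_m)
  next
    case False
    define i where "i = j - 2"
    have j: "j = i + 2" "i \<le> 2 * n + 1" using False Suc.prems by (auto simp: i_def)
    have "br Q (br c (m n i)) = br (br Q c) (m n i) + br c (br Q (m n i))"
      by (rule jacobi_ee[OF par_Q par_c])
    also have "\<dots> = (2 * of_nat n + 1 - of_nat i) *s br c (m n (Suc i))"
      using j Suc.IH by (simp add: Q_c br_lin)
    also have "\<dots> = (2 * of_nat n + 1 - of_nat i) *s m (Suc n) (Suc j)"
    proof (cases "i = 2 * n + 1")
      case False
      with j show ?thesis by (simp add: c_m)
    qed simp
    finally show ?thesis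
      using j by (simp add: c_m)
  qed
qed

lemma Y_m: "j \<le> 2 * n + 1 \<Longrightarrow> br Y (m n j) = (- of_nat j) *s m n (j - 1)"
proof (induction n arbitrary: j)
  case 0
  then consider "j = 0" | "j = 1" by linarith
  then show ?case by cases (simp_all add: Y_X)
next
  case (Suc n)
  show ?case
  proof (cases "j \<le> 2 * n + 1")
    case True
    have "br Y (br a (m n j)) = br (br Y a) (m n j) + br a (br Y (m n j))"
      by (rule jacobi_ee[OF par_Y par_a])
    then show ?thesis
      using True Suc.IH by (simp add: Y_a br_lin a_m)
  next
    case False
    define i where "i = j - 2"
    have j: "j = i + 2" "i \<le> 2 * n + 1" using False Suc.prems by (auto simp: i_def)
    have "br Y (br c (m n i)) = br (br Y c) (m n i) + br c (br Y (m n i))"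
      by (rule jacobi_ee[OF par_Y par_c])
    also have "\<dots> = - (2 *s m (Suc n) (i + 1)) - of_nat i *s br c (m n (i - 1))"
      using j Suc.IH by (simp add: Y_c br_lin b_m)
    also have "of_nat i *s br c (m n (i - 1)) = of_nat i *s m (Suc n) (i + 1)"
    proof (cases "i = 0")
      case False
      with j have "br c (m n (i - 1)) = m (Suc n) (i - 1 + 2)" by (intro c_m) simp
      with False show ?thesis by simp
    qed simp
    also have "- (2 *s m (Suc n) (i + 1)) - of_nat i *s m (Suc n) (i + 1)
        = (- of_nat j) *s m (Suc n) (j - 1)"
      using j by (intro vec_eqI) (simp add: functional_simps algebra_simps)
    finally show ?thesis
      using j by (simp add: c_m)
  qed
qed

lemma H_m: "j \<le> 2 * n + 1 \<Longrightarrow> br H (m n j) = (2 * of_nat n + 1 - 2 * of_nat j) *s m n j"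
proof (induction n arbitrary: j)
  case 0
  then consider "j = 0" | "j = 1" by linarith
  then show ?case by cases (simp_all add: H_p H_X)
next
  case (Suc n)
  show ?case
  proof (cases "j \<le> 2 * n + 1")
    case True
    have "br H (br a (m n j)) = br (br H a) (m n j) + br a (br H (m n j))"
      by (rule jacobi_ee[OF par_H par_a])
    also have "\<dots> = 2 *s m (Suc n) j + (2 * of_nat n + 1 - 2 * of_nat j) *s m (Suc n) j"
      using True Suc.IH by (simp add: H_a br_lin a_m)
    also have "\<dots> = (2 * of_nat (Suc n) + 1 - 2 * of_nat j) *s m (Suc n) j"
      by (intro vec_eqI) (simp add: functional_simps algebra_simps)
    finally show ?thesis
      using True by (simp only: a_m)
  next
    case False
    define i where "i = j - 2"
    have j: "j = i + 2" "i \<le> 2 * n + 1" using False Suc.prems by (auto simp: i_def)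
    have "br H (br c (m n i)) = br (br H c) (m n i) + br c (br H (m n i))"
      by (rule jacobi_ee[OF par_H par_c])
    also have "\<dots> = (-2) *s m (Suc n) j + (2 * of_nat n + 1 - 2 * of_nat i) *s m (Suc n) j"
      using j Suc.IH by (simp add: H_c br_lin c_m)
    also have "\<dots> = (2 * of_nat (Suc n) + 1 - 2 * of_nat j) *s m (Suc n) j"
      using j by (intro vec_eqI) (simp add: functional_simps algebra_simps)
    finally show ?thesis
      using j by (simp add: c_m)
  qed
qed

section \<open>Brackets of monomials, degree by degree\<close>

abbreviation pw :: "nat \<Rightarrow> 'a" where "pw n \<equiv> m n 0"

definition T :: "nat \<Rightarrow> nat \<Rightarrow> 'a" where "T i j = br (pw i) (pw j)"

lemma T_sym: "T i j = T j i"
  unfolding T_def by (intro antisym_odd par_m)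

lemma a_T: "br a (T i j) = T (Suc i) j + T i (Suc j)"
  using jacobi_eo[OF par_a par_m] by (simp add: T_def a_m)

lemma Q_br_p: "br Q (br p w) = br X w + br p (br Q w)"
  using jacobi_eo[OF par_Q par_p] by (simp add: Q_p)

lemma Q_br_X: "br Q (br X w) = br X (br Q w)"
  using jacobi_eo[OF par_Q par_X] by simp

text \<open>A common index for the three quadratic elements: \<open>gv i\<close> multiplies by
  p^(2-i) q^i.\<close>

definition gv :: "nat \<Rightarrow> 'a" where "gv i = (if i = 0 then a else if i = 1 then b else c)"

lemma par_gv: "even_el (gv i)"
  by (simp add: gv_def par_a par_b par_c)

lemma gv_m: "i \<le> 2 \<Longrightarrow> j \<le> 2 * n + 1 \<Longrightarrow> br (gv i) (m n j) = m (Suc n) (j + i)"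
  by (auto simp: gv_def a_m b_m c_m le_Suc_eq numeral_2_eq_2)

lemma gv_gv: "br (gv i) (br (gv k) w) = br (gv k) (br (gv i) w)"
  by (simp add: gv_def b_a c_a c_b)

text \<open>In degree \<open>d\<close> the bracket of \<open>m 0 i\<close> with \<open>m d j\<close> depends only on the product
  (\<open>d\<close> even) or on the Poisson bracket (\<open>d\<close> odd) of the monomials that they represent.\<close>

definition even_deg :: "nat \<Rightarrow> bool" where
  "even_deg d \<longleftrightarrow> (\<forall>i\<le>d. T i (d - i) = (-1) ^ i *s T 0 d) \<and>
     (\<forall>j\<le>2 * d. br p (m d (Suc j)) = br X (m d j))"

text \<open>With {p,q} = 1, the Poisson bracket of p with p^(2d-j) q^(j+1) is j+1 times p^(2d-j)
  q^j, and that of q with p^(2d+1-j) q^j is -(2d+1-j) times the same monomial; this is the second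
  clause. At \<open>j = 2 * d + 1\<close> it says that X annihilates q^(2d+1). The third clause is
  what carries the induction to the next even degree.\<close>

definition odd_deg :: "nat \<Rightarrow> bool" where
  "odd_deg d \<longleftrightarrow> (\<forall>i\<le>d. T i (d - i) = 0) \<and>
     (\<forall>j\<le>2 * d + 1. (2 * of_nat d + 1 - of_nat j) *s br p (m d (Suc j))
          + (of_nat j + 1) *s br X (m d j) = 0) \<and>
     (\<forall>j\<le>2 * d + 1. \<forall>i\<le>2. br (gv i) (br p (m d j)) = 0 \<and> br (gv i) (br X (m d j)) = 0)"

text \<open>The \<open>m 1 j\<close> are the odd vectors of the seven-dimensional module up to
  scalars. Their brackets with p and X are multiples of a, b, c, which commute with each
  other.\<close>

lemma odd_deg_1: "odd_deg 1"
proof -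
  have T01: "T 0 1 = 0"
    by (simp add: T_def m_1[simplified] br_lin)
  then have T10: "T 1 0 = 0" by (simp add: T_sym)
  have px: "br p (m 1 0) = 0" "br p (m 1 1) = a" "br p (m 1 2) = 2 *s b" "br p (m 1 3) = 3 *s c"
    using p_Zi[unfolded One_nat_def]
    by (simp_all add: m_1[simplified] br_lin a_def b_def c_def)
  have X: "br X (m 1 0) = (-3) *s a" "br X (m 1 1) = (-2) *s b" "br X (m 1 2) = (-1) *s c" "br X (m 1 3) = 0"
    using Zi_7 X_Zi[of 0] X_Zi[of 2] X_Zi[of 4] X_Zi[of 6] m_1[simplified]
    by (simp_all add: br_lin a_def b_def c_def flip: numeral_2_eq_2)
  have comm: "br g h = 0" if "g \<in> {a, b, c}" "h \<in> {a, b, c}" for g h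
    using that ab_zero ac_zero bc_zero antisym_even[OF par_a par_b] antisym_even[OF par_a par_c]
      antisym_even[OF par_b par_c]
    by (auto simp: br_even_self par_a par_b par_c)
  have g: "a \<in> {a, b, c}" "b \<in> {a, b, c}" "c \<in> {a, b, c}" by auto
  have small: "j = 0 \<or> j = 1 \<or> j = 2 \<or> j = 3" if "j \<le> 2 * 1 + 1" for j :: nat
    using that by linarith
  note px' = px[unfolded numeral_2_eq_2 numeral_3_eq_3 One_nat_def]
  note X' = X[unfolded numeral_2_eq_2 numeral_3_eq_3 One_nat_def]
  have small': "i \<le> 1 \<Longrightarrow> i = 0 \<or> i = 1" for i :: nat by linarith
  show ?thesis
    unfolding odd_deg_def
  proof (intro conjI allI impI ballI)
    fix i :: nat assume "i \<le> 1"
    then show "T i (1 - i) = 0" using T01 T10 small'[of i] by auto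
  next
    fix j :: nat assume j: "j \<le> 2 * 1 + 1"
    show "(2 * of_nat 1 + 1 - of_nat j) *s br p (m 1 (Suc j)) + (of_nat j + 1) *s br X (m 1 j) = 0"
      using small[OF j] by (elim disjE) (simp_all add: px' X' numeral_2_eq_2 numeral_3_eq_3)
  next
    fix i j :: nat assume "j \<le> 2 * 1 + 1"
    define h where "h = gv i"
    have h: "h \<in> {a, b, c}" by (simp add: h_def gv_def)
    note zero = comm[OF h g(1)] comm[OF h g(2)] comm[OF h g(3)]
    show "br (gv i) (br p (m 1 j)) = 0" unfolding h_def[symmetric]
      using small[OF \<open>j \<le> 2 * 1 + 1\<close>] by (elim disjE) (simp_all only: px br_lin zero scale_zero_right)
    show "br (gv i) (br X (m 1 j)) = 0" unfolding h_def[symmetric]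
      using small[OF \<open>j \<le> 2 * 1 + 1\<close>] by (elim disjE) (simp_all only: X br_lin zero scale_zero_right)
  qed
qed

text \<open>The quadratic elements act as derivations, and [gv i, p] and [gv i, X] are the cubics
  \<open>m 1 i\<close> and \<open>m 1 (Suc i)\<close>. The overlap of these two families drives the
  induction on the degree.\<close>

lemma gv_br_p:
  "i \<le> 2 \<Longrightarrow> j \<le> 2 * n + 1 \<Longrightarrow> br (gv i) (br p (m n j)) = br (m 1 i) (m n j) + br p (m (Suc n) (j + i))"
  and gv_br_X:
  "i \<le> 2 \<Longrightarrow> j \<le> 2 * n + 1 \<Longrightarrow> br (gv i) (br X (m n j)) = br (m 1 (Suc i)) (m n j) + br X (m (Suc n) (j + i))"
  using jacobi_eo[OF par_gv par_p, of i "m n j"] jacobi_eo[OF par_gv par_X, of i "m n j"]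
    gv_m[of i 0 0] gv_m[of i 1 0] gv_m[of i j n]
  by simp_all

text \<open>Applying quadratic elements to the brackets of degree d gives zero. Hence
  -[m 1 (i+1), m d k] equals both [p, m (d+1) (k+i+1)], through \<open>gv (i+1)\<close>, and
  [X, m (d+1) (k+i)], through \<open>gv i\<close>.\<close>

lemma odd_deg_Suc:
  assumes "odd_deg d"
  shows "even_deg (Suc d)"
proof -
  have T0: "T i (d - i) = 0" if "i \<le> d" for i
    using assms that unfolding odd_deg_def by blast
  have g0: "br (gv i) (br p (m d j)) = 0" "br (gv i) (br X (m d j)) = 0"
    if "i \<le> 2" "j \<le> 2 * d + 1" for i j
    using assms that unfolding odd_deg_def by blast+
  have "T i (Suc d - i) = (-1) ^ i *s T 0 (Suc d)" if "i \<le> Suc d" for i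
    using that
  proof (induction i)
    case (Suc i)
    have "0 = br a (T i (d - i))" using Suc.prems by (simp add: T0)
    also have "\<dots> = T (Suc i) (d - i) + T i (Suc d - i)"
      using Suc.prems by (simp add: a_T Suc_diff_le)
    finally have "T (Suc i) (d - i) = - T i (Suc d - i)"
      by (simp add: eq_neg_iff_add_eq_0)
    then show ?case using Suc by simp
  qed simp
  moreover have "br p (m (Suc d) (Suc j)) = br X (m (Suc d) j)" if "j \<le> 2 * Suc d" for j
  proof -
    \<comment> \<open>The bound i \<le> 1 keeps \<open>gv (i+1)\<close> among the three quadratic
      elements; i = 1 is needed only for the last j.\<close>
    obtain i k where ik: "i \<le> 1" "k \<le> 2 * d + 1" "j = k + i"
    proof (cases "j \<le> 2 * d + 1")
      case True
      then show ?thesis using that[of 0 j] by simp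
    next
      case False
      then show ?thesis using that[of 1 "2 * d + 1"] \<open>j \<le> 2 * Suc d\<close> by simp
    qed
    have "br p (m (Suc d) (k + Suc i)) = - br (m 1 (Suc i)) (m d k)"
      using gv_br_p[of "Suc i" k d] g0(1)[of "Suc i" k] ik
      by (simp add: eq_neg_iff_add_eq_0 add.commute)
    also have "\<dots> = br X (m (Suc d) (k + i))"
      using gv_br_X[of i k d] g0(2)[of i k] ik
      by (simp add: neg_eq_iff_add_eq_0 add.commute)
    finally show ?thesis using ik by simp
  qed
  ultimately show ?thesis by (auto simp: even_deg_def)
qed

section \<open>From an even degree to the next odd degree\<close>

context
  fixes e :: nat
  assumes even_e: "even e" and deg_e: "even_deg e" and s0: "br a (T 0 e) = 0"
begin

text \<open>The brackets alternate in i, and i runs up to the odd number e + 1. So the last bracket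
  is minus the first, while symmetry makes them equal.\<close>

lemma T_vanish:
  assumes "i \<le> Suc e"
  shows "T i (Suc e - i) = 0"
proof -
  have alt: "T i (Suc e - i) = (-1) ^ i *s T 0 (Suc e)" if "i \<le> Suc e" for i
    using that
  proof (induction i)
    case (Suc i)
    have "0 = br a (T i (e - i))"
      using Suc.prems deg_e s0 by (simp add: even_deg_def br_lin)
    also have "\<dots> = T (Suc i) (e - i) + T i (Suc e - i)"
      using Suc.prems by (simp add: a_T Suc_diff_le)
    finally have "T (Suc i) (e - i) = - T i (Suc e - i)"
      by (simp add: eq_neg_iff_add_eq_0)
    then show ?case using Suc by simp
  qed simp
  have "T 0 (Suc e) = - T 0 (Suc e)"
    using alt[of "Suc e"] even_e T_sym[of "Suc e" 0] by simp
  then have "T 0 (Suc e) = 0"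
    by (intro eq_halfI[of _ 0]) simp
  then show ?thesis using alt[OF assms] by simp
qed

abbreviation (input) "D \<equiv> Suc e"

text \<open>The chain starts with [p, m D 0] = 0 and is carried on by \<open>Q\<close>. Each
  application produces the common factor 2D + 1 - j, which is nonzero and can be cancelled.\<close>

lemma pX_rel:
  "j \<le> 2 * D + 1 \<Longrightarrow>
    (2 * of_nat D + 1 - of_nat j) *s br p (m D (Suc j)) + (of_nat j + 1) *s br X (m D j) = 0"
proof (induction j)
  case 0
  have "br p (m D 0) = 0"
    using T_vanish[of 0] by (simp add: T_def)
  then show ?case
    using Q_br_p[of "m D 0"] Q_m[of 0 D] by (simp add: br_lin add.commute)
next
  case (Suc j)
  let ?N = "2 * of_nat D + 1 :: complex"
  have ne: "?N - of_nat j \<noteq> 0"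
    using Suc.prems of_nat_eq_iff[where 'a = complex, of "2 * D + 1" j] by simp
  have "br Q ((?N - of_nat j) *s br p (m D (Suc j)) + (of_nat j + 1) *s br X (m D j)) = 0"
    using Suc by simp
  then have eq: "(?N - of_nat j) *s (br X (m D (Suc j)) + (?N - of_nat (Suc j)) *s br p (m D (Suc (Suc j))))
      + (of_nat j + 1) *s ((?N - of_nat j) *s br X (m D (Suc j))) = 0"
    using Q_m[of j D] Q_m[of "Suc j" D] Suc.prems by (simp add: br_lin Q_br_p Q_br_X)
  have "(?N - of_nat j) *s ((?N - of_nat (Suc j)) *s br p (m D (Suc (Suc j)))
     + (of_nat (Suc j) + 1) *s br X (m D (Suc j))) = 0"
    by (rule vec_eqI1[OF eq], simp only: functional_simps of_nat_Suc, algebra)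
  then show ?case using ne by (simp only: scale_eq_0_iff) simp
qed

text \<open>The class of p^(2D-j) q^j among the brackets of degree D, normalised so that brackets
  with p and X become Poisson brackets with {p,q} = 1.\<close>

definition E :: "nat \<Rightarrow> 'a" where
  "E j = (1 / (of_nat j + 1)) *s br p (m D (Suc j))"

lemma p_mD: "br p (m D j) = of_nat j *s E (j - 1)"
proof (cases j)
  case 0
  then show ?thesis using T_vanish[of 0] by (simp add: T_def)
next
  case (Suc i)
  have "1 + of_nat i \<noteq> (0::complex)"
    by (metis of_nat_Suc of_nat_eq_0_iff nat.distinct(1))
  then show ?thesis by (simp add: Suc E_def add.commute)
qed

lemma X_mD:
  assumes "j \<le> 2 * D + 1"
  shows "br X (m D j) = - ((2 * of_nat D + 1 - of_nat j) *s E j)"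
proof -
  have ne: "of_nat j + 1 \<noteq> (0::complex)"
    by (metis of_nat_Suc of_nat_eq_0_iff nat.distinct(1) add.commute)
  have "(of_nat j + 1) *s br X (m D j) = (of_nat j + 1) *s - ((2 * of_nat D + 1 - of_nat j) *s E j)"
    by (rule vec_eqI1[OF pX_rel[OF assms]])
      (simp add: p_mD functional_simps of_nat_Suc[symmetric] del: of_nat_Suc, simp add: algebra_simps)
  then show ?thesis using ne by (simp only: scale_left_imp_eq) 
qed

lemma Q_E:
  assumes "l \<le> 2 * D"
  shows "br Q (E l) = (2 * of_nat D - of_nat l) *s E (Suc l)"
proof -
  have ne: "of_nat l + 1 \<noteq> (0::complex)"
    by (metis of_nat_Suc of_nat_eq_0_iff nat.distinct(1) add.commute)
  have eq: "(of_nat l + 1) *s br Q (E l) = br X (m D (Suc l)) + (2 * of_nat D - of_nat l) *s br p (m D (Suc (Suc l)))"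
    using Q_br_p[of "m D (Suc l)"] Q_m[of "Suc l" D] assms
    by (simp add: br_lin p_mD add.commute)
  have "(of_nat l + 1) *s br Q (E l) = (of_nat l + 1) *s ((2 * of_nat D - of_nat l) *s E (Suc l))"
    using assms
    by (intro vec_eqI1[OF eq]) (simp add: p_mD X_mD functional_simps algebra_simps)
  then show ?thesis using ne by (simp only: scale_left_imp_eq)
qed

text \<open>The quadratic \<open>gv i\<close> is applied to both sides of the product rule in degree
  e. The constant 2D + 2 is the sum of i + j + 1 from the bracket with p and 2D + 1 - (i + j) from
  the bracket with X.\<close>

lemma B_diff:
  assumes "i \<le> 2" "j \<le> 2 * e"
  shows "br (m 1 i) (m e (Suc j)) = br (m 1 (Suc i)) (m e j) - (2 * of_nat D + 2) *s E (i + j)"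
proof -
  have "br (gv i) (br p (m e (Suc j))) = br (gv i) (br X (m e j))"
    using deg_e assms by (simp add: even_deg_def)
  then have eq: "br (m 1 i) (m e (Suc j)) + br p (m D (Suc j + i)) = br (m 1 (Suc i)) (m e j) + br X (m D (j + i))"
    using assms gv_br_p[of i "Suc j" e] gv_br_X[of i j e] by simp
  show ?thesis
    using assms
    by (intro vec_eqI1[OF eq]) (simp add: p_mD X_mD functional_simps, simp add: algebra_simps)
qed

lemma Q_B:
  assumes "i \<le> 3" "j \<le> 2 * e + 1"
  shows "br Q (br (m 1 i) (m e j)) =
    (3 - of_nat i) *s br (m 1 (Suc i)) (m e j) + (2 * of_nat e + 1 - of_nat j) *s br (m 1 i) (m e (Suc j))"
  using jacobi_eo[OF par_Q par_m, of "1" i "m e j"] Q_m[of i 1] Q_m[of j e] assms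
  by (simp add: br_lin)

text \<open>The coefficient is that of minus the Poisson bracket of p^(3-i) q^i with p^(2e+1-j) q^j.
  Induction on l = i + j: applying \<open>Q\<close> gives one equation for two neighbouring
  brackets, \<open>B_diff\<close> gives their difference, and the system is solvable because 2e + 4
  - l is nonzero.\<close>

lemma B_eq:
  "i \<le> 3 \<Longrightarrow> j \<le> 2 * e + 1 \<Longrightarrow> i + j = l \<Longrightarrow>
    br (m 1 i) (m e j) = (of_nat i * (2 * of_nat e + 1) - 3 * of_nat j) *s E (l - 1)"
proof (induction l arbitrary: i j)
  case 0
  then show ?case using T_vanish[of 1] by (simp add: T_def)
next
  case (Suc l)
  \<comment> \<open>For l = 0 the index l - 1 is truncated to 0, so the formula holds only for
    coefficient zero.\<close>
  have QEl: "br Q (k *s E (l - 1)) = (k * (2 * of_nat e + 3 - of_nat l)) *s E l"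
    if "l = 0 \<Longrightarrow> k = 0" "l \<le> 2 * e + 3" for k
  proof (cases l)
    case 0
    then show ?thesis using that by simp
  next
    case (Suc l')
    have "2 * of_nat D - of_nat l' = (2 * of_nat e + 3 - of_nat l :: complex)"
      by (simp add: Suc)
    then show ?thesis using that(2) Q_E[of l'] Suc by (simp add: br_lin)
  qed
  have both: "br (m 1 (Suc i)) (m e j) = (of_nat (Suc i) * (2 * of_nat e + 1) - 3 * of_nat j) *s E l \<and>
     br (m 1 i) (m e (Suc j)) = (of_nat i * (2 * of_nat e + 1) - 3 * of_nat (Suc j)) *s E l"
    if ij: "i \<le> 2" "j \<le> 2 * e" "i + j = l" for i j
  proof -
    let ?x = "br (m 1 (Suc i)) (m e j)" and ?y = "br (m 1 i) (m e (Suc j))"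
    let ?k = "of_nat i * (2 * of_nat e + 1) - 3 * of_nat j :: complex"
    have l: "of_nat l = (of_nat i + of_nat j :: complex)" using ij by auto
    have ne: "2 * of_nat e + 4 - of_nat l \<noteq> (0::complex)"
      using ij of_nat_eq_iff[where 'a = complex, of "2 * e + 4" l] by simp
    have y: "?y = ?x - (2 * of_nat e + 4) *s E l"
      using B_diff[of i j] ij by (simp add: algebra_simps)
    have "(3 - of_nat i) *s ?x + (2 * of_nat e + 1 - of_nat j) *s ?y = (?k * (2 * of_nat e + 3 - of_nat l)) *s E l"
    proof -
      have "br (m 1 i) (m e j) = ?k *s E (l - 1)"
        using Suc.IH[of i j] ij by simp
      moreover have "br Q (?k *s E (l - 1)) = (?k * (2 * of_nat e + 3 - of_nat l)) *s E l"
        by (rule QEl) (use ij in auto)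
      ultimately show ?thesis using Q_B[of i j] ij by simp
    qed
    then have eq: "(3 - of_nat i) *s ?x + (2 * of_nat e + 1 - of_nat j) *s (?x - (2 * of_nat e + 4) *s E l)
      = (?k * (2 * of_nat e + 3 - of_nat l)) *s E l"
      unfolding y .
    have "(2 * of_nat e + 4 - of_nat l) *s ?x
        = (2 * of_nat e + 4 - of_nat l) *s ((of_nat (Suc i) * (2 * of_nat e + 1) - 3 * of_nat j) *s E l)"
      by (rule vec_eqI1[OF eq], simp only: functional_simps of_nat_Suc l, algebra)
    then have x: "?x = (of_nat (Suc i) * (2 * of_nat e + 1) - 3 * of_nat j) *s E l"
      using ne by (simp only: scale_left_imp_eq)
    have "?y = (of_nat i * (2 * of_nat e + 1) - 3 * of_nat (Suc j)) *s E l"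
      unfolding y x by (intro vec_eqI) (simp add: functional_simps algebra_simps)
    with x show ?thesis by blast
  qed
  consider "1 \<le> i" "j \<le> 2 * e" | "1 \<le> j" "i \<le> 2" | "i = 3" "j = 2 * e + 1"
    using Suc.prems by linarith
  then show ?case
  proof cases
    case 1
    then show ?thesis using both[of "i - 1" j] Suc.prems by simp
  next
    case 2
    then show ?thesis using both[of i "j - 1"] Suc.prems by simp
  next
    \<comment> \<open>The corner q^3, q^(2e+1) is out of reach of \<open>B_diff\<close>;
      \<open>Q\<close> leads to it from the neighbour with i = 2, and \<open>Q\<close> annihilates
      the last vector \<open>E (2 * D)\<close>.\<close>
    case 3
    then have l: "l = 2 * e + 3" "2 + (2 * e + 1) = l" using Suc.prems by auto
    have "br (m 1 3) (m e (2 * e + 1)) = br Q (br (m 1 2) (m e (2 * e + 1)))"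
      using Q_B[of 2 "2 * e + 1"] by (simp add: eval_nat_numeral)
    also have "\<dots> = 0"
      using Suc.IH[OF _ _ l(2)] QEl l(1) by simp
    finally show ?thesis using 3 l by simp
  qed
qed

text \<open>In the even degree e a bracket is determined by a product of degree 2e + 2 = 2D.
  \<open>F j\<close> is the class of p^(2D-j) q^j; the last one is a bracket with X because q^(2D)
  is not divisible by p.\<close>

definition F :: "nat \<Rightarrow> 'a" where
  "F j = (if j \<le> 2 * e + 1 then br p (m e j) else br X (m e (2 * e + 1)))"

text \<open>Quadratic elements map the even degree to the odd one by minus the Poisson bracket, here
  of p^(2-i) q^i with p^(2D-j) q^j.\<close>

lemma gv_F:
  assumes "i \<le> 2" "j \<le> 2 * D"
  shows "br (gv i) (F j) = (2 * (of_nat i * of_nat D - of_nat j)) *s E (i + j - 1)"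
proof (cases "j \<le> 2 * e + 1")
  case True
  then have "br (gv i) (F j) = (of_nat i * (2 * of_nat e + 1) - 3 * of_nat j) *s E (i + j - 1)
      + of_nat (j + i) *s E (j + i - 1)"
    using assms B_eq[of i j "i + j"] by (simp add: F_def gv_br_p p_mD)
  also have "\<dots> = (2 * (of_nat i * of_nat D - of_nat j)) *s E (i + j - 1)"
    by (intro vec_eqI) (simp add: functional_simps algebra_simps)
  finally show ?thesis .
next
  case False
  then have j: "j = 2 * e + 2" using assms by simp
  then have "br (gv i) (F j) = (of_nat (Suc i) * (2 * of_nat e + 1) - 3 * of_nat (2 * e + 1)) *s E (i + j - 1)
      - (2 * of_nat D + 1 - of_nat (2 * e + 1 + i)) *s E (i + j - 1)"
    using assms B_eq[of "Suc i" "2 * e + 1" "i + j"] by (simp add: F_def gv_br_X X_mD add.commute)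
  also have "\<dots> = (2 * (of_nat i * of_nat D - of_nat j)) *s E (i + j - 1)"
    using j by (intro vec_eqI) (simp add: functional_simps algebra_simps)
  finally show ?thesis .
qed

lemma gv_E_comm:
  assumes "i \<le> 2" "k \<le> 2" "j \<le> 2 * D"
  shows "(of_nat k * of_nat D - of_nat j) *s br (gv i) (E (k + j - 1))
       = (of_nat i * of_nat D - of_nat j) *s br (gv k) (E (i + j - 1))"
proof -
  have "br (gv i) (br (gv k) (F j)) = br (gv k) (br (gv i) (F j))" by (rule gv_gv)
  then have "2 *s ((of_nat k * of_nat D - of_nat j) *s br (gv i) (E (k + j - 1)))
       = 2 *s ((of_nat i * of_nat D - of_nat j) *s br (gv k) (E (i + j - 1)))"
    using assms by (simp only: gv_F br_lin scale_scale)
  then show ?thesis by (rule scale_left_imp_eq[rotated]) simp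
qed

text \<open>Two commuting quadratic elements are applied to some \<open>F n\<close> in both orders.
  For fixed l = i + j this yields linear equations between the elements \<open>x k\<close>; for 2
  \<le> l \<le> 2D there are three, with determinant 2 D (D + 1). At both ends of the range of l
  some \<open>x k\<close> fall outside and fewer equations suffice.\<close>

lemma gv_E:
  assumes "i \<le> 2" "j \<le> 2 * D"
  shows "br (gv i) (E j) = 0"
proof -
  define l where "l = i + j"
  define x where "x k = br (gv k) (E (l - k))" for k
  have l: "l \<le> 2 * D + 2" using assms by (simp add: l_def)
  have rel: "(of_nat k * of_nat D - of_nat n) *s x i = (of_nat i * of_nat D - of_nat n) *s x k"
    if "i \<le> 2" "k \<le> 2" "n \<le> 2 * D" "n + i + k = l + 1" for i k n
  proof -
    have "l - i = k + n - 1" "l - k = i + n - 1" using that by linarith+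
    then show ?thesis using gv_E_comm[of i k n] that by (simp only: x_def)
  qed
  note rels = rel[of 0 1 l] rel[of 0 2 "l - 1"] rel[of 1 2 "l - 2"]
  have D0: "of_nat D \<noteq> (0::complex)" by (metis of_nat_eq_0_iff nat.distinct(1))
  consider "l = 0" | "l = 1" | "2 \<le> l" "l \<le> 2 * D" | "l = 2 * D + 1" | "l = 2 * D + 2"
    using l by linarith
  then have "(i = 0 \<longrightarrow> x 0 = 0) \<and> (i = 1 \<longrightarrow> x 1 = 0) \<and> (i = 2 \<longrightarrow> x 2 = 0)"
  proof cases
    case 1
    then show ?thesis using rels(1) D0 assms by (auto simp: l_def simp del: of_nat_Suc)
  next
    case 2
    have "x 0 = 0" using rels(2) 2 D0 by (simp del: of_nat_Suc)
    moreover have "x 1 = 0" using rels(1) 2 \<open>x 0 = 0\<close> by simp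
    ultimately show ?thesis using 2 assms by (auto simp: l_def)
  next
    case 3
    have nl: "of_nat (l - 1) = (of_nat l - 1 :: complex)" "of_nat (l - 2) = (of_nat l - 2 :: complex)"
      using 3 by (auto simp: of_nat_diff)
    have one: "of_nat (Suc 0) = (1 :: complex)" and le: "l - 1 \<le> 2 * D" "l - 2 \<le> 2 * D"
      using 3 by auto
    let ?D = "of_nat D :: complex" and ?l = "of_nat l :: complex"
    have r1: "(?D - ?l) *s x 0 = (- ?l) *s x 1"
      using rels(1)[unfolded of_nat_1 of_nat_0] 3 by (simp del: of_nat_Suc)
    have r2: "(2 * ?D - ?l + 1) *s x 0 = (1 - ?l) *s x 2"
      using rels(2) 3 le nl by (simp del: of_nat_Suc add: one algebra_simps)
    have r3: "(2 * ?D - ?l + 2) *s x 1 = (?D - ?l + 2) *s x 2"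
      using rels(3) 3 le nl by (simp del: of_nat_Suc add: one algebra_simps)
    have n1: "2 * ?D - ?l + 1 \<noteq> 0" and n2: "2 * ?D - ?l + 2 \<noteq> 0"
      using of_nat_eq_iff[where 'a = complex, of "2 * D + 1" l] of_nat_eq_iff[where 'a = complex, of "2 * D + 2" l] 3
      by (auto simp: algebra_simps)
    have "?D + 1 \<noteq> 0"
      by (metis of_nat_neq_0 of_nat_Suc add.commute)
    then have n3: "2 * ?D * (?D + 1) \<noteq> 0"
      using D0 by (simp del: of_nat_Suc)
    have x2: "(2 * ?D * (?D + 1)) *s x 2 = 0"
    proof (rule vec_eqI)
      fix \<phi> assume f: "functional \<phi>"
      from r1 r2 r3 have "(?D - ?l) * \<phi> (x 0) = (- ?l) * \<phi> (x 1)"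
        "(2 * ?D - ?l + 1) * \<phi> (x 0) = (1 - ?l) * \<phi> (x 2)"
        "(2 * ?D - ?l + 2) * \<phi> (x 1) = (?D - ?l + 2) * \<phi> (x 2)"
        by (metis functional_simps(2)[OF f])+
      then have "(2 * ?D * (?D + 1)) * \<phi> (x 2) = 0"
        by algebra
      then show "\<phi> ((2 * ?D * (?D + 1)) *s x 2) = \<phi> 0"
        by (simp only: functional_simps[OF f])
    qed
    then have "x 2 = 0" using n3 by (simp only: scale_eq_0_iff) simp
    moreover have "x 1 = 0" using r3 \<open>x 2 = 0\<close> n2 by simp
    moreover have "x 0 = 0" using r2 \<open>x 2 = 0\<close> n1 by simp
    ultimately show ?thesis by simp
  next
    case 4
    have "(2 * of_nat D - of_nat (2 * D)) *s x 0 = (- of_nat (2 * D)) *s x 2"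
      using rel[of 0 2 "2 * D"] 4 by (simp del: of_nat_Suc of_nat_mult mult_Suc_right)
    then have x2: "x 2 = 0" using D0 by (simp del: of_nat_Suc mult_Suc_right)
    moreover have "x 1 = 0" using rels(3) 4 x2 by (simp add: of_nat_diff algebra_simps)
    ultimately show ?thesis using 4 assms by (auto simp: l_def)
  next
    case 5
    have "(2 * of_nat D - of_nat (2 * D)) *s x 1 = (of_nat D - of_nat (2 * D)) *s x 2"
      using rel[of 1 2 "2 * D"] 5 by (simp only: of_nat_1 mult_1_left of_nat_numeral)
    then have "(of_nat D - 2 * of_nat D :: complex) *s x 2 = 0"
      by (simp del: of_nat_Suc mult_Suc_right)
    then have x2: "x 2 = 0" using D0 by (simp del: of_nat_Suc add: scale_eq_0_iff)
    then show ?thesis using 5 assms by (auto simp: l_def)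
  qed
  then show ?thesis using assms by (auto simp: x_def l_def le_Suc_eq numeral_2_eq_2)
qed

lemma odd_deg_Suc_e: "odd_deg (Suc e)"
  unfolding odd_deg_def
proof (intro conjI allI impI)
  fix i j :: nat assume i: "i \<le> 2" and j: "j \<le> 2 * D + 1"
  show "br (gv i) (br p (m D j)) = 0"
    using gv_E[OF i, of "j - 1"] j by (simp add: p_mD br_lin)
  show "br (gv i) (br X (m D j)) = 0"
  proof (cases "j = 2 * D + 1")
    case True
    then show ?thesis by (simp add: X_mD)
  next
    case False
    then show ?thesis using gv_E[OF i, of j] j by (simp add: X_mD br_lin)
  qed
qed (fact T_vanish pX_rel)+

lemma a_br_p_m:
  assumes "j \<le> 2 * e + 1"
  shows "br a (br p (m e j)) = (-2) *s br p (m D j)"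
  using assms gv_F[of 0 j] by (simp add: F_def gv_def p_mD)

lemma a_br_X_m:
  assumes "j \<le> 2 * e + 1"
  shows "br a (br X (m e j)) = (-2) *s br p (m D (Suc j))"
proof (cases "j \<le> 2 * e")
  case True
  then have "br X (m e j) = br p (m e (Suc j))"
    using deg_e by (simp add: even_deg_def)
  then show ?thesis using a_br_p_m[of "Suc j"] True by simp
next
  case False
  then have j: "j = 2 * e + 1" using assms by simp
  then have "br X (m e j) = F (2 * e + 2)" by (simp add: F_def)
  then show ?thesis using gv_F[of 0 "2 * e + 2"] j by (simp add: gv_def p_mD)
qed

end

section \<open>The obstruction [a, T 0 e]\<close>

lemma even_deg_2: "even_deg 2"
  using odd_deg_Suc[OF odd_deg_1] by (simp add: numeral_2_eq_2)

text \<open>Since p^3 is represented by -3Z, alternation in degree 2 gives T 0 2 = -9 [Z,Z], so the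
  cubic relation applies.\<close>

lemma a_T_02: "br a (T 0 2) = 0"
proof -
  have "T 1 (2 - 1) = (-1) ^ 1 *s T 0 2"
    using even_deg_2 unfolding even_deg_def by (meson one_le_numeral)
  then have "T 0 2 = - T 1 1" by simp
  also have "T 1 1 = 9 *s br Z Z"
    using m_1(1) by (simp add: T_def br_lin)
  finally show ?thesis
    using Z1_Z_Z by (simp add: br_lin a_def Zi_def)
qed

lemma odd_deg_3: "odd_deg 3"
  using odd_deg_Suc_e[OF _ even_deg_2 a_T_02] by (simp add: eval_nat_numeral)

context
  fixes e :: nat
  assumes even_e: "even e" and ge4: "4 \<le> e" and deg_e: "even_deg e" and s0: "br a (T 0 (e - 2)) = 0"
begin

text \<open>Writing \<open>T 0 e\<close> as a multiple of \<open>[U, T 0 (e - 2)]\<close> and using that \<open>V = [a,U]\<close> acts on the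
  powers of \<open>p\<close> as \<open>-2 p\<^sup>6\<close>, the Jacobi identity gives \<open>(2e - 2) s = -6 s\<close>.\<close>

lemma a_T_0e: "br a (T 0 e) = 0"
proof -
  define s where "s = br a (T 0 e)"
  \<comment> \<open>\<open>s\<close> measures how far the brackets of degree e + 1 are from
    alternating.\<close>
  have T_alt: "T i (Suc e - i) = (-1) ^ i *s (T 0 (Suc e) - of_nat i *s s)" if "i \<le> Suc e" for i
    using that
  proof (induction i)
    case (Suc i)
    have "(-1) ^ i *s s = br a (T i (e - i))"
      using Suc.prems deg_e by (simp add: even_deg_def br_lin s_def)
    also have "\<dots> = T (Suc i) (e - i) + T i (Suc e - i)"
      using Suc.prems by (simp add: a_T Suc_diff_le)
    finally have eq: "(-1) ^ i *s s = T (Suc i) (e - i) + T i (Suc e - i)" .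
    have IH: "T i (Suc e - i) = (-1) ^ i *s (T 0 (Suc e) - of_nat i *s s)"
      using Suc by simp
    define \<sigma> :: complex where "\<sigma> = (-1) ^ i"
    have "T (Suc i) (e - i) = (-1) ^ Suc i *s (T 0 (Suc e) - of_nat (Suc i) *s s)"
      by (rule vec_eqI1[OF eq[unfolded IH]],
        simp only: functional_simps of_nat_Suc power_Suc flip: \<sigma>_def, algebra)
    then show ?case by simp
  qed simp
  \<comment> \<open>\<open>U\<close> represents p^5 q in degree 2. On powers of p it acts like p^5
    d/dp, whose commutator with multiplication by p^2 is multiplication by -2 p^6.\<close>
  define U where "U = br X (pw 2)"
  define V where "V = br a U"
  have par_U: "even_el U" by (simp add: U_def par_br_oo par_X par_m)
  have U_eq: "U = br p (m 2 1)"
    using even_deg_2 unfolding even_deg_def U_def by (metis One_nat_def zero_le)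
  have U_p: "br U p = pw 2"
    using antisym_even[OF par_U par_p] Y_m[of 1 2] by (simp add: U_eq p_p)
  have U_a: "br U a = - V"
    using antisym_even[OF par_U par_a] by (simp add: V_def)
  \<comment> \<open>\<open>V\<close> is a multiple of [p, m 3 1], a bracket of the odd degree 3, and
    such brackets are annihilated by quadratic elements.\<close>
  have "br (gv 0) (br p (m 3 1)) = 0"
    using odd_deg_3 unfolding odd_deg_def by simp
  then have Va: "br a V = 0"
    using a_br_p_m[OF _ even_deg_2 a_T_02, of 1]
    by (simp add: V_def U_eq br_lin gv_def)
  have V_br: "br V w = br a (br U w) - br U (br a w)" for w
    using jacobi_ee[OF par_a par_U, of w] by (simp add: V_def)
  \<comment> \<open>Applying X to the vanishing bracket of p^5 and p^3 computes [U, p^3]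
    independently of V; this value is needed to find [V, p].\<close>
  have "T 2 (3 - 2) = 0"
    using odd_deg_3 unfolding odd_deg_def by (meson nat_le_linear numeral_le_iff semiring_norm)
  then have "br (pw 2) (pw 1) = 0" by (simp add: T_def)
  then have "br U (pw 1) = br (pw 2) (br X (pw 1))"
    using jacobi_odd[OF par_X par_m, of 2 0 "pw 1"] by (simp add: U_def)
  also have "br X (pw 1) = - (3 *s a)"
    using m_1(1) X_Zi[of 0] by (simp add: br_lin a_def)
  also have "br (pw 2) (- (3 *s a)) = 3 *s pw 3"
  proof -
    have "br (pw 2) a = - pw 3"
      using antisym_even[OF par_a par_m, of 2 0] a_m[of 0 2]
      by (simp add: numeral_3_eq_3 numeral_2_eq_2 flip: minus_equation_iff)
    then show ?thesis by (simp add: br_lin)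
  qed
  finally have U_1: "br U (pw 1) = 3 *s pw 3" .
  have "br V p = br a (pw 2) - br U (br a p)" using V_br[of p] by (simp add: U_p)
  also have "\<dots> = pw 3 - 3 *s pw 3"
    using U_1 a_m[of 0 0] a_m[of 0 2] by (simp add: numeral_3_eq_3 numeral_2_eq_2)
  also have "\<dots> = (-2) *s pw 3"
    by (intro vec_eqI) (simp add: functional_simps)
  finally have V_p: "br V p = (-2) *s pw 3" .
  have V_a: "br V a = 0"
    using Va antisym_even[OF par_a par_br_ee[OF par_a par_U]] by (simp add: V_def)
  have V_pw: "br V (pw n) = (-2) *s pw (n + 3)" for n
  proof (induction n)
    case 0
    then show ?case using V_p by simp
  next
    case (Suc n)
    have "br V (br a (pw n)) = br a (br V (pw n))"
      using jacobi_ee[OF par_br_ee[OF par_a par_U, folded V_def] par_a, of "pw n"] by (simp add: V_a)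
    then show ?case using Suc a_m[of 0 n] a_m[of 0 "n + 3"] by (simp add: br_lin)
  qed
  have U_pw: "br U (pw n) = (2 * of_nat n + 1) *s pw (n + 2)" for n
  proof (induction n)
    case 0
    then show ?case using U_p by (simp add: numeral_2_eq_2)
  next
    case (Suc n)
    have "br U (br a (pw n)) = - br V (pw n) + br a (br U (pw n))"
      using jacobi_ee[OF par_U par_a, of "pw n"] by (simp add: U_a)
    also have "\<dots> = 2 *s pw (n + 3) + (2 * of_nat n + 1) *s pw (n + 3)"
      using Suc a_m[of 0 "n + 2"] by (simp add: V_pw br_lin numeral_3_eq_3)
    also have "\<dots> = (2 * of_nat (Suc n) + 1) *s pw (n + 3)"
      by (intro vec_eqI) (simp add: functional_simps algebra_simps)
    finally show ?case using a_m[of 0 n] by (simp add: numeral_3_eq_3)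
  qed
  obtain k where k: "e = k + 2" using ge4 by (metis add.commute le_Suc_ex add_leD2 numeral_Bit0)
  have T_2k: "T 2 k = T 0 e"
    using deg_e k unfolding even_deg_def by (metis add_diff_cancel_right' le_add2 power2_minus one_power2 scale_one)
  have U_T: "br U (T 0 k) = (2 * of_nat k + 2) *s T 0 e"
  proof -
    have "br U (T 0 k) = T 2 k + (2 * of_nat k + 1) *s T 0 (k + 2)"
      using jacobi_eo[OF par_U par_p, of "pw k"] U_p U_pw[of k] by (simp add: T_def br_lin)
    also have "\<dots> = (2 * of_nat k + 2) *s T 0 e"
      unfolding T_2k k[symmetric]
      by (intro vec_eqI) (simp add: functional_simps algebra_simps)
    finally show ?thesis .
  qed
  have V_T: "br V (T 0 k) = (-2) *s (T 3 k + T 0 (k + 3))"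
    using jacobi_eo[OF par_br_ee[OF par_a par_U, folded V_def] par_p, of "pw k"] V_p V_pw[of k]
    by (simp add: T_def br_lin scale_right_distrib)
  have "br V (T 0 k) = (2 * of_nat k + 2) *s s"
    using V_br[of "T 0 k"] s0 k by (simp add: U_T br_lin s_def)
  moreover have "T 3 k = - (T 0 (k + 3) - 3 *s s)"
    using T_alt[of 3] k by (simp add: numeral_3_eq_3)
  ultimately have eq: "(2 * of_nat k + 2) *s s = (-2) *s (- (T 0 (k + 3) - 3 *s s) + T 0 (k + 3))"
    using V_T by simp
  have "(2 * of_nat k + 8) *s s = 0"
    by (rule vec_eqI1[OF eq], simp only: functional_simps, algebra)
  moreover have "(2 * of_nat k + 8) \<noteq> (0::complex)"
    using of_nat_eq_iff[where 'a = complex, of "2 * k + 8" 0] by simp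
  ultimately show ?thesis unfolding s_def by simp
qed

end

text \<open>Both claims are proved together: the obstruction in degree e uses that of degree e - 2
  and the product rule in degree e, and the latter follows from the odd degree e - 1.\<close>

lemma degrees: "odd_deg (2 * n + 1) \<and> br a (T 0 (2 * n)) = 0"
proof (induction n)
  case 0
  have "T 0 0 = 2 *s Y" by (simp add: T_def p_p_eq)
  then show ?case
    using odd_deg_1 Y_a antisym_even[OF par_a par_Y] by (simp add: br_lin)
next
  case (Suc n)
  have deg: "even_deg (2 * Suc n)"
    using odd_deg_Suc[of "2 * n + 1"] Suc by simp
  have "br a (T 0 (2 * Suc n)) = 0"
  proof (cases "n = 0")
    case True
    then show ?thesis using a_T_02 by (simp add: numeral_2_eq_2)
  next
    case False
    then show ?thesis using a_T_0e[OF _ _ deg] Suc by simp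
  qed
  with odd_deg_Suc_e[OF _ deg] show ?case by simp
qed

lemma odd_deg_odd: "odd d \<Longrightarrow> odd_deg d"
  using degrees by (auto elim!: oddE)

lemma a_T_even: "even d \<Longrightarrow> br a (T 0 d) = 0"
  using degrees by (auto elim!: evenE)

lemma even_deg_even: "even d \<Longrightarrow> even_deg d"
proof (cases d)
  case 0
  then show ?thesis by (simp add: even_deg_def p_X p_def[symmetric] flip: H_def)
next
  case (Suc n)
  assume "even d"
  then show ?thesis using odd_deg_Suc[OF odd_deg_odd] Suc by simp
qed

section \<open>A spanning set of the graded algebra\<close>

text \<open>The power of p that generates degree d: p^(2d+2), as a product, for even d, and p^(2d+1)
  for odd d.\<close>

definition low_vec :: "nat \<Rightarrow> 'a" where
  "low_vec d = (if even d then br p ((br a ^^ d) p) else (br a ^^ d) p)"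

lemma pw_eq: "pw d = (br a ^^ d) p"
proof (induction d)
  case (Suc d)
  then show ?case using a_m[of 0 d] by simp
qed simp

lemma low_vec_eq: "low_vec d = (if even d then br p (pw d) else pw d)"
  by (simp only: low_vec_def pw_eq)

definition basis_vecs :: "'a set" where
  "basis_vecs = {(br X ^^ i) (low_vec d) | i d. i \<le> 2 * wt d}"

definition mon_vecs :: "'a set" where
  "mon_vecs = (\<Union>d. \<Union>j\<in>{..2 * d + 1}. {m d j, br p (m d j), br X (m d j)})"

lemma mon_span:
  assumes "j \<le> 2 * d + 1"
  shows "m d j \<in> span mon_vecs" "br p (m d j) \<in> span mon_vecs" "br X (m d j) \<in> span mon_vecs"
  using assms by (auto simp: mon_vecs_def intro!: span_base)

lemma span_scaleD: "k *s x \<in> span S \<Longrightarrow> k \<noteq> 0 \<Longrightarrow> x \<in> span S"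
  using span_scale[of "k *s x" S "1 / k"] by simp

lemma br_in_span:
  assumes "\<And>x. x \<in> B \<Longrightarrow> br u x \<in> span C" "y \<in> span B"
  shows "br u y \<in> span C"
  using assms(2)
proof (induction rule: span_induct_alt)
  case (step k x y)
  then show ?case
    using assms(1) by (auto simp: br_lin intro: span_add span_scale)
qed (simp add: span_zero)

text \<open>Applying p twice is applying Y, which preserves monomials up to scalars. For even d,
  [X, m d j] equals [p, m d (j+1)], except at the last j, where p and X are interchanged at the cost
  of H. For odd d it is a multiple of [p, m d (j+1)].\<close>

lemma p_X_m:
  assumes "j \<le> 2 * d + 1"
  shows "br p (br X (m d j)) \<in> span mon_vecs"
proof -
  have ppm: "br p (br p (m d i)) \<in> span mon_vecs" if "i \<le> 2 * d + 1" for i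
    unfolding p_p Y_m[OF that] using that by (intro span_scale mon_span(1)) simp
  show ?thesis
  proof (cases "even d")
    case True
    note deg = even_deg_even[OF True, unfolded even_deg_def]
    show ?thesis
    proof (cases "j \<le> 2 * d")
      case True
      then show ?thesis using deg ppm[of "Suc j"] by simp
    next
      case False
      then have j: "j = Suc (2 * d)" using assms by simp
      have "br p (br X (m d j)) = br H (m d j) - br X (br X (m d (2 * d)))"
        using X_p[of "m d j"] deg j by simp
      also have "\<dots> \<in> span mon_vecs"
        using j H_m[of j d] Q_m[of "2 * d" d] mon_span(1)[of _ d]
        by (auto simp: X_X intro!: span_diff span_scale)
      finally show ?thesis .
    qed
  next
    case False
    have eq: "(2 * of_nat d + 1 - of_nat j) *s br p (m d (Suc j)) + (of_nat j + 1) *s br X (m d j) = 0"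
      using odd_deg_odd[OF False] assms unfolding odd_deg_def by blast
    have ne: "of_nat j + 1 \<noteq> (0 :: complex)"
      by (metis of_nat_neq_0 of_nat_Suc add.commute)
    have "(of_nat j + 1) *s br p (br X (m d j))
        = - ((2 * of_nat d + 1 - of_nat j) *s br p (br p (m d (Suc j))))"
      using arg_cong[OF eq, of "br p"] by (simp add: br_lin eq_neg_iff_add_eq_0 add.commute)
    moreover have "(2 * of_nat d + 1 - of_nat j) *s br p (br p (m d (Suc j))) \<in> span mon_vecs"
    proof (cases "j = 2 * d + 1")
      case True
      then show ?thesis by (simp add: span_zero)
    next
      case False
      then show ?thesis using assms ppm[of "Suc j"] by (auto intro: span_scale)
    qed
    ultimately have "(of_nat j + 1) *s br p (br X (m d j)) \<in> span mon_vecs"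
      by (simp add: span_neg)
    then show ?thesis using ne by (rule span_scaleD)
  qed
qed

lemma X_mon: "x \<in> span mon_vecs \<Longrightarrow> br X x \<in> span mon_vecs"
proof (rule br_in_span)
  fix x assume "x \<in> mon_vecs"
  then obtain d j where j: "j \<le> 2 * d + 1" and x: "x \<in> {m d j, br p (m d j), br X (m d j)}"
    by (auto simp: mon_vecs_def)
  have "br X (br p (m d j)) \<in> span mon_vecs"
    using j p_X_m H_m[OF j] mon_span(1) by (auto simp: X_p intro!: span_diff span_scale)
  moreover have "br X (br X (m d j)) \<in> span mon_vecs"
  proof (cases "j = 2 * d + 1")
    case True
    then show ?thesis using Q_m[OF j] by (simp add: X_X span_zero)
  next
    case False
    then show ?thesis using Q_m[OF j] j mon_span(1)[of "Suc j" d] by (auto simp: X_X intro: span_scale)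
  qed
  ultimately show "br X x \<in> span mon_vecs" using x mon_span[OF j] by auto
qed

lemma p_mon: "x \<in> span mon_vecs \<Longrightarrow> br p x \<in> span mon_vecs"
proof (rule br_in_span)
  fix x assume "x \<in> mon_vecs"
  then obtain d j where j: "j \<le> 2 * d + 1" and x: "x \<in> {m d j, br p (m d j), br X (m d j)}"
    by (auto simp: mon_vecs_def)
  have "br p (br p (m d j)) \<in> span mon_vecs"
    unfolding p_p Y_m[OF j] using j by (intro span_scale mon_span(1)) simp
  with x show "br p x \<in> span mon_vecs" using mon_span[OF j] p_X_m[OF j] by auto
qed

lemma a_mon: "x \<in> span mon_vecs \<Longrightarrow> br a x \<in> span mon_vecs"
proof (rule br_in_span)
  fix x assume "x \<in> mon_vecs"
  then obtain d j where j: "j \<le> 2 * d + 1" and x: "x \<in> {m d j, br p (m d j), br X (m d j)}"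
    by (auto simp: mon_vecs_def)
  have am: "br a (m d j) \<in> span mon_vecs"
    using j mon_span(1)[of j "Suc d"] by (simp add: a_m)
  have "br a (br p (m d j)) \<in> span mon_vecs \<and> br a (br X (m d j)) \<in> span mon_vecs"
  proof (cases "even d")
    case True
    then show ?thesis
      using a_br_p_m[OF True even_deg_even a_T_even, OF True True j]
        a_br_X_m[OF True even_deg_even a_T_even, OF True True j]
        j mon_span(2)[of j "Suc d"] mon_span(2)[of "Suc j" "Suc d"]
      by (auto intro!: span_scale span_neg)
  next
    case False
    have "br (gv 0) (br p (m d j)) = 0 \<and> br (gv 0) (br X (m d j)) = 0"
      using odd_deg_odd[OF False] j unfolding odd_deg_def by blast
    then show ?thesis by (simp add: gv_def span_zero)
  qed
  with x am show "br a x \<in> span mon_vecs" by auto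
qed

text \<open>The carrier may contain elements outside the subalgebra generated by X, Y, Z, so the
  spanning statement is restricted to generated elements.\<close>

inductive alg :: "bool \<Rightarrow> 'a \<Rightarrow> bool" where
  alg_X: "alg True X"
| alg_Y: "alg False Y"
| alg_Z: "alg True Z"
| alg_add: "alg r x \<Longrightarrow> alg r y \<Longrightarrow> alg r (x + y)"
| alg_scale: "alg r x \<Longrightarrow> alg r (k *s x)"
| alg_br: "alg r x \<Longrightarrow> alg q y \<Longrightarrow> alg (r \<noteq> q) (br x y)"

lemma alg_par: "alg r x \<Longrightarrow> par r x"
proof (induction rule: alg.induct)
  case (alg_br r x q y)
  then show ?case by (intro par_br)
qed (auto intro: par_intros par_add)

lemma gens_mon: "X \<in> span mon_vecs" "p \<in> span mon_vecs" "Y \<in> span mon_vecs" "Z \<in> span mon_vecs"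
proof -
  show "X \<in> span mon_vecs" "p \<in> span mon_vecs" using mon_span(1)[of 1 0] mon_span(1)[of 0 0] by auto
  have "2 *s Y \<in> span mon_vecs" using mon_span(2)[of 0 0] by (simp add: p_p_eq)
  then show "Y \<in> span mon_vecs" by (rule span_scaleD) simp
  have "(-3) *s Z \<in> span mon_vecs" using mon_span(1)[of 0 1] m_1(1) by simp
  then show "Z \<in> span mon_vecs" by (rule span_scaleD) simp
qed

text \<open>Stability of the span under ad x is included because it passes to brackets by the Jacobi
  identity. Membership alone would not carry the induction.\<close>

lemma alg_mon: "alg r x \<Longrightarrow> x \<in> span mon_vecs \<and> (\<forall>y\<in>span mon_vecs. br x y \<in> span mon_vecs)"
proof (induction rule: alg.induct)
  case alg_X
  then show ?case using gens_mon X_mon by auto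
next
  case alg_Y
  have "br Y y \<in> span mon_vecs" if "y \<in> span mon_vecs" for y
    using p_mon[OF p_mon[OF that]] by (simp only: p_p)
  then show ?case using gens_mon by auto
next
  case alg_Z
  have "br Z y \<in> span mon_vecs" if "y \<in> span mon_vecs" for y
  proof -
    \<comment> \<open>The generator Z is recovered from [a,p] = -3Z, so stability under a and p
      suffices.\<close>
    have "br a (br p y) = br (- (3 *s Z)) y + br p (br a y)"
      using jacobi_eo[OF par_a par_p, of y] by (simp add: a_p)
    then have "(-3) *s br Z y = br a (br p y) - br p (br a y)"
      by (simp add: br_lin)
    also have "\<dots> \<in> span mon_vecs"
      using a_mon p_mon that by (intro span_diff) auto
    finally show ?thesis by (rule span_scaleD) simp
  qed
  then show ?case using gens_mon by auto
next
  case (alg_br r x q y)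
  have "br (br x y) z = br x (br y z) - sgn_par r q *s br y (br x z)" for z
    using jacobi[OF alg_par[OF alg_br.hyps(1)] alg_par[OF alg_br.hyps(2)], of z] by simp
  with alg_br show ?case by (auto intro!: span_diff span_scale)
qed (auto simp: br_lin intro: span_add span_scale)

lemma X_low_vec: "even d \<Longrightarrow> br X (low_vec d) = (2 * of_nat d + 2) *s pw d"
proof -
  assume "even d"
  then have deg: "br X (m d 0) = br p (m d 1)"
    using even_deg_even unfolding even_deg_def by (metis One_nat_def zero_le)
  have "br X (low_vec d) = (2 * of_nat d + 1) *s pw d - br Y (m d 1)"
    using \<open>even d\<close> H_m[of 0 d] by (simp add: low_vec_eq X_p deg p_p)
  also have "\<dots> = (2 * of_nat d + 2) *s pw d"
    using Y_m[of 1 d] by (intro vec_eqI) (simp add: functional_simps algebra_simps)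
  finally show ?thesis .
qed

lemma basis_vecs_span: "i \<le> 2 * wt d \<Longrightarrow> (br X ^^ i) (low_vec d) \<in> span basis_vecs"
  by (intro span_base) (auto simp only: basis_vecs_def)

text \<open>For even d, \<open>pw d\<close> is proportional to the second vector of the chain of
  \<open>low_vec d\<close>, for odd d it is the first. The bounds are accordingly 2
  \<open>wt d\<close> - 1 and 2 \<open>wt d\<close>.\<close>

lemma X_pow_pw:
  assumes "i \<le> (if even d then 4 * d + 3 else 4 * d + 2)"
  shows "(br X ^^ i) (pw d) \<in> span basis_vecs"
proof (cases "even d")
  case True
  have lin: "(br X ^^ i) (k *s x) = k *s (br X ^^ i) x" for k x
    by (induction i) (simp_all add: br_lin)
  have ne: "2 * of_nat d + 2 \<noteq> (0 :: complex)"
    using of_nat_eq_iff[where 'a = complex, of "2 * d + 2" 0] by (simp add: add.commute)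
  have "(br X ^^ Suc i) (low_vec d) \<in> span basis_vecs"
    using assms True by (intro basis_vecs_span) (simp add: wt_def)
  then have "(2 * of_nat d + 2) *s (br X ^^ i) (pw d) \<in> span basis_vecs"
    by (simp only: funpow_Suc_right o_def X_low_vec[OF True] lin)
  then show ?thesis using ne by (rule span_scaleD)
next
  case False
  have "(br X ^^ i) (low_vec d) \<in> span basis_vecs"
    using assms False by (intro basis_vecs_span) (simp add: wt_def)
  then show ?thesis using False by (simp add: low_vec_eq)
qed

lemma X_pow_m:
  "j \<le> 2 * d + 1 \<Longrightarrow> \<exists>k. k \<noteq> 0 \<and> (br X ^^ (2 * j)) (pw d) = k *s m d j"
proof (induction j)
  case 0
  then show ?case by (auto intro: exI[of _ 1])
next
  case (Suc j)
  then obtain k where k: "k \<noteq> 0" "(br X ^^ (2 * j)) (pw d) = k *s m d j" by auto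
  have "(br X ^^ (2 * Suc j)) (pw d) = br Q ((br X ^^ (2 * j)) (pw d))"
    by (simp add: X_X)
  also have "\<dots> = (k * (2 * of_nat d + 1 - of_nat j)) *s m d (Suc j)"
    using k Q_m[of j d] Suc.prems by (simp add: br_lin)
  finally show ?case
    using k(1) Suc.prems of_nat_eq_iff[where 'a = complex, of "2 * d + 1" j]
    by (intro exI[of _ "k * (2 * of_nat d + 1 - of_nat j)"]) (auto simp: add.commute)
qed

lemma mon_bas: "mon_vecs \<subseteq> span basis_vecs"
proof -
  have m: "m d j \<in> span basis_vecs" and Xm: "br X (m d j) \<in> span basis_vecs" if j: "j \<le> 2 * d + 1" for d j
  proof -
    obtain k where k: "k \<noteq> 0" "(br X ^^ (2 * j)) (pw d) = k *s m d j"
      using X_pow_m[OF j] by auto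
    have "k *s m d j \<in> span basis_vecs"
      using X_pow_pw[of "2 * j" d] j k by (simp split: if_splits)
    then show "m d j \<in> span basis_vecs" using k(1) by (rule span_scaleD)
    show "br X (m d j) \<in> span basis_vecs"
    \<comment> \<open>In this exceptional case the exponent 4d + 3 exceeds the chain by one, but the
      Poisson rule makes the vector zero.\<close>
    proof (cases "odd d \<and> j = 2 * d + 1")
      case True
      then have "(2 * of_nat d + 1 - of_nat j) *s br p (m d (Suc j)) + (of_nat j + 1) *s br X (m d j) = 0"
        using odd_deg_odd[of d] j unfolding odd_deg_def by blast
      then have "(of_nat j + 1) *s br X (m d j) = 0"
        using True by simp
      moreover have "of_nat j + 1 \<noteq> (0 :: complex)"
        by (metis of_nat_neq_0 of_nat_Suc add.commute)
      ultimately show ?thesis by (simp add: span_zero)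
    next
      case False
      have "(br X ^^ Suc (2 * j)) (pw d) \<in> span basis_vecs"
        using j False by (intro X_pow_pw) auto
      then have "k *s br X (m d j) \<in> span basis_vecs" using k by (simp add: br_lin)
      then show ?thesis using k(1) by (rule span_scaleD)
    qed
  qed
  have pm: "br p (m d j) \<in> span basis_vecs" if j: "j \<le> 2 * d + 1" for d j
  proof (cases j)
    case 0
    show ?thesis
    proof (cases "even d")
      case True
      then have "(br X ^^ 0) (low_vec d) \<in> span basis_vecs" by (intro basis_vecs_span) simp
      then show ?thesis using True 0 by (simp add: low_vec_eq)
    next
      case False
      then have "T 0 (d - 0) = 0" using odd_deg_odd[of d] unfolding odd_deg_def by blast
      then show ?thesis using 0 by (simp add: T_def span_zero)
    qed
  next
    case (Suc i)
    show ?thesis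
    proof (cases "even d")
      case True
      then show ?thesis using even_deg_even[of d] Xm[of i d] j Suc by (simp add: even_deg_def)
    next
      case False
      then have "(2 * of_nat d + 1 - of_nat i) *s br p (m d j) + (of_nat i + 1) *s br X (m d i) = 0"
        using odd_deg_odd[of d] Suc j unfolding odd_deg_def by auto
      then have "(2 * of_nat d + 1 - of_nat i) *s br p (m d j) = - ((of_nat i + 1) *s br X (m d i))"
        by (simp add: eq_neg_iff_add_eq_0)
      also have "\<dots> \<in> span basis_vecs" using Xm[of i d] j Suc by (intro span_neg span_scale) simp
      finally show ?thesis
        using j Suc of_nat_eq_iff[where 'a = complex, of "2 * d + 1" i]
        by (elim span_scaleD) (auto simp: add.commute)
    qed
  qed
  show ?thesis unfolding mon_vecs_def using m Xm pm by auto
qed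

theorem alg_basis_vecs: "alg r x \<Longrightarrow> x \<in> span basis_vecs"
  using alg_mon mon_bas by (meson span_minimal subsetD subspace_span)

end

section \<open>The free Lie superalgebra and its quotients\<close>

quotient_type free_lie = expr / "liecong {}"
  morphisms rep_free abs_free
  by (intro equivpI reflpI sympI transpI) (auto intro: liecong.refl liecong.sym liecong.trans)

lemma abs_free_eq: "abs_free a = abs_free b \<longleftrightarrow> liecong {} a b"
  by (rule free_lie.abs_eq_iff)

lemma abs_free_cases: obtains e where "x = abs_free e"
  by (metis Quotient_abs_rep Quotient_free_lie)

instantiation free_lie :: ab_group_add
begin

lift_definition zero_free_lie :: free_lie is Zero .
lift_definition plus_free_lie :: "free_lie \<Rightarrow> free_lie \<Rightarrow> free_lie" is Add
  by (rule liecong.cong_add)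
lift_definition uminus_free_lie :: "free_lie \<Rightarrow> free_lie" is "Smul (-1)"
  by (rule liecong.cong_smul)
lift_definition minus_free_lie :: "free_lie \<Rightarrow> free_lie \<Rightarrow> free_lie" is "\<lambda>a b. Add a (Smul (-1) b)"
  by (intro liecong.cong_add liecong.cong_smul)

instance
proof
  fix x y z :: free_lie
  show "x + y + z = x + (y + z)" by transfer (rule liecong.add_assoc)
  show "x + y = y + x" by transfer (rule liecong.add_comm)
  show "0 + x = x"
    by transfer (meson liecong.add_comm liecong.add_zero liecong.trans)
  show "- x + x = 0"
    by transfer (meson liecong.add_comm liecong.add_neg liecong.trans)
  show "x - y = x + - y" by transfer (rule liecong.refl)
qed

end

lift_definition fscale :: "complex \<Rightarrow> free_lie \<Rightarrow> free_lie" is Smul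
  by (rule liecong.cong_smul)
lift_definition fbr :: "free_lie \<Rightarrow> free_lie \<Rightarrow> free_lie" is Br
  by (rule liecong.cong_br)

definition fpar :: "bool \<Rightarrow> free_lie \<Rightarrow> bool" where
  "fpar r x \<longleftrightarrow> (\<exists>e. hom e r \<and> x = abs_free e)"

lemma fpar_abs: "hom e r \<Longrightarrow> fpar r (abs_free e)"
  by (auto simp: fpar_def)

lemmas abs_free_simps [simp] = zero_free_lie.abs_eq[symmetric] plus_free_lie.abs_eq[symmetric]
  fscale.abs_eq[symmetric] fbr.abs_eq[symmetric]

interpretation free: super_lie fscale fbr fpar
proof
  fix x y z :: free_lie and k l :: complex and r q :: bool
  show "fscale k (x + y) = fscale k x + fscale k y" by transfer (rule liecong.smul_add)
  show "fscale (k + l) x = fscale k x + fscale l x" by transfer (rule liecong.smul_add_scalar)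
  show "fscale k (fscale l x) = fscale (k * l) x" by transfer (rule liecong.smul_smul)
  show "fscale 1 x = x" by transfer (rule liecong.smul_one)
  show "fbr (x + y) z = fbr x z + fbr y z" by transfer (rule liecong.br_add_left)
  show "fbr x (y + z) = fbr x y + fbr x z" by transfer (rule liecong.br_add_right)
  show "fbr (fscale k x) y = fscale k (fbr x y)" by transfer (rule liecong.br_smul_left)
  show "fbr x (fscale k y) = fscale k (fbr x y)" by transfer (rule liecong.br_smul_right)
  show "fpar r (fscale k x)" if "fpar r x"
  proof -
    from that obtain e where "hom e r" "x = abs_free e" by (auto simp: fpar_def)
    then show ?thesis using fpar_abs[OF hom.intros(4), of e r k] by simp
  qed
  show "fpar r (x + y)" if "fpar r x" "fpar r y"
  proof -
    from that obtain e f where "hom e r" "x = abs_free e" "hom f r" "y = abs_free f"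
      by (auto simp: fpar_def)
    then show ?thesis using fpar_abs[OF hom.intros(3), of e r f] by simp
  qed
  show "fpar (r \<noteq> q) (fbr x y)" if "fpar r x" "fpar q y"
  proof -
    from that obtain e f where "hom e r" "x = abs_free e" "hom f q" "y = abs_free f"
      by (auto simp: fpar_def)
    then show ?thesis using fpar_abs[OF hom.intros(5)] by simp
  qed
  show "fbr x y = fscale (- sgn_par r q) (fbr y x)" if "fpar r x" "fpar q y"
  proof -
    from that obtain e f where "hom e r" "x = abs_free e" "hom f q" "y = abs_free f"
      by (auto simp: fpar_def)
    moreover from this have "abs_free (Br e f) = abs_free (Smul (- sgn_par r q) (Br f e))"
      unfolding abs_free_eq by (intro liecong.antisym)
    ultimately show ?thesis by simp
  qed
  show "fbr x (fbr y z) = fbr (fbr x y) z + fscale (sgn_par r q) (fbr y (fbr x z))"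
    if "fpar r x" "fpar q y"
  proof -
    from that obtain e f where "hom e r" "x = abs_free e" "hom f q" "y = abs_free f"
      by (auto simp: fpar_def)
    moreover obtain g where "z = abs_free g" by (rule abs_free_cases)
    moreover from calculation have "abs_free (Br e (Br f g)) =
        abs_free (Add (Br (Br e f) g) (Smul (sgn_par r q) (Br f (Br e g))))"
      unfolding abs_free_eq by (intro liecong.jacobi)
    ultimately show ?thesis by simp
  qed
qed

abbreviation "fX \<equiv> abs_free eX"
abbreviation "fY \<equiv> abs_free eY"
abbreviation "fZ \<equiv> abs_free eZ"

lemma abs_free_adX: "abs_free (adX i e) = (fbr fX ^^ i) (abs_free e)"
  by (induction i) (simp_all add: adX_def)

section \<open>The grading by the number of Z\<close>

inductive zdeg :: "nat \<Rightarrow> free_lie \<Rightarrow> bool" where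
  zdeg_X: "zdeg 0 fX"
| zdeg_Y: "zdeg 0 fY"
| zdeg_Z: "zdeg 1 fZ"
| zdeg_zero: "zdeg k 0"
| zdeg_add: "zdeg k x \<Longrightarrow> zdeg k y \<Longrightarrow> zdeg k (x + y)"
| zdeg_scale: "zdeg k x \<Longrightarrow> zdeg k (fscale c x)"
| zdeg_br: "zdeg k x \<Longrightarrow> zdeg l y \<Longrightarrow> zdeg (k + l) (fbr x y)"

lemma subspace_zdeg: "free.subspace {x. zdeg k x}"
  by (auto intro: free.subspaceI zdeg.intros)

lemma zdeg_diff: "zdeg k x \<Longrightarrow> zdeg k y \<Longrightarrow> zdeg k (x - y)"
  using free.subspace_diff[OF subspace_zdeg] by auto

text \<open>The derivation that fixes Z and kills X and Y, written on expressions. It descends to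
  the free algebra as the Euler derivation of the grading.\<close>

fun dcount :: "expr \<Rightarrow> free_lie" where
  "dcount (Gen g) = (if g = GZ then fZ else 0)"
| "dcount Zero = 0"
| "dcount (Add a b) = dcount a + dcount b"
| "dcount (Smul c a) = fscale c (dcount a)"
| "dcount (Br a b) = fbr (dcount a) (abs_free b) + fbr (abs_free a) (dcount b)"

lemma fpar_zero: "fpar r 0"
  using fpar_abs[OF hom.intros(2)] by simp

lemma fpar_dcount: "hom e r \<Longrightarrow> fpar r (dcount e)"
proof (induction rule: hom.induct)
  case (1 g)
  then show ?case using fpar_abs[OF hom.intros(1), of GZ] by (cases g) (auto simp: fpar_zero)
next
  case (5 a p b q)
  then show ?case using free.par_br[of p _ q] fpar_abs by (auto intro!: free.par_add)
qed (auto intro: fpar_zero free.par_add free.par_scale)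

lemma dcount_cong: "liecong R a b \<Longrightarrow> R = {} \<Longrightarrow> dcount a = dcount b"
proof (induction rule: liecong.induct)
  case (cong_br a a' b b')
  then have "abs_free a = abs_free a'" "abs_free b = abs_free b'" by (auto simp: abs_free_eq)
  then show ?case using cong_br by simp
next
  case (antisym a p b q)
  have "fbr (dcount a) (abs_free b) = fscale (- sgn_par p q) (fbr (abs_free b) (dcount a))"
    "fbr (abs_free a) (dcount b) = fscale (- sgn_par p q) (fbr (dcount b) (abs_free a))"
    using antisym fpar_abs fpar_dcount free.antisym by blast+
  then show ?case by (simp add: free.scale_right_distrib add.commute)
next
  case (jacobi a p b q c)
  note par = fpar_abs[OF jacobi(1)] fpar_abs[OF jacobi(2)] fpar_dcount[OF jacobi(1)] fpar_dcount[OF jacobi(2)]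
  show ?case
    using free.jacobi[OF par(3) par(2), of "abs_free c"] free.jacobi[OF par(1) par(4), of "abs_free c"]
      free.jacobi[OF par(1) par(2), of "dcount c"]
    by (simp add: free.scale_right_distrib free.br_add_left free.br_add_right add_ac)
qed (simp_all add: free.scale_right_distrib free.scale_left_distrib free.br_add_left free.br_add_right
    free.br_scale_left free.br_scale_right add_ac)

lift_definition euler :: "free_lie \<Rightarrow> free_lie" is dcount
  by (rule dcount_cong) simp_all

lemma euler_abs: "euler (abs_free e) = dcount e"
  by (rule euler.abs_eq)

lemma euler_add: "euler (x + y) = euler x + euler y"
  and euler_scale: "euler (fscale c x) = fscale c (euler x)"
  and euler_zero: "euler 0 = 0"
  and euler_br: "euler (fbr x y) = fbr (euler x) y + fbr x (euler y)"
proof -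
  obtain e f where x: "x = abs_free e" and y: "y = abs_free f"
    using abs_free_cases by metis
  show "euler (x + y) = euler x + euler y"
    using euler_abs[of "Add e f"] by (simp add: x y euler_abs)
  show "euler (fscale c x) = fscale c (euler x)"
    using euler_abs[of "Smul c e"] by (simp add: x euler_abs)
  show "euler 0 = 0"
    using euler_abs[of Zero] by simp
  show "euler (fbr x y) = fbr (euler x) y + fbr x (euler y)"
    using euler_abs[of "Br e f"] by (simp add: x y euler_abs)
qed

lemma euler_zdeg: "zdeg k x \<Longrightarrow> euler x = fscale (of_nat k) x"
  by (induction rule: zdeg.induct)
    (simp_all add: euler_abs euler_add euler_scale euler_zero euler_br free.scale_right_distrib
      free.scale_left_distrib free.br_scale_left free.br_scale_right mult.commute)

lemma euler_sum: "euler (sum f A) = (\<Sum>n\<in>A. euler (f n))"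
  by (induction A rule: infinite_finite_induct) (simp_all add: euler_add euler_zero)

text \<open>Degree n is contained in the eigenspace of \<open>euler\<close> for n, and eigenspaces
  for distinct eigenvalues are independent: applying \<open>euler\<close> minus k removes the term
  of index k.\<close>

lemma zdeg_direct:
  assumes "finite A" "\<And>n. n \<in> A \<Longrightarrow> zdeg n (f n)" "sum f A = 0" "n \<in> A"
  shows "f n = 0"
  using assms
proof (induction A arbitrary: f n rule: finite_induct)
  case (insert k A)
  let ?g = "\<lambda>n. fscale (of_nat n - of_nat k) (f n)"
  have "(\<Sum>n\<in>insert k A. ?g n) = (\<Sum>n\<in>insert k A. euler (f n) - fscale (of_nat k) (f n))"
  proof (rule sum.cong[OF HOL.refl])
    fix n assume "n \<in> insert k A"
    then have "euler (f n) = fscale (of_nat n) (f n)"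
      by (intro euler_zdeg insert.prems(1))
    then show "?g n = euler (f n) - fscale (of_nat k) (f n)"
      by (simp only: free.scale_left_diff_distrib)
  qed
  also have "\<dots> = euler (sum f (insert k A)) - fscale (of_nat k) (sum f (insert k A))"
    by (simp only: euler_sum free.scale_sum_right sum_subtractf)
  finally have "sum ?g A = 0"
    using insert by (simp add: euler_zero)
  then have g: "?g n = 0" if "n \<in> A" for n
    using that insert.prems(1) by (intro insert.IH[of ?g n]) (auto intro: zdeg_scale)
  have A: "f n = 0" if "n \<in> A" for n
    using g[OF that] that insert.hyps by auto
  then have "f k = 0" using insert.prems(2) insert.hyps by (simp add: sum.neutral)
  with A insert.prems show ?case by auto
qed simp

text \<open>The quotient by \<open>S\<close> is realised inside the space, \<open>f\<close> choosing
  a representative of each class linearly.\<close>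

lemma (in vector_space) exists_projection:
  assumes "subspace S"
  shows "\<exists>f. Vector_Spaces.linear scale scale f \<and> (\<forall>x. f x = 0 \<longleftrightarrow> x \<in> S) \<and> (\<forall>x. x - f x \<in> S)"
proof -
  interpret vsp: vector_space_pair scale scale ..
  obtain B where B: "B \<subseteq> S" "independent B" "S \<subseteq> span B" "card B = dim S"
    by (rule basis_exists)
  obtain B' where B': "B \<subseteq> B'" "independent B'" "UNIV \<subseteq> span B'"
    by (rule maximal_independent_subset_extend[OF subset_UNIV B(2)])
  obtain f where f: "Vector_Spaces.linear scale scale f" "\<forall>x\<in>B'. f x = (if x \<in> B then 0 else x)"
    using vsp.linear_independent_extend[OF B'(2), of "\<lambda>x. if x \<in> B then 0 else x"] by auto
  interpret f: Vector_Spaces.linear scale scale f by (fact f(1))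
  have diff: "x - f x \<in> S" for x
  proof -
    have "x \<in> span B'" using B'(3) by auto
    then show ?thesis
    proof (induction rule: span_induct_alt)
      case (step k b y)
      have fb: "f b = (if b \<in> B then 0 else b)" using f(2) step(1) by blast
      have "b - f b \<in> S"
      proof (cases "b \<in> B")
        case True
        then show ?thesis using B(1) fb by auto
      next
        case False
        then show ?thesis using fb subspace_0[OF assms] by simp
      qed
      moreover have "scale k b + y - f (scale k b + y) = scale k (b - f b) + (y - f y)"
        by (simp add: f.add f.scale scale_right_diff_distrib)
      ultimately show ?case
        using subspace_add[OF assms subspace_scale[OF assms] step(2)] by (simp only:)
    next
      case base
      then show ?case using subspace_0[OF assms] by (simp add: f.zero)
    qed
  qed
  moreover have "f x = 0" if "x \<in> S" for x
  proof -
    have "x \<in> span B" using that B(3) by (rule rev_subsetD)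
    then show ?thesis
    proof (induction rule: span_induct_alt)
      case (step k b y)
      then have "f b = 0" using f(2) B'(1) by auto
      then show ?case using step(2) by (simp add: f.add f.scale)
    qed (simp add: f.zero)
  qed
  moreover have "x \<in> S" if "f x = 0" for x
    using diff[of x] that by simp
  ultimately have "(f x = 0 \<longleftrightarrow> x \<in> S) \<and> x - f x \<in> S" for x by blast
  then show ?thesis using f(1) by (intro exI[of _ f]) simp
qed

lemma liecong_mono: "liecong R a b \<Longrightarrow> R \<subseteq> R' \<Longrightarrow> liecong R' a b"
proof (induction rule: liecong.induct)
  case (sym a b)
  then show ?case by (intro liecong.sym[of _ a b])
next
  case (trans a b c)
  then show ?case by (intro liecong.trans[of _ a b c])
qed (auto intro: liecong.intros(1,2,5-))

section \<open>Ideals of relations\<close>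

definition rel_ideal :: "(expr \<times> expr) set \<Rightarrow> free_lie set" where
  "rel_ideal R = {x. \<exists>e. x = abs_free e \<and> liecong R e Zero}"

lemma rel_ideal_abs: "abs_free e \<in> rel_ideal R \<longleftrightarrow> liecong R e Zero"
proof
  assume "abs_free e \<in> rel_ideal R"
  then obtain f where "abs_free e = abs_free f" "liecong R f Zero"
    by (auto simp: rel_ideal_def)
  then show "liecong R e Zero"
    using liecong.trans[OF liecong_mono[of "{}" e f R]] by (simp add: abs_free_eq)
qed (auto simp: rel_ideal_def)

lemma liecong_abs: "abs_free e = abs_free f \<Longrightarrow> liecong R e f"
  by (metis abs_free_eq empty_subsetI liecong_mono)

lemma subspace_rel_ideal: "free.subspace (rel_ideal R)"
proof (rule free.subspaceI)
  show "0 \<in> rel_ideal R"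
    using rel_ideal_abs[of Zero R] liecong.refl by simp
next
  fix x y assume "x \<in> rel_ideal R" "y \<in> rel_ideal R"
  then obtain e f where ef: "x = abs_free e" "y = abs_free f" "liecong R e Zero" "liecong R f Zero"
    by (auto simp: rel_ideal_def)
  then have "liecong R (Add e f) Zero"
    using liecong.trans[OF liecong.cong_add liecong.add_zero] by blast
  then show "x + y \<in> rel_ideal R"
    using ef rel_ideal_abs[of "Add e f" R] by simp
next
  fix k x assume "x \<in> rel_ideal R"
  then obtain e where e: "x = abs_free e" "liecong R e Zero"
    by (auto simp: rel_ideal_def)
  have "liecong R (Smul k Zero) Zero"
    by (rule liecong_abs) simp
  then have "liecong R (Smul k e) Zero"
    using liecong.trans[OF liecong.cong_smul[OF e(2)]] by blast
  then show "fscale k x \<in> rel_ideal R"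
    using e rel_ideal_abs[of "Smul k e" R] by simp
qed

lemma rel_ideal_br:
  assumes "x \<in> rel_ideal R"
  shows "fbr x y \<in> rel_ideal R" "fbr y x \<in> rel_ideal R"
proof -
  obtain e where e: "x = abs_free e" "liecong R e Zero"
    using assms by (auto simp: rel_ideal_def)
  obtain f where f: "y = abs_free f" by (rule abs_free_cases)
  have "liecong R (Br Zero f) Zero" "liecong R (Br f Zero) Zero"
    by (rule liecong_abs, simp)+
  then have "liecong R (Br e f) Zero" "liecong R (Br f e) Zero"
    using liecong.trans[OF liecong.cong_br[OF e(2) liecong.refl]]
      liecong.trans[OF liecong.cong_br[OF liecong.refl e(2)]] by blast+
  then show "fbr x y \<in> rel_ideal R" "fbr y x \<in> rel_ideal R"
    using e f rel_ideal_abs[of "Br e f" R] rel_ideal_abs[of "Br f e" R] by simp_all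
qed

lemma rel_ideal_rel:
  assumes "(a, b) \<in> R"
  shows "abs_free a - abs_free b \<in> rel_ideal R"
proof -
  have "liecong R (Add a (Smul (-1) b)) (Add b (Smul (-1) b))"
    using assms by (intro liecong.cong_add liecong.rel liecong.refl)
  then have "liecong R (Add a (Smul (-1) b)) Zero"
    using liecong.trans[OF _ liecong.add_neg] by blast
  then show ?thesis using rel_ideal_abs[of "Add a (Smul (-1) b)" R] by simp
qed

lemma free_homogeneous:
  obtains e f where "x = abs_free e + abs_free f" "hom e False" "hom f True"
proof -
  have "\<exists>e f. abs_free g = abs_free e + abs_free f \<and> hom e False \<and> hom f True" for g
  proof (induction g)
    case (Gen g)
    show ?case
    proof (cases "gen_par g")
      case True
      then show ?thesis using hom.intros(1)[of g] hom.intros(2)[of False]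
        by (intro exI[of _ Zero] exI[of _ "Gen g"]) simp
    next
      case False
      then show ?thesis using hom.intros(1)[of g] hom.intros(2)[of True]
        by (intro exI[of _ "Gen g"] exI[of _ Zero]) simp
    qed
  next
    case Zero
    then show ?case using hom.intros(2) by (intro exI[of _ Zero]) simp
  next
    case (Add a b)
    then obtain e f e' f' where "abs_free a = abs_free e + abs_free f" "hom e False" "hom f True"
      "abs_free b = abs_free e' + abs_free f'" "hom e' False" "hom f' True" by blast
    then show ?case
      by (intro exI[of _ "Add e e'"] exI[of _ "Add f f'"]) (simp add: hom.intros add_ac)
  next
    case (Smul c a)
    then obtain e f where "abs_free a = abs_free e + abs_free f" "hom e False" "hom f True" by blast
    then show ?case
      by (intro exI[of _ "Smul c e"] exI[of _ "Smul c f"]) (simp add: hom.intros free.scale_right_distrib)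
  next
    case (Br a b)
    then obtain e f e' f' where *: "abs_free a = abs_free e + abs_free f" "hom e False" "hom f True"
      "abs_free b = abs_free e' + abs_free f'" "hom e' False" "hom f' True" by blast
    have "hom (Add (Br e e') (Br f f')) False" "hom (Add (Br e f') (Br f e')) True"
      using * hom.intros(5)[of e False e' False] hom.intros(5)[of f True f' True]
        hom.intros(5)[of e False f' True] hom.intros(5)[of f True e' False] hom.intros(3)
      by auto
    then show ?case
      using * by (intro exI[of _ "Add (Br e e') (Br f f')"] exI[of _ "Add (Br e f') (Br f e')"])
        (simp add: free.br_add_left free.br_add_right add_ac)
  qed
  then show thesis using that abs_free_cases[of x] by metis
qed

section \<open>Leading forms and the lifting of spanning sets\<close>

text \<open>The words behind \<open>low_vec\<close>, placed in the free algebra so that the same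
  elements can be mapped to the graded quotient and to the operators.\<close>

definition free_low :: "nat \<Rightarrow> free_lie" where
  "free_low d = (if even d then fbr (fbr fX fY) ((fbr (fbr fX fZ) ^^ d) (fbr fX fY))
     else (fbr (fbr fX fZ) ^^ d) (fbr fX fY))"

definition free_basis :: "nat \<Rightarrow> free_lie set" where
  "free_basis d = {(fbr fX ^^ i) (free_low d) | i. i \<le> 2 * wt d}"

lemma zdeg_funpow: "zdeg k x \<Longrightarrow> zdeg l y \<Longrightarrow> zdeg (n * k + l) ((fbr x ^^ n) y)"
  by (induction n) (auto simp: add.assoc intro: zdeg_br)

lemma zdeg_free_basis: "x \<in> free_basis d \<Longrightarrow> zdeg d x"
proof -
  have XY: "zdeg 0 (fbr fX fY)" and XZ: "zdeg 1 (fbr fX fZ)"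
    using zdeg_br[OF zdeg_X zdeg_Y] zdeg_br[OF zdeg_X zdeg_Z] by simp_all
  have "zdeg d ((fbr (fbr fX fZ) ^^ d) (fbr fX fY))"
    using zdeg_funpow[OF XZ XY, of d] by simp
  then have "zdeg d (free_low d)"
    using zdeg_br[OF XY] by (auto simp: free_low_def)
  then have "zdeg d ((fbr fX ^^ i) (free_low d))" for i
    using zdeg_funpow[OF zdeg_X, of d "free_low d" i] by simp
  then show "x \<in> free_basis d \<Longrightarrow> zdeg d x"
    unfolding free_basis_def by blast
qed

lemma zdeg_span_UNIV: "x \<in> free.span {y. \<exists>k. zdeg k y}"
proof -
  let ?S = "{y. \<exists>k. zdeg k y}"
  have br: "fbr x y \<in> free.span ?S" if "x \<in> free.span ?S" "y \<in> free.span ?S" for x y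
    using that(1)
  proof (induction rule: free.span_induct_alt)
    case (step c u v)
    have "fbr u y \<in> free.span ?S" using that(2)
    proof (induction rule: free.span_induct_alt)
      case (step c' u' v')
      have "fbr u u' \<in> ?S" using \<open>u \<in> ?S\<close> step(1) zdeg_br by blast
      then show ?case using step(2)
        by (simp add: free.br_add_right free.br_scale_right free.span_add free.span_scale free.span_base)
    qed (simp add: free.span_zero)
    then show ?case using step(2)
      by (simp add: free.br_add_left free.br_scale_left free.span_add free.span_scale)
  qed (simp add: free.span_zero)
  have "abs_free e \<in> free.span ?S" for e
  proof (induction e)
    case (Gen g)
    have "\<exists>k. zdeg k (abs_free (Gen g))"
      using zdeg_X zdeg_Y zdeg_Z by (cases g) blast+
    then show ?case by (intro free.span_base) simp
  qed (auto intro: free.span_add free.span_scale free.span_zero br)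
  then show ?thesis using abs_free_cases[of x] by metis
qed

definition Lo :: "nat \<Rightarrow> free_lie set" where
  "Lo n = free.span {x. \<exists>i<n. zdeg i x}"

text \<open>Elements whose class vanishes in degree \<open>n\<close> of the associated graded algebra of the
  quotient by \<open>I\<close>.\<close>

definition top_rel :: "free_lie set \<Rightarrow> nat \<Rightarrow> free_lie set" where
  "top_rel I n = {x. zdeg n x \<and> (\<exists>u\<in>I. x - u \<in> Lo n)}"

definition gr_ideal :: "free_lie set \<Rightarrow> free_lie set" where
  "gr_ideal I = free.span (\<Union>n. top_rel I n)"

lemma top_rel_gr_ideal: "x \<in> top_rel I n \<Longrightarrow> x \<in> gr_ideal I"
  unfolding gr_ideal_def by (intro free.span_base) auto

lemma ideal_gr_ideal: "zdeg n x \<Longrightarrow> x \<in> I \<Longrightarrow> x \<in> gr_ideal I"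
  by (rule top_rel_gr_ideal[where n = n]) (auto simp: top_rel_def Lo_def free.span_zero intro!: bexI[of _ x])

context
  fixes I :: "free_lie set"
  assumes subI: "free.subspace I"
    and brI: "\<And>x y. x \<in> I \<Longrightarrow> fbr x y \<in> I" "\<And>x y. x \<in> I \<Longrightarrow> fbr y x \<in> I"
begin

lemma Lo_br:
  assumes "zdeg k y" "x \<in> Lo n"
  shows "fbr y x \<in> Lo (k + n)" "fbr x y \<in> Lo (n + k)"
  using assms(2) unfolding Lo_def
proof (induction rule: free.span_induct_alt)
  case (step c u v)
  then obtain i where i: "i < n" "zdeg i u" by auto
  have "\<exists>j<k + n. zdeg j (fbr y u)"
    using zdeg_br[OF assms(1) i(2)] i(1) by (intro exI[of _ "k + i"]) simp
  moreover have "\<exists>j<n + k. zdeg j (fbr u y)"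
    using zdeg_br[OF i(2) assms(1)] i(1) by (intro exI[of _ "i + k"]) simp
  ultimately have "fbr y u \<in> {x. \<exists>i<k + n. zdeg i x}" "fbr u y \<in> {x. \<exists>i<n + k. zdeg i x}"
    by simp_all
  then show "fbr y (fscale c u + v) \<in> free.span {x. \<exists>i<k + n. zdeg i x}"
    "fbr (fscale c u + v) y \<in> free.span {x. \<exists>i<n + k. zdeg i x}"
    using step(2,3)
    by (simp_all add: free.br_add_right free.br_scale_right free.br_add_left free.br_scale_left
        free.span_add free.span_scale free.span_base)
qed (simp_all add: free.span_zero)

lemma subspace_top_rel: "free.subspace (top_rel I n)"
proof (rule free.subspaceI)
  show "0 \<in> top_rel I n"
    using free.subspace_0[OF subI]
    by (auto simp: top_rel_def Lo_def free.span_zero intro!: zdeg_zero bexI[of _ 0])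
next
  fix x y assume "x \<in> top_rel I n" "y \<in> top_rel I n"
  then obtain u v where *: "zdeg n x" "zdeg n y" "u \<in> I" "v \<in> I" "x - u \<in> Lo n" "y - v \<in> Lo n"
    by (auto simp: top_rel_def)
  have "x + y - (u + v) = (x - u) + (y - v)" by simp
  also have "\<dots> \<in> Lo n" using * by (auto simp: Lo_def intro: free.span_add)
  finally show "x + y \<in> top_rel I n"
    using * free.subspace_add[OF subI] zdeg_add unfolding top_rel_def by blast
next
  fix c x assume "x \<in> top_rel I n"
  then obtain u where *: "zdeg n x" "u \<in> I" "x - u \<in> Lo n" by (auto simp: top_rel_def)
  have "fscale c x - fscale c u = fscale c (x - u)" by (simp add: free.scale_right_diff_distrib)
  also have "\<dots> \<in> Lo n" using * by (auto simp: Lo_def intro: free.span_scale)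
  finally show "fscale c x \<in> top_rel I n"
    using * free.subspace_scale[OF subI] zdeg_scale unfolding top_rel_def by blast
qed

lemma top_rel_br:
  assumes "zdeg k y" "x \<in> top_rel I n"
  shows "fbr y x \<in> top_rel I (k + n)" "fbr x y \<in> top_rel I (n + k)"
proof -
  obtain u where u: "zdeg n x" "u \<in> I" "x - u \<in> Lo n" using assms(2) by (auto simp: top_rel_def)
  then have "fbr y x - fbr y u \<in> Lo (k + n)" "fbr x y - fbr u y \<in> Lo (n + k)"
    using Lo_br[OF assms(1) u(3)] by (simp_all add: free.br_diff_left free.br_diff_right)
  then show "fbr y x \<in> top_rel I (k + n)" "fbr x y \<in> top_rel I (n + k)"
    using brI[OF u(2), of y] zdeg_br[OF assms(1) u(1)] zdeg_br[OF u(1) assms(1)]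
    unfolding top_rel_def by blast+
qed

lemma gr_ideal_br:
  assumes "x \<in> gr_ideal I"
  shows "fbr y x \<in> gr_ideal I \<and> fbr x y \<in> gr_ideal I"
proof -
  have hom: "fbr z x \<in> gr_ideal I \<and> fbr x z \<in> gr_ideal I" if "zdeg k z" for z k
    using assms unfolding gr_ideal_def
  proof (induction rule: free.span_induct_alt)
    case (step c u v)
    then obtain n where "u \<in> top_rel I n" by auto
    then have "fbr z u \<in> (\<Union>n. top_rel I n)" "fbr u z \<in> (\<Union>n. top_rel I n)"
      using top_rel_br[OF that] by blast+
    then show ?case using step(2)
      by (simp add: free.br_add_right free.br_scale_right free.br_add_left free.br_scale_left
        free.span_add free.span_scale free.span_base)
  qed (simp add: free.span_zero)
  from zdeg_span_UNIV[of y] show ?thesis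
  proof (induction rule: free.span_induct_alt)
    case (step c u v)
    then show ?case using hom
      by (auto simp: gr_ideal_def free.br_add_right free.br_scale_right free.br_add_left free.br_scale_left
        intro!: free.span_add free.span_scale)
  qed (simp add: gr_ideal_def free.span_zero)
qed

text \<open>Subtracting x in degree k from a decomposition of x gives a vanishing sum of homogeneous
  terms, so every term vanishes.\<close>

lemma zdeg_component:
  assumes A: "\<And>n. free.subspace (A n)" "\<And>n x. x \<in> A n \<Longrightarrow> zdeg n x"
    and x: "x \<in> free.span (\<Union>n. A n)" "zdeg k x"
  shows "x \<in> A k"
proof -
  have "\<exists>N f. (\<forall>n. f n \<in> A n) \<and> (\<forall>n. n \<notin> {..<N} \<longrightarrow> f n = 0) \<and> x = sum f {..<N::nat}"
    using x(1)
  proof (induction rule: free.span_induct_alt)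
    case base
    then show ?case using free.subspace_0[OF A(1)] by (intro exI[of _ 0] exI[of _ "\<lambda>_. 0"]) auto
  next
    case (step c u v)
    then obtain N f j where *: "\<forall>n. f n \<in> A n" "\<forall>n. n \<notin> {..<N} \<longrightarrow> f n = 0" "v = sum f {..<N::nat}" "u \<in> A j"
      by auto
    define M where "M = max N (Suc j)"
    define g where "g = f(j := fscale c u + f j)"
    have "v = sum f {..<M}"
      unfolding *(3) using *(2) by (intro sum.mono_neutral_left) (auto simp: M_def)
    moreover have "sum g {..<M} = fscale c u + sum f {..<M}"
    proof -
      have "sum g {..<M} = g j + sum g ({..<M} - {j})" by (intro sum.remove) (auto simp: M_def)
      also have "sum g ({..<M} - {j}) = sum f ({..<M} - {j})" by (intro sum.cong) (auto simp: g_def)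
      also have "g j + sum f ({..<M} - {j}) = fscale c u + (f j + sum f ({..<M} - {j}))" by (simp add: g_def)
      also have "f j + sum f ({..<M} - {j}) = sum f {..<M}" by (intro sum.remove[symmetric]) (auto simp: M_def)
      finally show ?thesis .
    qed
    moreover have "\<forall>n. g n \<in> A n"
      using * free.subspace_add[OF A(1)] free.subspace_scale[OF A(1)] by (auto simp: g_def)
    moreover have "\<forall>n. n \<notin> {..<M} \<longrightarrow> g n = 0" using *(2) by (auto simp: g_def M_def)
    ultimately show ?case by (intro exI[of _ M] exI[of _ g]) auto
  qed
  then obtain N f where f: "\<forall>n. f n \<in> A n" "\<forall>n. n \<notin> {..<N} \<longrightarrow> f n = 0" "x = sum f {..<N::nat}"
    by blast
  define M where "M = max N (Suc k)"
  define h where "h n = f n - (if n = k then x else 0)" for n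
  have "sum h {..<M} = sum f {..<M} - x"
    unfolding h_def sum_subtractf by (simp add: M_def less_max_iff_disj)
  also have "sum f {..<M} = sum f {..<N}"
    using f(2) by (intro sum.mono_neutral_right) (auto simp: M_def)
  finally have "sum h {..<M} = 0" using f(3) by simp
  moreover have "zdeg n (h n)" for n
  proof (cases "n = k")
    case True
    have "zdeg k (f k)" using f(1) A(2) by blast
    then show ?thesis using True zdeg_diff[of k "f k" x] x(2) by (simp add: h_def)
  next
    case False
    then show ?thesis using A(2) f(1) by (simp add: h_def)
  qed
  ultimately have "h k = 0"
    using zdeg_direct[of "{..<M}" h k] by (simp add: M_def)
  then show ?thesis using f(1) by (metis eq_iff_diff_eq_0 h_def)
qed

text \<open>A homogeneous x of degree k is, up to basis elements of degree k, a leading form z of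
  some u in I. Then z - u lies in smaller degrees, where the induction hypothesis applies.\<close>

theorem span_free_basis_if_graded:
  assumes gr: "\<And>x. \<exists>y\<in>free.span (\<Union>d. free_basis d). x - y \<in> gr_ideal I"
  shows "\<exists>y\<in>free.span (\<Union>d. free_basis d). x - y \<in> I"
proof -
  let ?B = "free.span (\<Union>d. free_basis d)"
  define A where "A n = {y + z | y z. y \<in> free.span (free_basis n) \<and> z \<in> top_rel I n}" for n
  have subA: "free.subspace (A n)" for n
    unfolding A_def by (intro free.subspace_sums free.subspace_span subspace_top_rel)
  have zA: "zdeg n x" if x: "x \<in> A n" for n x
  proof -
    obtain y z where yz: "x = y + z" "y \<in> free.span (free_basis n)" "z \<in> top_rel I n"
      using x unfolding A_def by blast
    have "free.span (free_basis n) \<subseteq> {x. zdeg n x}"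
      by (rule free.span_minimal[OF _ subspace_zdeg]) (blast intro: zdeg_free_basis)
    then have "zdeg n y" using yz(2) by blast
    moreover have "zdeg n z" using yz(3) by (simp add: top_rel_def)
    ultimately show ?thesis unfolding yz(1) by (rule zdeg_add)
  qed
  have all: "x \<in> free.span (\<Union>n. A n)" for x
  proof -
    obtain y where y: "y \<in> ?B" "x - y \<in> gr_ideal I" using gr by blast
    have lA: "y \<in> A d" if "y \<in> free_basis d" for y d
      using that free.span_base[of y "free_basis d"] free.subspace_0[OF subspace_top_rel, of d]
      unfolding A_def by (intro CollectI exI[of _ y] exI[of _ 0]) simp
    have tA: "y \<in> A d" if "y \<in> top_rel I d" for y d
      using that free.span_zero[of "free_basis d"]
      unfolding A_def by (intro CollectI exI[of _ 0] exI[of _ y]) simp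
    have "(\<Union>d. free_basis d) \<subseteq> (\<Union>n. A n)" using lA by auto
    from subsetD[OF free.span_mono[OF this] y(1)] have "y \<in> free.span (\<Union>n. A n)" .
    moreover have "(\<Union>n. top_rel I n) \<subseteq> (\<Union>n. A n)" using tA by auto
    from subsetD[OF free.span_mono[OF this] y(2)[unfolded gr_ideal_def]]
    have "x - y \<in> free.span (\<Union>n. A n)" .
    ultimately have "y + (x - y) \<in> free.span (\<Union>n. A n)" by (rule free.span_add)
    then show ?thesis by simp
  qed
  define P where "P = {y + u | y u. y \<in> ?B \<and> u \<in> I}"
  have subP: "free.subspace P"
    unfolding P_def by (intro free.subspace_sums free.subspace_span subI)
  have BP: "x \<in> P" if "x \<in> ?B" for x
    using that free.subspace_0[OF subI] unfolding P_def
    by (intro CollectI exI[of _ x] exI[of _ 0]) simp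
  have IP: "x \<in> P" if "x \<in> I" for x
    using that free.span_zero unfolding P_def
    by (intro CollectI exI[of _ 0] exI[of _ x]) simp
  have deg: "zdeg k x \<Longrightarrow> x \<in> P" for k x
  proof (induction k arbitrary: x rule: less_induct)
    case (less k)
    have "x \<in> A k" using zdeg_component[OF subA zA all less.prems] .
    then obtain y z where yz: "x = y + z" "y \<in> free.span (free_basis k)" "z \<in> top_rel I k" unfolding A_def by blast
    then obtain u where u: "u \<in> I" "z - u \<in> Lo k" by (auto simp: top_rel_def)
    have "Lo k \<subseteq> P"
      unfolding Lo_def by (rule free.span_minimal[OF _ subP]) (use less.IH in blast)
    moreover have "y \<in> ?B"
      by (rule subsetD[OF free.span_mono yz(2)]) blast
    ultimately have "y + (u + (z - u)) \<in> P"
      using u(1,2) BP[of y] IP[of u] by (intro free.subspace_add[OF subP]) blast+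
    then show ?case using yz by simp
  qed
  have "free.span {y. \<exists>k. zdeg k y} \<subseteq> P"
    by (rule free.span_minimal[OF _ subP]) (use deg in blast)
  then have "x \<in> P" using zdeg_span_UNIV by blast
  then obtain y u where "x = y + u" "y \<in> ?B" "u \<in> I" unfolding P_def by blast
  then have "x - y \<in> I" by (simp only: add_diff_cancel_left')
  with \<open>y \<in> ?B\<close> show ?thesis by (rule bexI[rotated])
qed

end

section \<open>The graded quotient by the given relations\<close>

context
  fixes lam t :: complex
begin

abbreviation (input) "J \<equiv> gr_ideal (rel_ideal (rels lam t))"

lemma J_br: "x \<in> J \<Longrightarrow> fbr y x \<in> J" "x \<in> J \<Longrightarrow> fbr x y \<in> J"
  using gr_ideal_br[OF subspace_rel_ideal rel_ideal_br] by blast+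

lemma subspace_J: "free.subspace J"
  unfolding gr_ideal_def by (rule free.subspace_span)

lemma rel_in_J:
  assumes "(e, f) \<in> rels lam t" "zdeg n (abs_free e - abs_free f)"
  shows "abs_free e - abs_free f \<in> J"
  using ideal_gr_ideal[OF assms(2)] rel_ideal_rel[OF assms(1)] by blast

lemma zdeg_free:
  "zdeg 0 (fbr fX fY)" "zdeg 0 (fbr fX (fbr fX fY))" "zdeg 1 ((fbr fX ^^ i) fZ)"
  using zdeg_br[OF zdeg_X zdeg_Y] zdeg_br[OF zdeg_X zdeg_br[OF zdeg_X zdeg_Y]]
    zdeg_funpow[OF zdeg_X zdeg_Z] by simp_all

lemma adX_simps: "abs_free (eYi i) = (fbr fX ^^ i) fY" "abs_free (eZi i) = (fbr fX ^^ i) fZ"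
  by (simp_all add: eYi_def eZi_def abs_free_adX)

text \<open>Types cannot depend on \<open>lam\<close> and \<open>t\<close>, so the quotient by \<open>J\<close> is modelled on the whole type
  \<open>free_lie\<close>: the bracket is followed by a linear projection \<open>\<pi>\<close> with kernel \<open>J\<close>.\<close>

lemma graded_span: "\<exists>y\<in>free.span (\<Union>d. free_basis d). x - y \<in> J"
proof -
  obtain \<pi> where \<pi>: "Vector_Spaces.linear fscale fscale \<pi>" "\<And>x. \<pi> x = 0 \<longleftrightarrow> x \<in> J" "\<And>x. x - \<pi> x \<in> J"
    using free.exists_projection[OF subspace_J] by auto
  interpret \<pi>: Vector_Spaces.linear fscale fscale \<pi> by (fact \<pi>(1))
  have \<pi>_eq: "\<pi> x = \<pi> y \<longleftrightarrow> x - y \<in> J" for x y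
    using \<pi>(2)[of "x - y"] by (simp add: \<pi>.diff)
  have \<pi>_\<pi> [simp]: "\<pi> (\<pi> x) = \<pi> x" for x
    using \<pi>(2)[of "x - \<pi> x"] \<pi>(3)[of x] by (simp add: \<pi>.diff)
  have cong: "\<pi> (fbr x y) = \<pi> (fbr x' y')" if "\<pi> x = \<pi> x'" "\<pi> y = \<pi> y'" for x y x' y'
  proof -
    have "fbr x y - fbr x' y' = fbr (x - x') y + fbr x' (y - y')"
      by (simp add: free.br_diff_left free.br_diff_right)
    also have "\<dots> \<in> J"
      using that unfolding \<pi>_eq by (intro free.subspace_add[OF subspace_J] J_br)
    finally show ?thesis unfolding \<pi>_eq .
  qed
  define B where "B x y = \<pi> (fbr x y)" for x y
  define P where "P r x \<longleftrightarrow> (\<exists>y. fpar r y \<and> \<pi> x = \<pi> y)" for r x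
  have B_\<pi>: "B (\<pi> x) y = B x y" "B x (\<pi> y) = B x y" for x y
    unfolding B_def by (rule cong; simp)+
  have B_cong: "B x y = B x' y'" if "\<pi> x = \<pi> x'" "\<pi> y = \<pi> y'" for x y x' y'
    unfolding B_def using that by (rule cong)
  have \<pi>_B: "\<pi> (B x y) = B x y" for x y by (simp add: B_def)
  have P_\<pi>: "fpar r x \<Longrightarrow> P r (\<pi> x)" for r x
    unfolding P_def by (intro exI[of _ x]) simp
  interpret q: super_lie fscale B P
  proof
    fix x y z :: free_lie and k :: complex and r q :: bool
    show "B (x + y) z = B x z + B y z" "B x (y + z) = B x y + B x z"
      "B (fscale k x) y = fscale k (B x y)" "B x (fscale k y) = fscale k (B x y)"
      by (simp_all add: B_def free.br_add_left free.br_add_right free.br_scale_left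
        free.br_scale_right \<pi>.add \<pi>.scale)
    show "P r (fscale k x)" if "P r x"
      using that free.par_scale unfolding P_def by (metis \<pi>.scale)
    show "P r (x + y)" if "P r x" "P r y"
      using that free.par_add unfolding P_def by (metis \<pi>.add)
    assume "P r x" "P q y"
    then obtain x' y' where x': "fpar r x'" "\<pi> x = \<pi> x'" and y': "fpar q y'" "\<pi> y = \<pi> y'"
      unfolding P_def by blast
    show "P (r \<noteq> q) (B x y)"
      unfolding P_def using free.par_br[OF x'(1) y'(1)] cong[OF x'(2) y'(2)]
      by (intro exI[of _ "fbr x' y'"]) (simp add: B_def)
    have "B x y = \<pi> (fbr x' y')" "B y x = \<pi> (fbr y' x')"
      unfolding B_def using x'(2) y'(2) by (auto intro: cong)
    then show "B x y = fscale (- sgn_par r q) (B y x)"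
      using free.antisym[OF x'(1) y'(1)] by (simp add: \<pi>.scale \<pi>.neg)
    have "B x (B y z) = \<pi> (fbr x' (fbr y' z))" "B (B x y) z = \<pi> (fbr (fbr x' y') z)"
      "B y (B x z) = \<pi> (fbr y' (fbr x' z))"
      unfolding B_def using x'(2) y'(2) by (auto intro!: cong)
    then show "B x (B y z) = B (B x y) z + fscale (sgn_par r q) (B y (B x z))"
      using free.jacobi[OF x'(1) y'(1), of z] by (simp add: \<pi>.add \<pi>.scale)
  qed
  have pow: "(B (\<pi> x) ^^ n) (\<pi> y) = \<pi> ((fbr x ^^ n) y)" for x y n
  proof (induction n)
    case (Suc n)
    then show ?case by (simp add: B_\<pi>) (simp add: B_def)
  qed simp
  have \<pi>_fbr: "\<pi> (fbr x y) = B (\<pi> x) (\<pi> y)" for x y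
    by (simp add: B_\<pi>) (simp add: B_def)
  note rel = rel_in_J[folded \<pi>_eq]
  interpret g: graded_osp fscale B P "\<pi> fX" "\<pi> fY" "\<pi> fZ"
  proof
    show "P True (\<pi> fX)" "P False (\<pi> fY)" "P True (\<pi> fZ)"
      using fpar_abs[OF hom.intros(1), of GX] fpar_abs[OF hom.intros(1), of GY]
        fpar_abs[OF hom.intros(1), of GZ] P_\<pi> by auto
    show "B (\<pi> fY) (B (\<pi> fX) (\<pi> fY)) = 0"
      using rel[of "Br eY (eYi 1)" Zero 0] zdeg_br[OF zdeg_Y zdeg_free(1)]
      by (simp add: rels_def adX_simps \<pi>_fbr \<pi>.zero)
    show "B (B (\<pi> fX) (B (\<pi> fX) (\<pi> fY))) (\<pi> fY) = fscale 2 (\<pi> fY)"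
      using rel[of "Br (eYi 2) eY" "Smul 2 eY" 0]
        zdeg_diff[OF zdeg_br[OF zdeg_free(2) zdeg_Y, simplified] zdeg_scale[OF zdeg_Y, of 2]]
      by (simp add: rels_def adX_simps \<pi>_fbr \<pi>.scale numeral_2_eq_2)
    show "B (B (\<pi> fX) (B (\<pi> fX) (\<pi> fY))) (\<pi> fX) = - \<pi> fX"
      using rel[of "Br (eYi 2) eX" "Smul (-1) eX" 0]
        zdeg_diff[OF zdeg_br[OF zdeg_free(2) zdeg_X, simplified] zdeg_scale[OF zdeg_X, of "-1"]]
      by (simp add: rels_def adX_simps \<pi>_fbr \<pi>.neg numeral_2_eq_2)
    show "B (B (\<pi> fX) (\<pi> fY)) (\<pi> fZ) = 0"
      using rel[of "Br (Br eX eY) eZ" Zero 1] zdeg_br[OF zdeg_free(1) zdeg_Z]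
      by (simp add: rels_def \<pi>_fbr \<pi>.zero)
    show "(B (\<pi> fX) ^^ 7) (\<pi> fZ) = 0"
      using rel[of "adX 7 eZ" Zero 1] zdeg_free(3)[of 7]
      by (simp add: rels_def pow abs_free_adX \<pi>.zero)
    show "B (B (\<pi> fX) (B (\<pi> fX) (\<pi> fY))) (\<pi> fZ) = fscale 3 (\<pi> fZ)"
      using rel[of "Br (eYi 2) eZ" "Smul 3 eZ" 1]
        zdeg_diff[OF zdeg_br[OF zdeg_free(2) zdeg_Z, simplified] zdeg_scale[OF zdeg_Z, of 3, simplified]]
      by (simp add: rels_def adX_simps \<pi>_fbr \<pi>.scale numeral_2_eq_2)
    \<comment> \<open>The other side of this relation has terms of degree 0 and 1 only, so the
      bracket is the leading form of an element of the ideal.\<close>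
    have "zdeg 2 (fbr (fbr fX fZ) ((fbr fX ^^ 3) fZ))"
      using zdeg_br[OF zdeg_free(3)[of 1] zdeg_free(3)[of 3]] by (simp add: numeral_2_eq_2)
    moreover have "Lo1": "zdeg 0 fY" "zdeg 1 (fbr fX fZ)" using zdeg_Y zdeg_free(3)[of 1] by simp_all
    ultimately have "fbr (fbr fX fZ) ((fbr fX ^^ 3) fZ) \<in> top_rel (rel_ideal (rels lam t)) 2"
    proof -
      let ?e = "Br (eZi 1) (eZi 3)"
      let ?f = "Add (Smul (2 * t^2 * (lam - 1) * (lam + 2)) eY) (Smul (2 * t * (2 * lam + 1)) (eZi 1))"
      have f: "abs_free ?f \<in> Lo 2"
      proof -
        have "fY \<in> Lo 2"
          unfolding Lo_def by (rule free.span_base) (use Lo1(1) in \<open>auto intro!: exI[of _ 0]\<close>)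
        moreover have "fbr fX fZ \<in> Lo 2"
          unfolding Lo_def by (rule free.span_base) (use Lo1(2) in \<open>auto intro!: exI[of _ 1]\<close>)
        ultimately show ?thesis
          unfolding Lo_def by (simp add: adX_simps free.span_add free.span_scale)
      qed
      have e: "zdeg 2 (abs_free ?e)"
        using zdeg_br[OF zdeg_free(3)[of 1] zdeg_free(3)[of 3]] by (simp add: adX_simps numeral_2_eq_2)
      have "abs_free ?e - abs_free ?f \<in> rel_ideal (rels lam t)"
        by (rule rel_ideal_rel) (simp add: rels_def)
      then have "abs_free ?e \<in> top_rel (rel_ideal (rels lam t)) 2"
        unfolding top_rel_def using e f
        by (auto simp del: abs_free_simps intro!: bexI[of _ "abs_free ?e - abs_free ?f"])
      then show ?thesis by (simp add: adX_simps)
    qed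
    then have "\<pi> (fbr (fbr fX fZ) ((fbr fX ^^ 3) fZ)) = 0"
      unfolding \<pi>(2) by (rule top_rel_gr_ideal)
    then show "B (B (\<pi> fX) (\<pi> fZ)) ((B (\<pi> fX) ^^ 3) (\<pi> fZ)) = 0"
      by (simp only: \<pi>_fbr pow)
    show "B (B (\<pi> fX) (\<pi> fZ)) (B (\<pi> fZ) (\<pi> fZ)) = 0"
      using rel[of "Br (eZi 1) (Br eZ eZ)" Zero 3]
        zdeg_br[OF zdeg_free(3)[of 1] zdeg_br[OF zdeg_Z zdeg_Z]]
      by (simp add: rels_def adX_simps \<pi>_fbr \<pi>.zero numeral_3_eq_3 numeral_2_eq_2)
  qed
  have low_vec: "g.low_vec d = \<pi> (free_low d)" for d
    unfolding g.low_vec_def free_low_def g.p_def g.a_def g.Zi_def One_nat_def funpow.simps o_def id_def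
    by (simp add: \<pi>_fbr pow[symmetric])
  have basis_vecs: "g.basis_vecs = \<pi> ` (\<Union>d. free_basis d)"
    unfolding g.basis_vecs_def free_basis_def low_vec pow by blast
  have alg: "g.alg r (\<pi> (abs_free e))" if "hom e r" for e r
    using that
  proof (induction rule: hom.induct)
    case (1 g)
    then show ?case using g.alg.intros(1-3) by (cases g) auto
  next
    case (2 r)
    have "g.alg r (fscale 0 (\<pi> (if r then fX else fY)))"
      by (rule g.alg.intros(5)) (use g.alg.intros(1,2) in auto)
    then show ?case by (simp add: \<pi>.zero)
  next
    case (3 a p b)
    then show ?case using g.alg.intros(4) by (simp add: \<pi>.add)
  next
    case (4 a p c)
    then show ?case using g.alg.intros(5) by (simp add: \<pi>.scale)
  next
    case (5 a p b q)
    then show ?case using g.alg.intros(6)[OF 5(3,4)] by (simp add: \<pi>_fbr)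
  qed
  obtain e f where x: "x = abs_free e + abs_free f" "hom e False" "hom f True"
    by (rule free_homogeneous)
  have "\<pi> x \<in> free.span g.basis_vecs"
    unfolding x(1) \<pi>.add by (intro free.span_add g.alg_basis_vecs[OF alg[OF x(2)]] g.alg_basis_vecs[OF alg[OF x(3)]])
  then have "\<pi> x \<in> \<pi> ` free.span (\<Union>d. free_basis d)"
    unfolding basis_vecs \<pi>.span_image .
  then show ?thesis unfolding \<pi>_eq[symmetric] by auto
qed

theorem span_free_basis: "\<exists>y\<in>free.span (\<Union>d. free_basis d). x - y \<in> rel_ideal (rels lam t)"
  by (rule span_free_basis_if_graded[OF subspace_rel_ideal rel_ideal_br graded_span])

end

section \<open>Differential operators\<close>

definition psm :: "complex \<Rightarrow> sfun \<Rightarrow> sfun" where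
  "psm c v = (smult c (fst v), smult c (snd v))"

lemma psm_simps [simp]:
  "psm c (u + v) = psm c u + psm c v" "psm c (u - v) = psm c u - psm c v"
  "psm c (psm d v) = psm (c * d) v" "psm 1 v = v" "psm 0 v = 0" "psm c 0 = 0"
  "psm (- c) v = - psm c v" "psm c (- v) = - psm c v"
  by (simp_all add: psm_def prod_eq_iff smult_add_right smult_diff_right)

lemma psm_add_left: "psm (c + d) v = psm c v + psm d v"
  by (simp add: psm_def prod_eq_iff smult_add_left)

lemma psm_eq_0_iff: "psm c v = 0 \<longleftrightarrow> c = 0 \<or> v = 0"
  by (auto simp: psm_def prod_eq_iff)

lemma op_simps:
  "op_zero v = 0" "op_add A B v = A v + B v" "op_smul c A v = psm c (A v)"
  "op_br r q A B v = A (B v) - psm (sgn_par r q) (B (A v))"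
  by (simp_all add: op_zero_def op_add_def op_smul_def op_br_def psm_def prod_eq_iff)

definition op_linear :: "sop \<Rightarrow> bool" where
  "op_linear A \<longleftrightarrow> (\<forall>u v. A (u + v) = A u + A v) \<and> (\<forall>c v. A (psm c v) = psm c (A v))"

lemma op_linearD:
  assumes "op_linear A"
  shows "A (u + v) = A u + A v" "A (psm c v) = psm c (A v)" "A 0 = 0" "A (- v) = - A v"
    "A (u - v) = A u - A v"
proof -
  have add: "A (u + v) = A u + A v" and sm: "A (psm c v) = psm c (A v)" for u v c
    using assms unfolding op_linear_def by blast+
  show "A (u + v) = A u + A v" "A (psm c v) = psm c (A v)" by (fact add sm)+
  show "A 0 = 0" using sm[of 0 0] by simp
  show neg: "A (- v) = - A v" for v using sm[of "-1" v] by simp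
  show "A (u - v) = A u - A v" using add[of u "- v"] neg[of v] by simp
qed

lemma op_linear_gen: "op_linear (opX lam)" "op_linear opY" "op_linear (opZ t)" "op_linear op_zero"
  by (auto simp: op_linear_def opX_def opY_def opZ_def op_simps d_x_def d_th_def mul_x_def mul_th_def
      psm_def prod_eq_iff pderiv_add pderiv_smult pderiv_diff pderiv_minus smult_add_right
      smult_diff_right algebra_simps)

lemma op_linear_add: "op_linear A \<Longrightarrow> op_linear B \<Longrightarrow> op_linear (op_add A B)"
  by (simp add: op_linear_def op_simps add_ac)

lemma op_linear_smul: "op_linear A \<Longrightarrow> op_linear (op_smul c A)"
  by (simp add: op_linear_def op_simps mult.commute)

lemma op_linear_br: "op_linear A \<Longrightarrow> op_linear B \<Longrightarrow> op_linear (op_br r q A B)"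
  unfolding op_linear_def op_simps
  by (simp add: mult.commute algebra_simps del: split_paired_All)

lemma op_linear_evalp: "op_linear (fst (evalp lam t e)) \<and> op_linear (snd (evalp lam t e))"
proof (induction e)
  case (Gen g)
  then show ?case by (cases g) (simp_all add: op_linear_gen)
qed (simp_all add: op_linear_gen op_linear_add op_linear_smul op_linear_br)

lemmas evalp_linear = op_linearD[OF conjunct1[OF op_linear_evalp]] op_linearD[OF conjunct2[OF op_linear_evalp]]

lemma evalp_hom: "hom e r \<Longrightarrow> (if r then fst (evalp lam t e) else snd (evalp lam t e)) = op_zero"
proof (induction rule: hom.induct)
  case (1 g)
  then show ?case by (cases g) simp_all
next
  case (5 a p b q)
  then show ?case
    by (cases p; cases q) (simp_all add: fun_eq_iff op_simps evalp_linear del: split_paired_All)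
qed (auto simp: fun_eq_iff op_simps)

text \<open>With no relations this makes evaluation well defined on the free algebra; with
  \<open>rels lam t\<close> it puts their ideal into the kernel.\<close>

lemma evalp_cong:
  assumes "\<And>l r. (l, r) \<in> R \<Longrightarrow> evalp lam t l = evalp lam t r" and "liecong R a b"
  shows "evalp lam t a = evalp lam t b"
  using assms(2)
proof (induction rule: liecong.induct)
  case (rel a b)
  then show ?case by (rule assms(1))
next
  case (antisym a p b q)
  show ?case
    using evalp_hom[OF antisym(1), of lam t] evalp_hom[OF antisym(2), of lam t]
    by (cases p; cases q)
      (simp_all add: prod_eq_iff[of "(_, _)"] fun_eq_iff op_simps evalp_linear sgn_par_def add.commute
        del: split_paired_All)
next
  case (jacobi a p b q c)
  show ?case
    using evalp_hom[OF jacobi(1), of lam t] evalp_hom[OF jacobi(2), of lam t]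
    by (cases p; cases q)
      (simp_all add: prod_eq_iff[of "(_, _)"] fun_eq_iff op_simps evalp_linear sgn_par_def algebra_simps
        del: split_paired_All)
qed (simp_all add: prod_eq_iff[of "(_, _)"] fun_eq_iff op_simps evalp_linear psm_add_left algebra_simps)

lift_definition evf :: "complex \<Rightarrow> complex \<Rightarrow> free_lie \<Rightarrow> sop \<times> sop" is evalp
  using evalp_cong[where R = "{}"] by blast

lemma evf_abs: "evf lam t (abs_free e) = evalp lam t e"
  by (rule evf.abs_eq)

lemma op_linear_evf: "op_linear (fst (evf lam t x))" "op_linear (snd (evf lam t x))"
  by (rule abs_free_cases[of x], simp add: evf_abs op_linear_evalp)+

lemma evf_simps:
  "evf lam t 0 = (op_zero, op_zero)"
  "evf lam t (x + y) = (op_add (fst (evf lam t x)) (fst (evf lam t y)),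
      op_add (snd (evf lam t x)) (snd (evf lam t y)))"
  "evf lam t (fscale c x) = (op_smul c (fst (evf lam t x)), op_smul c (snd (evf lam t x)))"
  "evf lam t (fbr x y) =
     (op_add (op_br False False (fst (evf lam t x)) (fst (evf lam t y)))
             (op_br True True (snd (evf lam t x)) (snd (evf lam t y))),
      op_add (op_br False True (fst (evf lam t x)) (snd (evf lam t y)))
             (op_br True False (snd (evf lam t x)) (fst (evf lam t y))))"
proof -
  obtain e f where x: "x = abs_free e" and y: "y = abs_free f"
    using abs_free_cases by metis
  show "evf lam t 0 = (op_zero, op_zero)"
    using evf_abs[of lam t Zero] by simp
  show "evf lam t (x + y) = (op_add (fst (evf lam t x)) (fst (evf lam t y)),
      op_add (snd (evf lam t x)) (snd (evf lam t y)))"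
    using evf_abs[of lam t "Add e f"] by (simp add: x y evf_abs)
  show "evf lam t (fscale c x) = (op_smul c (fst (evf lam t x)), op_smul c (snd (evf lam t x)))"
    using evf_abs[of lam t "Smul c e"] by (simp add: x evf_abs)
  show "evf lam t (fbr x y) =
     (op_add (op_br False False (fst (evf lam t x)) (fst (evf lam t y)))
             (op_br True True (snd (evf lam t x)) (snd (evf lam t y))),
      op_add (op_br False True (fst (evf lam t x)) (snd (evf lam t y)))
             (op_br True False (snd (evf lam t x)) (fst (evf lam t y))))"
    using evf_abs[of lam t "Br e f"] by (simp add: x y evf_abs)
qed

lemma evf_br:
  shows "evf lam t x = (A, op_zero) \<Longrightarrow> evf lam t y = (B, op_zero) \<Longrightarrow>
      evf lam t (fbr x y) = (\<lambda>v. A (B v) - B (A v), op_zero)"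
    and "evf lam t x = (A, op_zero) \<Longrightarrow> evf lam t y = (op_zero, B) \<Longrightarrow>
      evf lam t (fbr x y) = (op_zero, \<lambda>v. A (B v) - B (A v))"
    and "evf lam t x = (op_zero, A) \<Longrightarrow> evf lam t y = (B, op_zero) \<Longrightarrow>
      evf lam t (fbr x y) = (op_zero, \<lambda>v. A (B v) - B (A v))"
    and "evf lam t x = (op_zero, A) \<Longrightarrow> evf lam t y = (op_zero, B) \<Longrightarrow>
      evf lam t (fbr x y) = (\<lambda>v. A (B v) + B (A v), op_zero)"
  using op_linear_evf[of lam t x] op_linear_evf[of lam t y]
  by (simp_all add: evf_simps fun_eq_iff op_simps op_linearD sgn_par_def del: split_paired_All)

section \<open>Explicit operators and verification of the relations\<close>

text \<open>x and the constants are kept as atoms. With the rules \<open>pd\<close>, operator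
  identities become identities in a commutative ring over x, lam, t and derivatives of the
  arguments.\<close>

definition x_poly :: "complex poly" where "x_poly = [:0, 1:]"
definition const_poly :: "complex \<Rightarrow> complex poly" where "const_poly c = [:c:]"

lemma const_poly_hom: "const_poly (a + b) = const_poly a + const_poly b" "const_poly (a - b) = const_poly a - const_poly b" "const_poly (a * b) = const_poly a * const_poly b"
  "const_poly (- a) = - const_poly a" "const_poly 0 = 0" "const_poly 1 = 1" "const_poly (numeral n) = numeral n" "const_poly (a ^ k) = const_poly a ^ k"
  by (simp_all add: const_poly_def numeral_poly one_poly_eq_simps pCons_one poly_const_pow)

lemma smult_const_poly: "smult c p = const_poly c * p"
  by (simp add: const_poly_def)

lemma pderiv_rules: "pderiv x_poly = 1" "pderiv (const_poly c) = 0" "pderiv (numeral n :: complex poly) = 0"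
  "pderiv (const_poly c ^ k) = 0"
proof -
  show "pderiv x_poly = 1" "pderiv (const_poly c) = 0" by (simp_all add: x_poly_def const_poly_def pderiv_pCons)
  show "pderiv (numeral n :: complex poly) = 0" by (simp add: numeral_poly pderiv_pCons)
  show "pderiv (const_poly c ^ k) = 0" by (simp add: const_poly_def poly_const_pow pderiv_pCons)
qed

lemmas pd = pderiv_rules pderiv_mult pderiv_add pderiv_diff pderiv_minus pderiv_1 pderiv_0

text \<open>The operators \<open>Z\<^sub>0/t, \<dots>, Z\<^sub>6/t\<close>, acting on \<open>f + g \<theta>\<close>.\<close>

definition zop :: "complex \<Rightarrow> nat \<Rightarrow> sop" where
  "zop lam i = (\<lambda>(f, g). let L = const_poly lam; f1 = pderiv f; f2 = pderiv f1; g1 = pderiv g in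
     [(g1, - f2),
      ((1 - L) * f1, (- 2 - L) * g1),
      ((L - 1) * g - 3 * x_poly * g1, 3 * x_poly * f2 + (2 - 2 * L) * f1),
      ((2 * L - 2) * x_poly * f1 + (L - L^2) * f, (4 + 2 * L) * x_poly * g1 + (2 - L - L^2) * g),
      (6 * x_poly^2 * g1 + (4 - 4 * L) * x_poly * g, (8 * L - 8) * x_poly * f1 - 6 * x_poly^2 * f2 + (2 * L - 2 * L^2) * f),
      ((2 - 2 * L) * x_poly^2 * f1 + (2 * L^2 - 2 * L) * x_poly * f,
        (- 4 - 2 * L) * x_poly^2 * g1 + (2 * L - 4 + 2 * L^2) * x_poly * g),
      ((6 * L - 6) * x_poly^2 * g - 6 * x_poly^3 * g1,
        6 * x_poly^3 * f2 + (12 - 12 * L) * x_poly^2 * f1 + (6 * L^2 - 6 * L) * x_poly * f)] ! i)"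

lemma higher_pderiv_x: "(pderiv ^^ n) (x_poly * pderiv q) = x_poly * (pderiv ^^ Suc n) q + of_nat n * (pderiv ^^ n) q"
  by (induction n) (simp_all add: pd algebra_simps)

lemma higher_pderiv_linear:
  "(pderiv ^^ n) (p + q) = (pderiv ^^ n) p + (pderiv ^^ n) q"
  "(pderiv ^^ n) (p - q) = (pderiv ^^ n) p - (pderiv ^^ n) q"
  "(pderiv ^^ n) (- p) = - (pderiv ^^ n) p"
  "(pderiv ^^ n) (const_poly c * p) = const_poly c * (pderiv ^^ n) p"
  "(pderiv ^^ n) (numeral k * p) = numeral k * (pderiv ^^ n) p"
  "(pderiv ^^ n) ((const_poly c - 1) * p) = (const_poly c - 1) * (pderiv ^^ n) p"
  by (induction n) (simp_all add: pd)

lemma higher_pderiv_pderiv: "(pderiv ^^ n) (pderiv p) = pderiv ((pderiv ^^ n) p)"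
  by (simp add: funpow_swap1)

context
  fixes lam t :: complex
begin

abbreviation (input) "ev \<equiv> evf lam t"
abbreviation (input) "Zt i \<equiv> (fbr fX ^^ i) fZ"

lemma ev_X: "ev fX = (op_zero, \<lambda>(f, g). (x_poly * g, x_poly * pderiv f - const_poly lam * f))"
  by (auto simp: evf_abs fun_eq_iff opX_def op_simps d_th_def d_x_def mul_x_def mul_th_def psm_def
      smult_const_poly const_poly_hom x_poly_def)

lemma ev_Y: "ev fY = (\<lambda>(f, g). (pderiv f, pderiv g), op_zero)"
  by (simp add: evf_abs opY_def d_x_def)

lemma ev_Z: "ev fZ = (op_zero, \<lambda>v. psm t (zop lam 0 v))"
  by (auto simp: evf_abs fun_eq_iff opZ_def zop_def op_simps d_th_def d_x_def mul_th_def psm_def smult_const_poly const_poly_hom)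

lemma ev_p: "ev (fbr fX fY) = (op_zero, \<lambda>(f, g). (- g, - pderiv f))"
  unfolding evf_br(3)[OF ev_X ev_Y]
  by (auto simp: fun_eq_iff pd algebra_simps)

lemma ev_H: "ev (fbr fX (fbr fX fY)) =
    (\<lambda>(f, g). (const_poly lam * f - 2 * x_poly * pderiv f, (const_poly lam - 1) * g - 2 * x_poly * pderiv g), op_zero)"
  unfolding evf_br(4)[OF ev_X ev_p]
  by (auto simp: fun_eq_iff pd algebra_simps)

lemma ev_Zt:
  "ev (Zt 1) = (\<lambda>v. psm t (zop lam 1 v), op_zero)"
  "ev (Zt 2) = (op_zero, \<lambda>v. psm t (zop lam 2 v))"
  "ev (Zt 3) = (\<lambda>v. psm t (zop lam 3 v), op_zero)"
  "ev (Zt 4) = (op_zero, \<lambda>v. psm t (zop lam 4 v))"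
  "ev (Zt 5) = (\<lambda>v. psm t (zop lam 5 v), op_zero)"
  "ev (Zt 6) = (op_zero, \<lambda>v. psm t (zop lam 6 v))"
  "ev (Zt 7) = (op_zero, op_zero)"
proof -
  note zs = fun_eq_iff zop_def Let_def psm_def smult_const_poly pd op_simps power2_eq_square
    power3_eq_cube
  have st: "Zt 1 = fbr fX fZ" "Zt 2 = fbr fX (Zt 1)" "Zt 3 = fbr fX (Zt 2)" "Zt 4 = fbr fX (Zt 3)"
    "Zt 5 = fbr fX (Zt 4)" "Zt 6 = fbr fX (Zt 5)" "Zt 7 = fbr fX (Zt 6)"
    by (simp_all add: numeral_eq_Suc)
  show 1: "ev (Zt 1) = (\<lambda>v. psm t (zop lam 1 v), op_zero)"
    unfolding st evf_br(4)[OF ev_X ev_Z] by (auto simp: zs) algebra+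
  show 2: "ev (Zt 2) = (op_zero, \<lambda>v. psm t (zop lam 2 v))"
    unfolding st(2) evf_br(3)[OF ev_X 1] by (auto simp: zs) algebra+
  show 3: "ev (Zt 3) = (\<lambda>v. psm t (zop lam 3 v), op_zero)"
    unfolding st(3) evf_br(4)[OF ev_X 2] by (auto simp: zs) algebra+
  show 4: "ev (Zt 4) = (op_zero, \<lambda>v. psm t (zop lam 4 v))"
    unfolding st(4) evf_br(3)[OF ev_X 3] by (auto simp: zs) algebra+
  show 5: "ev (Zt 5) = (\<lambda>v. psm t (zop lam 5 v), op_zero)"
    unfolding st(5) evf_br(4)[OF ev_X 4] by (auto simp: zs) algebra+
  show 6: "ev (Zt 6) = (op_zero, \<lambda>v. psm t (zop lam 6 v))"
    unfolding st(6) evf_br(3)[OF ev_X 5] by (auto simp: zs) algebra+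
  show "ev (Zt 7) = (op_zero, op_zero)"
    unfolding st(7) evf_br(4)[OF ev_X 6] by (auto simp: zs zero_prod_def) algebra+
qed

lemma ev_rels:
  assumes "(l, r) \<in> rels lam t"
  shows "evalp lam t l = evalp lam t r"
proof -
  note zs = fun_eq_iff zop_def Let_def psm_def smult_const_poly const_poly_hom pd op_simps zero_prod_def
    power2_eq_square power3_eq_cube
  have Y0: "(fbr fX ^^ 1) fY = fbr fX fY" "(fbr fX ^^ 2) fY = fbr fX (fbr fX fY)"
    by (simp_all add: numeral_2_eq_2)
  have "ev (fbr fY (fbr fX fY)) = ev 0"
    unfolding evf_br(2)[OF ev_Y ev_p] evf_simps(1) by (auto simp: zs)
  moreover have "ev (fbr (fbr fX (fbr fX fY)) fY) = ev (fscale 2 fY)"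
    unfolding evf_br(1)[OF ev_H ev_Y] evf_simps(3) ev_Y by (auto simp: zs algebra_simps)
  moreover have "ev (fbr (fbr fX (fbr fX fY)) fX) = ev (fscale (-1) fX)"
    unfolding evf_br(2)[OF ev_H ev_X] evf_simps(3) ev_X by (auto simp: zs algebra_simps)
  moreover have "ev (fbr fY fZ) = ev 0"
    unfolding evf_br(2)[OF ev_Y ev_Z] evf_simps(1) by (auto simp: zs)
  moreover have "ev (fbr (fbr fX fY) fZ) = ev 0"
    unfolding evf_br(4)[OF ev_p ev_Z] evf_simps(1) by (auto simp: zs)
  moreover have "ev (Zt 7) = ev 0"
    unfolding ev_Zt evf_simps(1) ..
  moreover have "ev (fbr (fbr fX (fbr fX fY)) fZ) = ev (fscale 3 fZ)"
    unfolding evf_br(2)[OF ev_H ev_Z] evf_simps(3) ev_Z by (auto simp: zs) algebra+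
  moreover have "ev (fscale 3 (fbr fZ (Zt 3)) + fscale 2 (fbr (Zt 1) (Zt 2)))
      = ev (fscale (6 * t * (2 * lam + 1)) fZ)"
    unfolding evf_simps(2,3) evf_br(3)[OF ev_Z ev_Zt(3)] evf_br(2)[OF ev_Zt(1) ev_Zt(2)] ev_Z
    by (auto simp: zs) algebra+
  moreover have "ev (fbr (Zt 1) (Zt 3)) = ev (fscale (2 * t^2 * (lam - 1) * (lam + 2)) fY
      + fscale (2 * t * (2 * lam + 1)) (Zt 1))"
    unfolding evf_simps(2,3) evf_br(1)[OF ev_Zt(1) ev_Zt(3)] ev_Y ev_Zt(1)
    by (auto simp: zs) algebra+
  moreover have "ev (fbr (Zt 1) (fbr fZ fZ)) = ev 0"
    unfolding evf_br(1)[OF ev_Zt(1) evf_br(4)[OF ev_Z ev_Z]] evf_simps(1)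
    by (auto simp: zs)
  ultimately have "ev (abs_free l) = ev (abs_free r)"
    using assms unfolding rels_def
    by (elim insertE emptyE) (auto simp only: prod.inject adX_simps abs_free_adX abs_free_simps Y0)
  then show ?thesis by (simp only: evf_abs)
qed

section \<open>Images of the lowest weight vectors\<close>

abbreviation (input) "fp \<equiv> fbr fX fY"
abbreviation (input) "fH \<equiv> fbr fX fp"

text \<open>Z_1 sends f to t(1 - lam) f' and g to -t(2 + lam) g', while p exchanges the components.
  So each bracket with Z_1 adds a derivative and multiplies by the difference 3t of the two scalars,
  with opposite signs on the two components.\<close>

lemma ev_pw:
  "ev ((fbr (fbr fX fZ) ^^ d) fp) = (op_zero,
     \<lambda>(f, g). (- const_poly ((3 * t) ^ d) * (pderiv ^^ d) g, - const_poly ((- 3 * t) ^ d) * pderiv ((pderiv ^^ d) f)))"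
proof (induction d)
  case 0
  then show ?case by (simp add: ev_p const_poly_hom)
next
  case (Suc d)
  have Z1: "ev (fbr fX fZ) = (\<lambda>(f, g). (const_poly (t * (1 - lam)) * pderiv f, const_poly (- t * (2 + lam)) * pderiv g), op_zero)"
    using ev_Zt(1) by (auto simp: fun_eq_iff zop_def Let_def psm_def smult_const_poly const_poly_hom algebra_simps)
  show ?case
    unfolding funpow.simps o_def evf_br(2)[OF Z1 Suc]
    by (auto simp: fun_eq_iff pd higher_pderiv_linear higher_pderiv_pderiv) (simp_all add: const_poly_hom(1-7) algebra_simps)
qed

lemma ev_free_low:
  "ev (free_low d) = (if even d
     then (\<lambda>(f, g). (const_poly (2 * (3 * t) ^ d) * pderiv ((pderiv ^^ d) f), const_poly (2 * (3 * t) ^ d) * pderiv ((pderiv ^^ d) g)), op_zero)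
     else (op_zero, \<lambda>(f, g). (- const_poly ((3 * t) ^ d) * (pderiv ^^ d) g, const_poly ((3 * t) ^ d) * pderiv ((pderiv ^^ d) f))))"
proof (cases "even d")
  case True
  then have "(- (3 * t)) ^ d = (3 * t) ^ d" by simp
  then show ?thesis
    unfolding free_low_def if_P[OF True] evf_br(4)[OF ev_p ev_pw]
    by (auto simp: fun_eq_iff const_poly_hom(1-7) pd higher_pderiv_linear higher_pderiv_pderiv)
next
  case False
  then show ?thesis
    by (auto simp: free_low_def ev_pw fun_eq_iff const_poly_hom(1-7))
qed

definition hom_ker :: "free_lie set" where "hom_ker = {x. ev x = (op_zero, op_zero)}"

lemma subspace_hom_ker: "free.subspace hom_ker"
  by (rule free.subspaceI) (simp_all add: hom_ker_def evf_simps fun_eq_iff op_simps)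

lemma hom_ker_br: "x \<in> hom_ker \<Longrightarrow> fbr x y \<in> hom_ker" "x \<in> hom_ker \<Longrightarrow> fbr y x \<in> hom_ker"
  using op_linear_evf[of lam t y]
  by (simp_all add: hom_ker_def evf_simps fun_eq_iff op_simps op_linearD del: split_paired_All)

lemma hom_ker_diff: "x \<in> hom_ker \<Longrightarrow> y \<in> hom_ker \<Longrightarrow> x - y \<in> hom_ker"
  by (rule free.subspace_diff[OF subspace_hom_ker])

lemma hom_ker_add: "x \<in> hom_ker \<Longrightarrow> y \<in> hom_ker \<Longrightarrow> x + y \<in> hom_ker"
  by (rule free.subspace_add[OF subspace_hom_ker])

lemma hom_ker_scale: "x \<in> hom_ker \<Longrightarrow> fscale c x \<in> hom_ker"
  by (rule free.subspace_scale[OF subspace_hom_ker])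

lemma hom_ker_zero: "0 \<in> hom_ker"
  by (rule free.subspace_0[OF subspace_hom_ker])

lemma p_free_low: "fbr fp (free_low d) \<in> hom_ker"
proof (cases "even d")
  case True
  note e = ev_free_low[of d, unfolded if_P[OF True]]
  show ?thesis
    unfolding hom_ker_def mem_Collect_eq evf_br(3)[OF ev_p e]
    by (auto simp: fun_eq_iff op_simps zero_prod_def pd higher_pderiv_linear higher_pderiv_pderiv)
next
  case False
  note e = ev_free_low[of d, unfolded if_not_P[OF False]]
  show ?thesis
    unfolding hom_ker_def mem_Collect_eq evf_br(4)[OF ev_p e]
    by (auto simp: fun_eq_iff op_simps zero_prod_def pd higher_pderiv_linear higher_pderiv_pderiv)
qed

lemma const_poly_of_nat: "const_poly (of_nat n) = of_nat n"
  by (simp add: const_poly_def of_nat_poly)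

lemma H_free_low: "fbr fH (free_low d) - fscale (of_nat (wt d)) (free_low d) \<in> hom_ker"
proof -
  have "ev (fbr fH (free_low d)) = ev (fscale (of_nat (wt d)) (free_low d))"
  proof (cases "even d")
    case True
    note e = ev_free_low[of d, unfolded if_P[OF True]]
    show ?thesis
      unfolding evf_br(1)[OF ev_H e] evf_simps(3) e using True
      by (auto simp: fun_eq_iff op_simps psm_def smult_const_poly const_poly_hom(1-7) const_poly_of_nat wt_def pd higher_pderiv_linear
          higher_pderiv_pderiv higher_pderiv_x mult.assoc zero_prod_def) (simp_all add: algebra_simps)
  next
    case False
    note e = ev_free_low[of d, unfolded if_not_P[OF False]]
    show ?thesis
      unfolding evf_br(2)[OF ev_H e] evf_simps(3) e using False
      by (auto simp: fun_eq_iff op_simps psm_def smult_const_poly const_poly_hom(1-7) const_poly_of_nat wt_def pd higher_pderiv_linear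
          higher_pderiv_pderiv higher_pderiv_x mult.assoc zero_prod_def) (simp_all add: algebra_simps)
  qed
  then have "ev (fbr fH (free_low d) + fscale (-1) (fscale (of_nat (wt d)) (free_low d))) = (op_zero, op_zero)"
    by (simp only: evf_simps) (simp add: fun_eq_iff op_simps)
  then show ?thesis by (simp add: hom_ker_def)
qed

lemma H_X_hom_ker: "fbr fH fX + fX \<in> hom_ker"
proof -
  have "ev (fbr fH fX + fX) = (op_zero, op_zero)"
    unfolding evf_simps(2) evf_br(2)[OF ev_H ev_X] ev_X
    by (auto simp: fun_eq_iff op_simps zero_prod_def pd) algebra+
  then show ?thesis by (simp add: hom_ker_def)
qed

section \<open>Chains of osp(1|2) modulo the kernel\<close>

text \<open>The factor in [p, X^i v] = c X^(i-1) v for a vector v of H-eigenvalue k killed by p. The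
  recursion is [p,[X,w]] = [H,w] - [X,[p,w]].\<close>

primrec low_coeff :: "nat \<Rightarrow> nat \<Rightarrow> complex" where
  "low_coeff k 0 = 0"
| "low_coeff k (Suc i) = of_nat k - of_nat i - low_coeff k i"

lemma low_coeff_closed: "low_coeff k (2 * j) = - of_nat j \<and> low_coeff k (2 * j + 1) = of_nat k - of_nat j"
  by (induction j) (simp_all add: algebra_simps)

text \<open>By the closed forms -j and k - j the first zero at a positive index is 2k + 1, so p
  leads back from every vector of the chain to its start.\<close>

lemma low_coeff_nonzero:
  assumes "0 < i" "i \<le> 2 * k"
  shows "low_coeff k i \<noteq> 0"
proof (cases "even i")
  case True
  then show ?thesis using low_coeff_closed[of k] assms by (auto elim!: evenE)
next
  case False
  then obtain j where "i = 2 * j + 1" by (auto elim!: oddE)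
  then show ?thesis using low_coeff_closed[of k j] assms by auto
qed

abbreviation (input) "XW i d \<equiv> (fbr fX ^^ i) (free_low d)"

lemma H_XW: "fbr fH (XW i d) - fscale (of_nat (wt d) - of_nat i) (XW i d) \<in> hom_ker"
proof (induction i)
  case 0
  then show ?case using H_free_low by simp
next
  case (Suc i)
  have par: "fpar False fH" "fpar True fX"
    using fpar_abs[OF hom.intros(1), of GX] fpar_abs[OF hom.intros(1), of GY]
      free.par_br_oo[of fX fp] free.par_br_oe[of fX fY] by simp_all
  have "fbr fH (XW (Suc i) d) - fscale (of_nat (wt d) - of_nat (Suc i)) (XW (Suc i) d)
      = fbr (fbr fH fX + fX) (XW i d) + fbr fX (fbr fH (XW i d) - fscale (of_nat (wt d) - of_nat i) (XW i d))"
    using free.jacobi_eo[OF par, of "XW i d"]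
    by (simp add: free.br_add_left free.br_diff_right free.br_scale_right free.scale_left_diff_distrib
        free.scale_left_distrib)
  also have "\<dots> \<in> hom_ker" by (intro hom_ker_add hom_ker_br H_X_hom_ker Suc)
  finally show ?case .
qed

lemma p_XW: "fbr fp (XW i d) - fscale (low_coeff (wt d) i) (XW (i - 1) d) \<in> hom_ker"
proof (induction i)
  case 0
  then show ?case using p_free_low by simp
next
  case (Suc i)
  have par: "fpar True fX" "fpar True fp"
    using fpar_abs[OF hom.intros(1), of GX] fpar_abs[OF hom.intros(1), of GY]
      free.par_br_oe[of fX fY] by simp_all
  have X: "fscale (low_coeff (wt d) i) (XW i d) = fbr fX (fscale (low_coeff (wt d) i) (XW (i - 1) d))"
    by (cases i) (simp_all add: free.br_scale_right)
  have "fbr fp (XW (Suc i) d) - fscale (low_coeff (wt d) (Suc i)) (XW i d)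
     = (fbr fH (XW i d) - fscale (of_nat (wt d) - of_nat i) (XW i d))
       - (fbr fX (fbr fp (XW i d)) - fscale (low_coeff (wt d) i) (XW i d))"
    using free.jacobi_odd[OF par, of "XW i d"]
    by (simp add: free.scale_left_diff_distrib)
  also have "fbr fX (fbr fp (XW i d)) - fscale (low_coeff (wt d) i) (XW i d)
      = fbr fX (fbr fp (XW i d) - fscale (low_coeff (wt d) i) (XW (i - 1) d))"
    by (simp add: X free.br_diff_right)
  finally show ?case using H_XW[of i d] Suc hom_ker_br(2) hom_ker_diff by simp
qed

lemma fp_pow_lin:
  "(fbr z ^^ n) (x + y) = (fbr z ^^ n) x + (fbr z ^^ n) y"
  "(fbr z ^^ n) (x - y) = (fbr z ^^ n) x - (fbr z ^^ n) y"
  "(fbr z ^^ n) (fscale c x) = fscale c ((fbr z ^^ n) x)"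
  "(fbr z ^^ n) 0 = 0"
  by (induction n) (simp_all add: free.br_add_right free.br_diff_right free.br_scale_right)

lemma fp_pow_hom_ker: "x \<in> hom_ker \<Longrightarrow> (fbr z ^^ n) x \<in> hom_ker"
  by (induction n) (simp_all add: hom_ker_br)

lemma fp_pow_XW:
  assumes "i \<le> 2 * wt d"
  shows "\<exists>k. k \<noteq> 0 \<and> (fbr fp ^^ i) (XW i d) - fscale k (free_low d) \<in> hom_ker"
  using assms
proof (induction i)
  case 0
  then show ?case by (intro exI[of _ 1]) (simp add: hom_ker_zero)
next
  case (Suc i)
  then obtain k where k: "k \<noteq> 0" "(fbr fp ^^ i) (XW i d) - fscale k (free_low d) \<in> hom_ker" by auto
  let ?g = "low_coeff (wt d) (Suc i)"
  have "(fbr fp ^^ i) (fbr fp (XW (Suc i) d) - fscale ?g (XW i d)) \<in> hom_ker"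
    using p_XW[of "Suc i" d] by (intro fp_pow_hom_ker) simp
  then have "(fbr fp ^^ Suc i) (XW (Suc i) d) - fscale ?g ((fbr fp ^^ i) (XW i d)) \<in> hom_ker"
    by (simp only: funpow_Suc_right o_apply fp_pow_lin)
  from hom_ker_add[OF this hom_ker_scale[OF k(2), of ?g]]
  have "(fbr fp ^^ Suc i) (XW (Suc i) d) - fscale (?g * k) (free_low d) \<in> hom_ker"
    by (simp add: free.scale_right_diff_distrib)
  moreover have "?g * k \<noteq> 0" using k(1) low_coeff_nonzero[of "Suc i" "wt d"] Suc.prems by simp
  ultimately show ?case by blast
qed

lemma fp_pow_XW_zero:
  assumes "i < n"
  shows "(fbr fp ^^ n) (XW i d) \<in> hom_ker"
  using assms
proof (induction i arbitrary: n)
  case 0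
  then obtain m where n: "n = Suc m" by (cases n) auto
  show ?case unfolding n funpow_Suc_right o_apply by (intro fp_pow_hom_ker) (use p_free_low in simp)
next
  case (Suc i)
  then obtain m where n: "n = Suc m" "i < m" by (cases n) auto
  let ?g = "low_coeff (wt d) (Suc i)"
  have "(fbr fp ^^ m) (fbr fp (XW (Suc i) d) - fscale ?g (XW i d)) \<in> hom_ker"
    using p_XW[of "Suc i" d] by (intro fp_pow_hom_ker) simp
  then have "(fbr fp ^^ n) (XW (Suc i) d) - fscale ?g ((fbr fp ^^ m) (XW i d)) \<in> hom_ker"
    unfolding n(1) by (simp only: funpow_Suc_right o_apply fp_pow_lin)
  from hom_ker_add[OF this hom_ker_scale[OF Suc.IH[OF n(2)], of ?g]] show ?case by simp
qed

section \<open>Linear independence of the operators\<close>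

definition act :: "free_lie \<Rightarrow> sfun \<Rightarrow> sfun" where
  "act x v = fst (ev x) v + snd (ev x) v"

lemma act_lin: "act (x + y) v = act x v + act y v" "act (fscale c x) v = psm c (act x v)" "act 0 v = 0"
  by (simp_all add: act_def evf_simps op_simps)

lemma act_hom_ker: "x \<in> hom_ker \<Longrightarrow> act x v = 0"
  by (simp add: hom_ker_def act_def op_simps)

lemma act_cong: "x - y \<in> hom_ker \<Longrightarrow> act x v = act y v"
  using act_hom_ker[of "x - y" v] act_lin(1)[of "x - y" y v] by simp

lemma act_sum: "act (sum f A) v = (\<Sum>s\<in>A. act (f s) v)"
  by (induction A rule: infinite_finite_induct) (simp_all add: act_lin)

text \<open>On (f, 0) only the derivative of f of order d + 1 occurs. This is why the test function
  for degree n is x^(n+1).\<close>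

lemma act_free_low:
  assumes "t \<noteq> 0"
  shows "n < d \<Longrightarrow> act (free_low d) (monom 1 (Suc n), 0) = 0"
    and "act (free_low d) (monom 1 (Suc d), 0) \<noteq> 0"
proof -
  have dn0: "(pderiv ^^ k) (0 :: complex poly) = 0" for k by (induction k) simp_all
  have dn: "(pderiv ^^ n) (monom 1 n :: complex poly) = [:fact n:]" for n
  proof -
    have "(pderiv ^^ n) (monom c n) = [:c * fact n:]" for c :: complex
    proof (induction n arbitrary: c)
      case (Suc n)
      then show ?case by (simp add: funpow_Suc_right pderiv_monom algebra_simps del: funpow.simps)
    qed (simp add: monom_0)
    then show ?thesis by simp
  qed
  show "act (free_low d) (monom 1 (Suc d), 0) \<noteq> 0"
  proof -
    have "pderiv ((pderiv ^^ d) (monom 1 (Suc d))) \<noteq> (0 :: complex poly)"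
      using dn[of "Suc d"] by (simp del: fact_Suc)
    then show ?thesis
      using assms by (auto simp: act_def ev_free_low op_simps dn0 zero_prod_def const_poly_def)
  qed
  show "act (free_low d) (monom 1 (Suc n), 0) = 0" if nd: "n < d"
  proof -
    obtain k where k: "d = Suc n + k" using less_imp_Suc_add[OF nd] by auto
    have "(pderiv ^^ (k + Suc n)) (monom 1 (Suc n) :: complex poly) = (pderiv ^^ k) [:fact (Suc n):]"
      by (simp only: funpow_add o_apply dn)
    then have "pderiv ((pderiv ^^ d) (monom 1 (Suc n) :: complex poly)) = (pderiv ^^ k) (pderiv [:fact (Suc n):])"
      by (simp only: k add.commute higher_pderiv_pderiv)
    then have "pderiv ((pderiv ^^ d) (monom 1 (Suc n) :: complex poly)) = 0"
      by (simp add: pderiv_pCons dn0)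
    then show ?thesis
      by (auto simp: act_def ev_free_low op_simps dn0 zero_prod_def)
  qed
qed

text \<open>Let N be the largest power of X with a nonzero coefficient and n the least degree
  occurring with it. Applying p N times kills the smaller powers and turns the others into lowest
  weight vectors; all of these with d > n annihilate x^(n+1). The coefficient at (N, n) would have
  to be zero.\<close>

lemma free_basis_independent:
  assumes t: "t \<noteq> 0" and y: "y \<in> free.span (\<Union>d. free_basis d)" "y \<in> hom_ker"
  shows "y = 0"
proof -
  let ?g = "\<lambda>(i, d). XW i d"
  define S where "S = {(i, d). i \<le> 2 * wt d}"
  have "(\<Union>d. free_basis d) = ?g ` S" by (auto simp: free_basis_def S_def)
  with y(1) obtain T r where T: "finite T" "T \<subseteq> ?g ` S" "y = (\<Sum>a\<in>T. fscale (r a) a)"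
    unfolding free.span_explicit by auto
  \<comment> \<open>Restricting to an injective set of indices avoids proving beforehand that the
    chain vectors are distinct in the free algebra.\<close>
  from T(2) obtain A where A: "A \<subseteq> S" "inj_on ?g A" "T = ?g ` A"
    unfolding subset_image_inj by blast
  define c where "c = (\<lambda>s. r (?g s))"
  have yA: "y = (\<Sum>s\<in>A. fscale (c s) (?g s))"
    unfolding T(3) A(3) c_def by (rule sum.reindex_cong[OF A(2)]) auto
  have finA: "finite A" using T(1) A(2,3) by (simp add: finite_image_iff)
  show ?thesis
  proof (rule ccontr)
    assume "y \<noteq> 0"
    define A' where "A' = {s \<in> A. c s \<noteq> 0}"
    have fin: "finite A'" using finA by (simp add: A'_def)
    have yA': "y = (\<Sum>s\<in>A'. fscale (c s) (?g s))"
      unfolding yA by (rule sum.mono_neutral_right[OF finA]) (auto simp: A'_def)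
    have ne: "A' \<noteq> {}" using \<open>y \<noteq> 0\<close> yA' by auto
    define N where "N = Max (fst ` A')"
    have N: "i \<le> N" if "(i, d) \<in> A'" for i d
      unfolding N_def using that fin by (intro Max_ge) force+
    have "N \<in> fst ` A'"
      unfolding N_def using fin ne by (intro Max_in) auto
    then obtain d0 where "(N, d0) \<in> A'" by auto
    define n where "n = (LEAST d. (N, d) \<in> A')"
    have n: "(N, n) \<in> A'" and n_le: "\<And>d. (N, d) \<in> A' \<Longrightarrow> n \<le> d"
      unfolding n_def using \<open>(N, d0) \<in> A'\<close> by (auto intro: LeastI Least_le)
    let ?v = "(monom 1 (Suc n), 0) :: sfun"
    have zero: "act ((fbr fp ^^ N) (?g s)) ?v = 0" if "s \<in> A' - {(N, n)}" for s
    proof -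
      obtain i d where s: "s = (i, d)" by (cases s)
      show ?thesis
      proof (cases "i < N")
        case True
        then show ?thesis using act_hom_ker fp_pow_XW_zero s by auto
      next
        case False
        then have i: "i = N" "n < d" using N n_le that s by (force simp: le_less)+
        then have "i \<le> 2 * wt d" using that s A(1) by (auto simp: A'_def S_def)
        then obtain k where "(fbr fp ^^ i) (XW i d) - fscale k (free_low d) \<in> hom_ker"
          using fp_pow_XW by blast
        then have "act ((fbr fp ^^ N) (?g s)) ?v = psm k (act (free_low d) ?v)"
          using i s by (simp add: act_cong[of _ "fscale k (free_low d)"] act_lin)
        then show ?thesis using act_free_low(1)[OF t i(2)] by simp
      qed
    qed
    have "N \<le> 2 * wt n" using n A(1) by (auto simp: A'_def S_def)
    then obtain k where k: "k \<noteq> 0" "(fbr fp ^^ N) (XW N n) - fscale k (free_low n) \<in> hom_ker"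
      using fp_pow_XW by blast
    have powsum: "(fbr fp ^^ N) (sum f B) = (\<Sum>s\<in>B. (fbr fp ^^ N) (f s))" for f and B :: "(nat \<times> nat) set"
      by (induction B rule: infinite_finite_induct) (simp_all add: fp_pow_lin)
    have "0 = act ((fbr fp ^^ N) y) ?v"
      using act_hom_ker[OF fp_pow_hom_ker[OF y(2)]] by simp
    also have "\<dots> = (\<Sum>s\<in>A'. psm (c s) (act ((fbr fp ^^ N) (?g s)) ?v))"
      unfolding yA' powsum act_sum by (simp add: fp_pow_lin act_lin)
    also have "\<dots> = psm (c (N, n)) (act ((fbr fp ^^ N) (?g (N, n))) ?v)
        + (\<Sum>s\<in>A' - {(N, n)}. psm (c s) (act ((fbr fp ^^ N) (?g s)) ?v))"
      by (rule sum.remove[OF fin n])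
    also have "(\<Sum>s\<in>A' - {(N, n)}. psm (c s) (act ((fbr fp ^^ N) (?g s)) ?v)) = 0"
      using zero by (intro sum.neutral) simp
    also have "act ((fbr fp ^^ N) (?g (N, n))) ?v = psm k (act (free_low n) ?v)"
      using k(2) by (simp add: act_cong[of _ "fscale k (free_low n)"] act_lin)
    finally have "psm (c (N, n) * k) (act (free_low n) ?v) = 0" by simp
    moreover have "c (N, n) \<noteq> 0" using n by (simp add: A'_def)
    ultimately show False using k(1) act_free_low(2)[OF t, of n] by (simp add: psm_eq_0_iff)
  qed
qed

text \<open>Modulo the relations an element of the kernel is a combination of chain vectors, which
  again lies in the kernel and is therefore zero.\<close>

lemma rel_ideal_eq_hom_ker:
  assumes "t \<noteq> 0"
  shows "x \<in> rel_ideal (rels lam t) \<longleftrightarrow> x \<in> hom_ker"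
proof -
  have IK: "x \<in> hom_ker" if x: "x \<in> rel_ideal (rels lam t)" for x
  proof -
    obtain e where e: "x = abs_free e" "liecong (rels lam t) e Zero"
      using x by (auto simp: rel_ideal_def)
    then show ?thesis
      using evalp_cong[OF ev_rels e(2)] by (simp add: hom_ker_def evf_abs)
  qed
  moreover have "x \<in> rel_ideal (rels lam t)" if "x \<in> hom_ker"
  proof -
    obtain y where y: "y \<in> free.span (\<Union>d. free_basis d)" "x - y \<in> rel_ideal (rels lam t)"
      using span_free_basis by blast
    have "y \<in> hom_ker" using hom_ker_diff[OF that IK[OF y(2)]] by simp
    then have "y = 0" using free_basis_independent[OF assms y(1)] by simp
    then show ?thesis using y(2) by simp
  qed
  ultimately show ?thesis by blast
qed

end

section \<open>Separation of parities and surjectivity\<close>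

text \<open>The automorphism theta to -theta of the functions. Even operators commute with it and
  odd ones anticommute, which separates the two summands of \<open>nat_hom\<close>.\<close>

definition flip_odd :: "sfun \<Rightarrow> sfun" where "flip_odd v = (fst v, - snd v)"

lemma flip_odd_simps [simp]:
  "flip_odd (u + v) = flip_odd u + flip_odd v" "flip_odd (u - v) = flip_odd u - flip_odd v"
  "flip_odd (- v) = - flip_odd v" "flip_odd (psm c v) = psm c (flip_odd v)" "flip_odd 0 = 0"
  "flip_odd u = flip_odd v \<longleftrightarrow> u = v"
  by (auto simp: flip_odd_def psm_def prod_eq_iff)

lemma evalp_flip_odd:
  "fst (evalp lam t e) (flip_odd v) = flip_odd (fst (evalp lam t e) v) \<and>
   snd (evalp lam t e) (flip_odd v) = - flip_odd (snd (evalp lam t e) v)"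
proof (induction e arbitrary: v)
  case (Gen g)
  obtain x y where v: "v = (x, y)" by (cases v)
  show ?case
    unfolding v by (cases g) (simp_all add: flip_odd_def opX_def opY_def opZ_def op_simps d_x_def d_th_def
      mul_x_def mul_th_def psm_def prod_eq_iff pderiv_minus)
qed (simp_all add: op_simps evalp_linear)

lemma nat_hom_eq_zero_iff:
  "nat_hom lam t e = op_zero \<longleftrightarrow> evalp lam t e = (op_zero, op_zero)"
proof
  let ?A = "fst (evalp lam t e)" and ?B = "snd (evalp lam t e)"
  assume "nat_hom lam t e = op_zero"
  then have sum: "?A v + ?B v = 0" for v
    by (simp add: nat_hom_def fun_eq_iff op_simps del: split_paired_All)
  have "?A v = 0 \<and> ?B v = 0" for v
  proof -
    have "flip_odd (?A v - ?B v) = 0"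
      using sum[of "flip_odd v"] by (simp add: evalp_flip_odd)
    then have "?A v = ?B v"
      using flip_odd_simps(6)[of "?A v - ?B v" 0] by simp
    moreover from this have "psm 2 (?A v) = 0"
      using sum[of v] psm_add_left[of 1 1 "?A v"] by simp
    ultimately show ?thesis by (simp add: psm_eq_0_iff)
  qed
  then show "evalp lam t e = (op_zero, op_zero)"
    by (simp add: prod_eq_iff[of "evalp lam t e"] fun_eq_iff op_simps del: split_paired_All)
qed (simp add: nat_hom_def fun_eq_iff op_simps)

lemma ospH_evalp: "ospH lam t (fst (evalp lam t e)) False \<and> ospH lam t (snd (evalp lam t e)) True"
proof (induction e)
  case (Gen g)
  then show ?case by (cases g) (auto intro: ospH.intros(1-4))
next
  case (Br a b)
  then show ?case
    using ospH.br[of lam t _ False _ False] ospH.br[of lam t _ True _ True]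
      ospH.br[of lam t _ False _ True] ospH.br[of lam t _ True _ False]
    by (auto intro!: ospH.add)
qed (auto intro: ospH.intros(4-6))

text \<open>Each generated operator is lifted with zero in the component of the other parity; only
  then does a bracket of lifts evaluate to the single bracket \<open>op_br\<close>.\<close>

lemma ospH_evf: "ospH lam t A r \<Longrightarrow> \<exists>x. evf lam t x = (if r then (op_zero, A) else (A, op_zero))"
proof (induction rule: ospH.induct)
  case (zero r)
  then show ?case by (intro exI[of _ 0]) (simp add: evf_simps)
next
  case (add A r B)
  then obtain x y where "evf lam t x = (if r then (op_zero, A) else (A, op_zero))"
    "evf lam t y = (if r then (op_zero, B) else (B, op_zero))" by blast
  then show ?case by (intro exI[of _ "x + y"]) (simp add: evf_simps fun_eq_iff op_simps)
next
  case (smul A r c)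
  then obtain x where "evf lam t x = (if r then (op_zero, A) else (A, op_zero))" by blast
  then show ?case by (intro exI[of _ "fscale c x"]) (simp add: evf_simps fun_eq_iff op_simps)
next
  case (br A r B q)
  then obtain x y where "evf lam t x = (if r then (op_zero, A) else (A, op_zero))"
    "evf lam t y = (if q then (op_zero, B) else (B, op_zero))" by blast
  then show ?case
    using evf_br[of lam t x A y B]
    by (intro exI[of _ "fbr x y"])
      (cases r; cases q; simp add: fun_eq_iff op_simps sgn_par_def del: split_paired_All)
qed (auto intro: exI[of _ fX] exI[of _ fY] exI[of _ fZ] simp: evf_abs)

theorem theorem4p3:
  fixes lam t :: complex
  assumes "lam \<notin> \<int>" and "t \<noteq> 0"
  shows "(\<forall>e. nat_hom lam t e \<in> osp lam t)
       \<and> (\<forall>A \<in> osp lam t. \<exists>e. nat_hom lam t e = A)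
       \<and> (\<forall>e. nat_hom lam t e = op_zero \<longleftrightarrow> liecong (rels lam t) e Zero)"
proof (intro conjI allI ballI)
  fix e
  show "nat_hom lam t e \<in> osp lam t"
    using ospH_evalp[of lam t e] unfolding nat_hom_def osp_def by blast
next
  fix A assume "A \<in> osp lam t"
  then obtain B C where A: "A = op_add B C" "ospH lam t B False" "ospH lam t C True"
    by (auto simp: osp_def)
  obtain x y where xy: "evf lam t x = (B, op_zero)" "evf lam t y = (op_zero, C)"
    using ospH_evf[OF A(2)] ospH_evf[OF A(3)] by auto
  obtain e where e: "x + y = abs_free e" by (rule abs_free_cases)
  have "evalp lam t e = (op_add B op_zero, op_add op_zero C)"
    unfolding evf_abs[symmetric] e[symmetric] by (simp add: evf_simps xy)
  then have "nat_hom lam t e = A"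
    by (simp add: nat_hom_def A(1) fun_eq_iff op_simps)
  then show "\<exists>e. nat_hom lam t e = A" by blast
next
  fix e
  show "nat_hom lam t e = op_zero \<longleftrightarrow> liecong (rels lam t) e Zero"
    using rel_ideal_eq_hom_ker[OF assms(2), of "abs_free e" lam]
    by (simp add: nat_hom_eq_zero_iff rel_ideal_abs hom_ker_def evf_abs)
qed

end
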